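(* Let the hypotheses of Lemma 4.2 hold: $m\ge1$, $1\le q^*,r_i^*,q_i^*,\zeta<\infty$, $\omega\in A_\zeta(\mathbb Q_p^n)$ with finite critical index $r_\omega$, $\delta\in(1,r_\omega)$, $\zeta\le r_i^*$, $b_i\in CMO^{r_i^*}_\omega(\mathbb Q_p^n)$ for all $i$, and $\frac1{q^*}>\big(\sum_i\frac1{r_i^*}+\sum_i\frac1{q_i^*}\big)\zeta\frac{r_\omega}{r_\omega-1}$. Let $\lambda_i\in(-\frac1{q_i^*},0)$ for all $i$ and $\lambda=\lambda_1+\cdots+\lambda_m$. If $$\mathcal C_{10}=\int_{\mathbb Q_p^n}\frac{\Phi(y)}{|y|_p^n}\prod_{i=1}^m\psi_i^*(y)\mu_i^*(y)\Big(\chi_{\{\|A_i(y)\|_p\le1\}}(y)\|A_i(y)\|_p^{n\zeta\lambda_i}+\chi_{\{\|A_i(y)\|_p>1\}}(y)\|A_i(y)\|_p^{\frac{n\lambda_i(\delta-1)}{\delta}}\Big)dy<\infty,$$ then $\mathcal H^p_{\Phi,\vec A,\vec b}$ is bounded from $\dot B^{q_1^*,\lambda_1}_\omega(\mathbb Q_p^n)\times\cdots\times\dot B^{q_m^*,\lambda_m}_\omega(\mathbb Q_p^n)$ to $\dot B^{q^*,\lambda}_\omega(\mathbb Q_p^n)$, with norm at most $C\,\mathcal C_{10}\prod_i\|b_i\|_{CMO^{r_i^*}_\omega}$.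
   Context: Let $p$ be a prime, $\mathbb Q_p$ the $p$-adic numbers with absolute value $|\cdot|_p$; for $x\in\mathbb Q_p^n$, $|x|_p=\max_j|x_j|_p$. $dx$ is the Haar measure on $\mathbb Q_p^n$ normalized so that $B_0$ has measure 1, $|E|$ the measure of $E$, $B_\gamma=\{x:|x|_p\le p^\gamma\}$; balls are sets $\{x:|x-a|_p\le p^\gamma\}$. For an $n\times n$ matrix $A=(a_{ij})$ over $\mathbb Q_p$, $\|A\|_p=\max_{i,j}|a_{ij}|_p$. For a weight $\omega$, $\omega(E)=\int_E\omega$. $CMO^q_\omega(\mathbb Q_p^n)$: $f$ locally in $L^q_\omega$ with $\|f\|_{CMO^q_\omega}=\sup_{\gamma}\big(\frac1{\omega(B_\gamma)}\int_{B_\gamma}|f-f_{B_\gamma}|^q\omega\big)^{1/q}<\infty$, $f_{B_\gamma}=\frac1{|B_\gamma|}\int_{B_\gamma}f$. $\dot B^{q,\lambda}_\omega(\mathbb Q_p^n)$ ($\lambda\in\mathbb R$, $1\le q<\infty$): $f$ locally in $L^q_\omega$ with $\|f\|_{\dot B^{q,\lambda}_\omega}=\sup_{\gamma\in\mathbb Z}\big(\omega(B_\gamma)^{-1-\lambda q}\int_{B_\gamma}|f|^q\omega\big)^{1/q}<\infty$. For $1<\zeta<\infty$, $\omega\in A_\zeta$ means $\big(\frac1{|B|}\int_B\omega\big)\big(\frac1{|B|}\int_B\omega^{-1/(\zeta-1)}\big)^{\zeta-1}\le C$ for all balls; $\omega\in A_1$ means $\frac1{|B|}\int_B\omega\le C\operatorname{ess\,inf}_B\omega$.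 $\omega\in RH_r$ means $\big(\frac1{|B|}\int_B\omega^r\big)^{1/r}\le\frac C{|B|}\int_B\omega$ for all balls; $r_\omega=\sup\{r>1:\omega\in RH_r\}$. Let $\Phi:\mathbb Q_p^n\to[0,\infty)$ be measurable and $A_i(y)$ $n\times n$ matrices over $\mathbb Q_p$, measurable in $y$, invertible a.e. $\mathcal H^p_{\Phi,\vec A,\vec b}(\vec f)(x)=\int\frac{\Phi(y)}{|y|_p^n}\prod_i\big(b_i(x)-b_i(A_i(y)x)\big)\prod_i f_i(A_i(y)x)\,dy$. $\psi_i^*(y)=1+\frac{2\|A_i(y)\|_p^n}{|\det A_i(y)|_p}+|\det A_i^{-1}(y)|_p^{\zeta/r_i^*}\|A_i(y)\|_p^{n\zeta/r_i^*}+|\log_p\|A_i(y)\|_p|$ and $\mu_i^*(y)=|\det A_i^{-1}(y)|_p^{\zeta/q_i^*}\|A_i(y)\|_p^{n\zeta/q_i^*}$. *)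

theory Defs
  imports "HOL-Analysis.Analysis" "HOL-Computational_Algebra.Factorial_Ring"
begin

definition padic_abs_rat :: "nat \<Rightarrow> rat \<Rightarrow> real" where
  "padic_abs_rat p q =
     (if q = 0 then 0
      else (case quotient_of q of (a, b) \<Rightarrow>
              real p powr (- (real (multiplicity (int p) a) - real (multiplicity (int p) b)))))"

text \<open>A type 'a together with absp is (a model of) Q_p: a field of characteristic 0 with a
  non-archimedean absolute value extending the p-adic absolute value of Q, in which Q is
  dense, and which is complete. (This is the definition of the completion of Q w.r.t.
  the p-adic absolute value; it determines Q_p up to isometric isomorphism.)\<close>
definition is_Qp :: "nat \<Rightarrow> ('a::field_char_0 \<Rightarrow> real) \<Rightarrow> bool" where
  "is_Qp p absp \<longleftrightarrow>
     prime p \<and>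
     (\<forall>x. 0 \<le> absp x) \<and> (\<forall>x. absp x = 0 \<longleftrightarrow> x = 0) \<and>
     (\<forall>x y. absp (x * y) = absp x * absp y) \<and>
     (\<forall>x y. absp (x + y) \<le> max (absp x) (absp y)) \<and>
     (\<forall>q. absp (of_rat q) = padic_abs_rat p q) \<and>
     (\<forall>x. \<forall>e>0. \<exists>q. absp (x - of_rat q) < e) \<and>
     (\<forall>X::nat \<Rightarrow> 'a. (\<forall>e>0. \<exists>N. \<forall>j\<ge>N. \<forall>k\<ge>N. absp (X j - X k) < e)
          \<longrightarrow> (\<exists>L. \<forall>e>0. \<exists>N. \<forall>k\<ge>N. absp (X k - L) < e))"

definition vnorm :: "('a \<Rightarrow> real) \<Rightarrow> 'a^'n::finite \<Rightarrow> real" where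
  "vnorm absp x = Max (range (\<lambda>j. absp (x $ j)))"

definition mnorm :: "('a \<Rightarrow> real) \<Rightarrow> 'a^'n::finite^'n \<Rightarrow> real" where
  "mnorm absp A = Max (range (\<lambda>(i,j). absp (A $ i $ j)))"

definition pball :: "nat \<Rightarrow> ('a::ab_group_add \<Rightarrow> real) \<Rightarrow> 'a^'n::finite \<Rightarrow> int \<Rightarrow> ('a^'n) set" where
  "pball p absp a g = {x. vnorm absp (x - a) \<le> real p powr real_of_int g}"

abbreviation B0 :: "nat \<Rightarrow> ('a::ab_group_add \<Rightarrow> real) \<Rightarrow> int \<Rightarrow> ('a^'n::finite) set" where
  "B0 p absp g \<equiv> pball p absp 0 g"

text \<open>One-dimensional balls, generating the Borel sigma algebra of Q_p.\<close>
definition Qp_space :: "nat \<Rightarrow> ('a::ab_group_add \<Rightarrow> real) \<Rightarrow> 'a measure" where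
  "Qp_space p absp = sigma UNIV (range (\<lambda>(a, g::int). {x. absp (x - a) \<le> real p powr real_of_int g}))"

text \<open>M is the Haar measure on Q_p^n normalized by |B_0| = 1: a translation invariant
  measure on the Borel sigma algebra (generated by the balls) with |B_0| = 1.
  Such a measure is unique.\<close>
definition is_haar :: "nat \<Rightarrow> ('a::ab_group_add \<Rightarrow> real) \<Rightarrow> ('a^'n::finite) measure \<Rightarrow> bool" where
  "is_haar p absp M \<longleftrightarrow>
     space M = UNIV \<and>
     sets M = sigma_sets UNIV (range (\<lambda>(a, g). pball p absp a g)) \<and>
     (\<forall>E\<in>sets M. \<forall>a. emeasure M ((\<lambda>x. a + x) ` E) = emeasure M E) \<and>
     emeasure M (B0 p absp 0) = 1"

definition wm :: "'b measure \<Rightarrow> ('b \<Rightarrow> real) \<Rightarrow> 'b set \<Rightarrow> real" where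
  "wm M w E = (LINT x:E|M. w x)"

definition avg :: "'b measure \<Rightarrow> 'b set \<Rightarrow> ('b \<Rightarrow> real) \<Rightarrow> real" where
  "avg M E f = (LINT x:E|M. f x) / measure M E"

definition A_class :: "nat \<Rightarrow> ('a::ab_group_add \<Rightarrow> real) \<Rightarrow> ('a^'n::finite) measure
                        \<Rightarrow> real \<Rightarrow> ('a^'n \<Rightarrow> real) \<Rightarrow> bool" where
  "A_class p absp M zeta w \<longleftrightarrow>
     w \<in> borel_measurable M \<and> (AE x in M. 0 < w x) \<and>
     (if zeta = 1 then
        (\<exists>C. \<forall>a g. set_integrable M (pball p absp a g) w \<and>
              (AE x in M. x \<in> pball p absp a g \<longrightarrow> avg M (pball p absp a g) w \<le> C * w x))
      else
        (\<exists>C. \<forall>a g. set_integrable M (pball p absp a g) w \<and>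
              set_integrable M (pball p absp a g) (\<lambda>x. w x powr (- 1 / (zeta - 1))) \<and>
              avg M (pball p absp a g) w *
                avg M (pball p absp a g) (\<lambda>x. w x powr (- 1 / (zeta - 1))) powr (zeta - 1) \<le> C))"

definition RH_class :: "nat \<Rightarrow> ('a::ab_group_add \<Rightarrow> real) \<Rightarrow> ('a^'n::finite) measure
                        \<Rightarrow> real \<Rightarrow> ('a^'n \<Rightarrow> real) \<Rightarrow> bool" where
  "RH_class p absp M r w \<longleftrightarrow>
     (\<exists>C. \<forall>a g. set_integrable M (pball p absp a g) w \<and>
           set_integrable M (pball p absp a g) (\<lambda>x. w x powr r) \<and>
           avg M (pball p absp a g) (\<lambda>x. w x powr r) powr (1 / r)
             \<le> C * avg M (pball p absp a g) w)"

definition RH_set :: "nat \<Rightarrow> ('a::ab_group_add \<Rightarrow> real) \<Rightarrow> ('a^'n::finite) measure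
                        \<Rightarrow> ('a^'n \<Rightarrow> real) \<Rightarrow> real set" where
  "RH_set p absp M w = {r. 1 < r \<and> RH_class p absp M r w}"

definition crit_index :: "nat \<Rightarrow> ('a::ab_group_add \<Rightarrow> real) \<Rightarrow> ('a^'n::finite) measure
                        \<Rightarrow> ('a^'n \<Rightarrow> real) \<Rightarrow> real" where
  "crit_index p absp M w = Sup (RH_set p absp M w)"

definition loc_Lq :: "nat \<Rightarrow> ('a::ab_group_add \<Rightarrow> real) \<Rightarrow> ('a^'n::finite) measure
                      \<Rightarrow> ('a^'n \<Rightarrow> real) \<Rightarrow> real \<Rightarrow> ('a^'n \<Rightarrow> complex) \<Rightarrow> bool" where
  "loc_Lq p absp M w q f \<longleftrightarrow>
     f \<in> borel_measurable M \<and>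
     (\<forall>g. set_integrable M (B0 p absp g) (\<lambda>x. norm (f x) powr q * w x))"

definition mean :: "('a^'n::finite) measure \<Rightarrow> ('a^'n) set \<Rightarrow> ('a^'n \<Rightarrow> complex) \<Rightarrow> complex" where
  "mean M E f = (LINT x:E|M. f x) / complex_of_real (measure M E)"

definition cmo_osc :: "nat \<Rightarrow> ('a::ab_group_add \<Rightarrow> real) \<Rightarrow> ('a^'n::finite) measure
                      \<Rightarrow> ('a^'n \<Rightarrow> real) \<Rightarrow> real \<Rightarrow> ('a^'n \<Rightarrow> complex) \<Rightarrow> int \<Rightarrow> real" where
  "cmo_osc p absp M w q f g =
     (1 / wm M w (B0 p absp g) *
       (LINT x:(B0 p absp g)|M. norm (f x - mean M (B0 p absp g) f) powr q * w x)) powr (1 / q)"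

text \<open>Membership in CMO^q_omega (f_{B_gamma} is required to exist, i.e. f is integrable on B_gamma).\<close>
definition in_CMO :: "nat \<Rightarrow> ('a::ab_group_add \<Rightarrow> real) \<Rightarrow> ('a^'n::finite) measure
                      \<Rightarrow> ('a^'n \<Rightarrow> real) \<Rightarrow> real \<Rightarrow> ('a^'n \<Rightarrow> complex) \<Rightarrow> bool" where
  "in_CMO p absp M w q f \<longleftrightarrow>
     loc_Lq p absp M w q f \<and> (\<forall>g. set_integrable M (B0 p absp g) f) \<and>
     bdd_above (range (cmo_osc p absp M w q f))"

definition CMO_norm :: "nat \<Rightarrow> ('a::ab_group_add \<Rightarrow> real) \<Rightarrow> ('a^'n::finite) measure
                      \<Rightarrow> ('a^'n \<Rightarrow> real) \<Rightarrow> real \<Rightarrow> ('a^'n \<Rightarrow> complex) \<Rightarrow> real" where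
  "CMO_norm p absp M w q f = (SUP g. cmo_osc p absp M w q f g)"

definition bdot_term :: "nat \<Rightarrow> ('a::ab_group_add \<Rightarrow> real) \<Rightarrow> ('a^'n::finite) measure
                      \<Rightarrow> ('a^'n \<Rightarrow> real) \<Rightarrow> real \<Rightarrow> real \<Rightarrow> ('a^'n \<Rightarrow> complex) \<Rightarrow> int \<Rightarrow> real" where
  "bdot_term p absp M w q lam f g =
     (wm M w (B0 p absp g) powr (- 1 - lam * q) *
       (LINT x:(B0 p absp g)|M. norm (f x) powr q * w x)) powr (1 / q)"

definition in_Bdot :: "nat \<Rightarrow> ('a::ab_group_add \<Rightarrow> real) \<Rightarrow> ('a^'n::finite) measure
                      \<Rightarrow> ('a^'n \<Rightarrow> real) \<Rightarrow> real \<Rightarrow> real \<Rightarrow> ('a^'n \<Rightarrow> complex) \<Rightarrow> bool" where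
  "in_Bdot p absp M w q lam f \<longleftrightarrow>
     loc_Lq p absp M w q f \<and> bdd_above (range (bdot_term p absp M w q lam f))"

definition Bdot_norm :: "nat \<Rightarrow> ('a::ab_group_add \<Rightarrow> real) \<Rightarrow> ('a^'n::finite) measure
                      \<Rightarrow> ('a^'n \<Rightarrow> real) \<Rightarrow> real \<Rightarrow> real \<Rightarrow> ('a^'n \<Rightarrow> complex) \<Rightarrow> real" where
  "Bdot_norm p absp M w q lam f = (SUP g. bdot_term p absp M w q lam f g)"

definition hausdorff_comm_integrand ::
  "('a::field_char_0 \<Rightarrow> real) \<Rightarrow> nat \<Rightarrow> ('a^'n::finite \<Rightarrow> real) \<Rightarrow> (nat \<Rightarrow> 'a^'n \<Rightarrow> 'a^'n^'n)
   \<Rightarrow> (nat \<Rightarrow> 'a^'n \<Rightarrow> complex) \<Rightarrow> (nat \<Rightarrow> 'a^'n \<Rightarrow> complex) \<Rightarrow> 'a^'n \<Rightarrow> 'a^'n \<Rightarrow> complex" where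
  "hausdorff_comm_integrand absp m Phi A b f x y =
     complex_of_real (Phi y / vnorm absp y ^ CARD('n)) *
     (\<Prod>i<m. b i x - b i (A i y *v x)) * (\<Prod>i<m. f i (A i y *v x))"

definition hausdorff_comm ::
  "('a::field_char_0 \<Rightarrow> real) \<Rightarrow> ('a^'n::finite) measure \<Rightarrow> nat \<Rightarrow> ('a^'n \<Rightarrow> real)
   \<Rightarrow> (nat \<Rightarrow> 'a^'n \<Rightarrow> 'a^'n^'n)
   \<Rightarrow> (nat \<Rightarrow> 'a^'n \<Rightarrow> complex) \<Rightarrow> (nat \<Rightarrow> 'a^'n \<Rightarrow> complex) \<Rightarrow> 'a^'n \<Rightarrow> complex" where
  "hausdorff_comm absp M m Phi A b f x = (LINT y|M. hausdorff_comm_integrand absp m Phi A b f x y)"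

definition psi_star :: "nat \<Rightarrow> ('a::field_char_0 \<Rightarrow> real) \<Rightarrow> real \<Rightarrow> real \<Rightarrow> 'a^'n::finite^'n \<Rightarrow> real" where
  "psi_star p absp zeta r Ay =
     1 + 2 * mnorm absp Ay ^ CARD('n) / absp (det Ay)
       + inverse (absp (det Ay)) powr (zeta / r) * mnorm absp Ay powr (real CARD('n) * zeta / r)
       + \<bar>log (real p) (mnorm absp Ay)\<bar>"

definition mu_star :: "('a::field_char_0 \<Rightarrow> real) \<Rightarrow> real \<Rightarrow> real \<Rightarrow> 'a^'n::finite^'n \<Rightarrow> real" where
  "mu_star absp zeta q Ay =
     inverse (absp (det Ay)) powr (zeta / q) * mnorm absp Ay powr (real CARD('n) * zeta / q)"

definition C10 :: "nat \<Rightarrow> ('a::field_char_0 \<Rightarrow> real) \<Rightarrow> ('a^'n::finite) measure \<Rightarrow> nat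
   \<Rightarrow> ('a^'n \<Rightarrow> real) \<Rightarrow> (nat \<Rightarrow> 'a^'n \<Rightarrow> 'a^'n^'n) \<Rightarrow> real \<Rightarrow> real \<Rightarrow> (nat \<Rightarrow> real)
   \<Rightarrow> (nat \<Rightarrow> real) \<Rightarrow> (nat \<Rightarrow> real) \<Rightarrow> ennreal" where
  "C10 p absp M m Phi A zeta delta r q lam =
     (\<integral>\<^sup>+ y. ennreal (Phi y / vnorm absp y ^ CARD('n) *
        (\<Prod>i<m. psi_star p absp zeta (r i) (A i y) * mu_star absp zeta (q i) (A i y) *
           ((if mnorm absp (A i y) \<le> 1 then mnorm absp (A i y) powr (real CARD('n) * zeta * lam i) else 0)
          + (if mnorm absp (A i y) > 1
             then mnorm absp (A i y) powr (real CARD('n) * lam i * (delta - 1) / delta) else 0)))) \<partial>M)"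

end

theory Submission
  imports Defs
begin

text \<open>Minkowski's integral inequality reduces the claim to bounding, for fixed \<open>y\<close>, the weighted
  \<open>L\<^sup>q\<close> norm over a ball \<open>B\<close> of the integrand. There the reverse Hoelder inequality
  removes the weight, and Hoelder's inequality splits the product into unweighted \<open>L\<^sup>s\<close> norms with
  \<open>s = r\<^sub>i / \<zeta>\<close> and \<open>s = q\<^sub>i / \<zeta>\<close>. In an unweighted norm one can substitute
  \<open>A\<^sub>i(y)x\<close>, which maps \<open>B\<close> into the concentric ball \<open>B'\<close> with radius scaled by
  \<open>\<parallel>A\<^sub>i(y)\<parallel>\<close>, and the \<open>A\<^sub>\<zeta>\<close> condition leads back to weighted norms over \<open>B'\<close>.
  The averages of \<open>b\<^sub>i\<close> over \<open>B\<close> and \<open>B'\<close> are compared by telescoping, which produces the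
  logarithm in \<open>\<psi>\<^sub>i\<close>; the powers of \<open>\<omega>(B')\<close> and \<open>\<omega>(B)\<close> are compared by the \<open>A\<^sub>\<zeta>\<close>
  condition if \<open>B' \<subseteq> B\<close> and by the reverse Hoelder inequality otherwise.\<close>

subsection \<open>Hoelder's and Minkowski's inequalities\<close>

text \<open>A Muckenhoupt weight offers no pointwise control of \<open>w (A *v x)\<close> by
  \<open>w x\<close>, so no linear substitution is possible while the weight is under the integral;
  this forces the detour through unweighted norms. Removing the weight costs the exponent
  \<open>1 / \<rho>\<close> of a reverse Hoelder inequality, and the other factors cost
  \<open>qs * zeta / r i\<close> and \<open>qs * zeta / q i\<close>; together these must not exceed
  1. The critical index is a supremum that need not be attained, and the strict inequality in the
  hypothesis is what leaves room for an admissible \<open>\<rho>\<close>, chosen above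
  \<open>delta\<close> as well. Because \<open>lam i < 0\<close>, both comparisons of
  \<open>\<omega>(B')\<close> with \<open>\<omega>(B)\<close> are needed in the same direction, as
  lower bounds of \<open>\<omega>(B')\<close>. The slice estimate is arranged so that its dependence
  on \<open>y\<close> is exactly the integrand of \<open>C10\<close>. A second obstacle is that the
  measure is given only by translation invariance and one normalisation: volumes, uniqueness and the
  Jacobian \<open>1 / absp (det A)\<close> all have to be derived from these.\<close>

lemma weighted_am_gm:
  fixes t \<theta> :: "'i \<Rightarrow> real"
  assumes "finite I" and \<theta>: "\<And>i. i \<in> I \<Longrightarrow> 0 \<le> \<theta> i" "(\<Sum>i\<in>I. \<theta> i) = 1"
    and t: "\<And>i. i \<in> I \<Longrightarrow> 0 \<le> t i"
  shows "(\<Prod>i\<in>I. t i powr \<theta> i) \<le> (\<Sum>i\<in>I. \<theta> i * t i)"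
proof (cases "\<exists>i\<in>I. t i = 0")
  case True
  \<comment> \<open>Since \<open>0 powr 0 = 0\<close>, this holds even if the exponent of the
    vanishing factor is 0.\<close>
  then have "(\<Prod>i\<in>I. t i powr \<theta> i) = 0"
    using \<open>finite I\<close> by (auto simp: prod_zero_iff)
  then show ?thesis
    using \<theta> t by (simp add: sum_nonneg)
next
  case False
  then have tpos: "0 < t i" if "i \<in> I" for i
    using t that by force
  define S where "S = (\<Sum>i\<in>I. \<theta> i * t i)"
  obtain k where k: "k \<in> I" "\<theta> k \<noteq> 0"
    using \<theta>(2) by (metis sum.neutral zero_neq_one)
  have "0 < \<theta> k * t k" using k \<theta>(1)[OF k(1)] tpos by simp
  also have "\<dots> \<le> S"
    unfolding S_def using k \<open>finite I\<close> \<theta> t by (intro member_le_sum) auto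
  finally have S: "0 < S" .
  \<comment> \<open>The tangent of \<open>ln\<close> at the weighted mean \<open>S\<close> lies
    above \<open>ln\<close>; averaging it with weights \<open>\<theta>\<close> cancels its linear
    part.\<close>
  have "(\<Sum>i\<in>I. \<theta> i * ln (t i)) - ln S = (\<Sum>i\<in>I. \<theta> i * ln (t i / S))"
  proof -
    have "(\<Sum>i\<in>I. \<theta> i * ln (t i / S)) = (\<Sum>i\<in>I. \<theta> i * ln (t i) - \<theta> i * ln S)"
      using S False by (intro sum.cong refl) (simp add: ln_div right_diff_distrib)
    then show ?thesis
      using \<theta>(2) by (simp add: sum_subtractf sum_distrib_right[symmetric])
  qed
  also have "\<dots> \<le> (\<Sum>i\<in>I. \<theta> i * (t i / S - 1))"
    using S tpos \<theta>(1) by (intro sum_mono mult_left_mono ln_le_minus_one) auto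
  also have "\<dots> = 0"
    using \<theta>(2) S by (simp add: right_diff_distrib sum_subtractf sum_divide_distrib[symmetric] S_def)
  finally have "(\<Sum>i\<in>I. \<theta> i * ln (t i)) \<le> ln S" by simp
  moreover have "(\<Prod>i\<in>I. t i powr \<theta> i) = exp (\<Sum>i\<in>I. \<theta> i * ln (t i))"
    unfolding exp_sum[OF \<open>finite I\<close>] using tpos by (intro prod.cong) (force simp: powr_def)+
  ultimately have "(\<Prod>i\<in>I. t i powr \<theta> i) \<le> exp (ln S)"
    by simp
  also have "exp (ln S) = S" using S by simp
  finally show ?thesis by (simp add: S_def)
qed

text \<open>Weighted AM-GM for \<open>g i x / c i\<close>, integrated. Upper bounds
  \<open>c i\<close> replace the integrals themselves, so that the right-hand side is a real number
  and real powers make sense; if some \<open>c k\<close> is 0, then \<open>g k\<close> vanishes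
  almost everywhere.\<close>

lemma Holder_nn_integral_prod:
  fixes g :: "'i \<Rightarrow> 'b \<Rightarrow> real" and \<theta> c :: "'i \<Rightarrow> real"
  assumes I: "finite I" and \<theta>: "\<And>i. i \<in> I \<Longrightarrow> 0 \<le> \<theta> i" "(\<Sum>i\<in>I. \<theta> i) = 1"
    and g: "\<And>i. i \<in> I \<Longrightarrow> g i \<in> borel_measurable M" "\<And>i x. i \<in> I \<Longrightarrow> 0 \<le> g i x"
    and c: "\<And>i. i \<in> I \<Longrightarrow> 0 \<le> c i"
    and le: "\<And>i. i \<in> I \<Longrightarrow> (\<integral>\<^sup>+x. ennreal (g i x) \<partial>M) \<le> ennreal (c i)"
  shows "(\<integral>\<^sup>+x. ennreal (\<Prod>i\<in>I. g i x powr \<theta> i) \<partial>M) \<le> ennreal (\<Prod>i\<in>I. c i powr \<theta> i)"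
proof (cases "\<exists>i\<in>I. c i = 0")
  case True
  then obtain k where k: "k \<in> I" "c k = 0" by blast
  then have "(\<integral>\<^sup>+x. ennreal (g k x) \<partial>M) = 0" using le[of k] by simp
  then have "AE x in M. ennreal (g k x) = 0"
    using g(1)[OF k(1)] by (subst (asm) nn_integral_0_iff_AE) auto
  then have "AE x in M. ennreal (\<Prod>i\<in>I. g i x powr \<theta> i) = 0"
  proof eventually_elim
    case (elim x)
    then have "g k x = 0" using g(2)[OF k(1), of x] by (simp add: ennreal_eq_0_iff)
    then have "(\<Prod>i\<in>I. g i x powr \<theta> i) = 0" using k I by (auto simp: prod_zero_iff)
    then show ?case by simp
  qed
  then have "(\<integral>\<^sup>+x. ennreal (\<Prod>i\<in>I. g i x powr \<theta> i) \<partial>M) = (\<integral>\<^sup>+x. 0 \<partial>M)"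
    by (rule nn_integral_cong_AE)
  then show ?thesis by simp
next
  case False
  then have cpos: "0 < c i" if "i \<in> I" for i using c that by force
  define P where "P = (\<Prod>i\<in>I. c i powr \<theta> i)"
  have P: "0 \<le> P" unfolding P_def by (intro prod_nonneg) auto
  have pt: "(\<Prod>i\<in>I. g i x powr \<theta> i) \<le> P * (\<Sum>i\<in>I. \<theta> i / c i * g i x)" for x
  proof -
    have "g i x powr \<theta> i = c i powr \<theta> i * (g i x / c i) powr \<theta> i" if "i \<in> I" for i
      using powr_divide[of "g i x" "c i" "\<theta> i"] cpos[OF that] g(2)[OF that, of x] by simp
    then have "(\<Prod>i\<in>I. g i x powr \<theta> i) = P * (\<Prod>i\<in>I. (g i x / c i) powr \<theta> i)"
      unfolding P_def prod.distrib[symmetric] by (intro prod.cong refl)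
    also have "\<dots> \<le> P * (\<Sum>i\<in>I. \<theta> i * (g i x / c i))"
      using I \<theta> g(2) c P by (intro mult_left_mono weighted_am_gm) auto
    finally show ?thesis by simp
  qed
  have "(\<integral>\<^sup>+x. ennreal (\<Prod>i\<in>I. g i x powr \<theta> i) \<partial>M)
      \<le> (\<integral>\<^sup>+x. ennreal P * (\<Sum>i\<in>I. ennreal (\<theta> i / c i) * ennreal (g i x)) \<partial>M)"
  proof (rule nn_integral_mono)
    fix x
    have "(\<Sum>i\<in>I. ennreal (\<theta> i / c i) * ennreal (g i x)) = (\<Sum>i\<in>I. ennreal (\<theta> i / c i * g i x))"
      by (intro sum.cong refl ennreal_mult[symmetric] divide_nonneg_nonneg) (auto intro: \<theta> c g)
    also have "\<dots> = ennreal (\<Sum>i\<in>I. \<theta> i / c i * g i x)"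
      by (intro sum_ennreal mult_nonneg_nonneg divide_nonneg_nonneg) (auto intro: \<theta> c g)
    finally have "ennreal P * (\<Sum>i\<in>I. ennreal (\<theta> i / c i) * ennreal (g i x))
       = ennreal (P * (\<Sum>i\<in>I. \<theta> i / c i * g i x))"
      using P by (simp add: ennreal_mult')
    then show "ennreal (\<Prod>i\<in>I. g i x powr \<theta> i)
        \<le> ennreal P * (\<Sum>i\<in>I. ennreal (\<theta> i / c i) * ennreal (g i x))"
      using pt[of x] by (simp add: ennreal_leI)
  qed
  also have "\<dots> = ennreal P * (\<Sum>i\<in>I. ennreal (\<theta> i / c i) * (\<integral>\<^sup>+x. ennreal (g i x) \<partial>M))"
    using g(1) by (simp add: nn_integral_cmult nn_integral_sum)
  also have "\<dots> \<le> ennreal P * (\<Sum>i\<in>I. ennreal (\<theta> i / c i) * ennreal (c i))"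
    using le by (intro mult_left_mono sum_mono) auto
  also have "(\<Sum>i\<in>I. ennreal (\<theta> i / c i) * ennreal (c i)) = (\<Sum>i\<in>I. ennreal (\<theta> i))"
  proof (intro sum.cong refl)
    fix i assume i: "i \<in> I"
    show "ennreal (\<theta> i / c i) * ennreal (c i) = ennreal (\<theta> i)"
      using \<theta>(1)[OF i] cpos[OF i] by (simp flip: ennreal_mult)
  qed
  also have "\<dots> = 1" using \<theta> by (simp add: sum_ennreal)
  finally show ?thesis by (simp add: P_def)
qed

lemma Holder_nn_integral_two:
  fixes g h :: "'b \<Rightarrow> real"
  assumes \<theta>: "0 \<le> \<theta>" "\<theta> \<le> 1"
    and m: "g \<in> borel_measurable M" "h \<in> borel_measurable M"
    and nn: "\<And>x. 0 \<le> g x" "\<And>x. 0 \<le> h x" and c: "0 \<le> c" "0 \<le> d"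
    and le: "(\<integral>\<^sup>+x. ennreal (g x) \<partial>M) \<le> ennreal c" "(\<integral>\<^sup>+x. ennreal (h x) \<partial>M) \<le> ennreal d"
  shows "(\<integral>\<^sup>+x. ennreal (g x powr \<theta> * h x powr (1 - \<theta>)) \<partial>M) \<le> ennreal (c powr \<theta> * d powr (1 - \<theta>))"
proof -
  have "(\<integral>\<^sup>+x. ennreal (\<Prod>i\<in>UNIV. (if i then g else h) x powr (if i then \<theta> else 1 - \<theta>)) \<partial>M)
      \<le> ennreal (\<Prod>i\<in>UNIV. (if i then c else d) powr (if i then \<theta> else 1 - \<theta>))"
    using assms by (intro Holder_nn_integral_prod) (auto simp: UNIV_bool)
  then show ?thesis by (simp add: UNIV_bool mult.commute)
qed

text \<open>Knowing a bound \<open>K\<close> for the slice norms in advance, Jensen's inequality for \<open>F / K\<close> and the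
  measure \<open>K dy\<close>, followed by Tonelli, suffices.\<close>

lemma Minkowski_nn_integral:
  fixes F :: "'b \<Rightarrow> 'c \<Rightarrow> real" and K :: "'c \<Rightarrow> real"
  assumes "sigma_finite_measure N" "sigma_finite_measure M"
    and F[measurable]: "case_prod F \<in> borel_measurable (N \<Otimes>\<^sub>M M)" and F0: "\<And>x y. 0 \<le> F x y"
    and K[measurable]: "K \<in> borel_measurable M" and K0: "\<And>y. 0 \<le> K y"
    and \<kappa>: "(\<integral>\<^sup>+y. ennreal (K y) \<partial>M) \<le> ennreal \<kappa>" "0 \<le> \<kappa>"
    and q: "1 \<le> q" and L: "0 \<le> L"
    and zero: "AE y in M. K y = 0 \<longrightarrow> (\<forall>x. F x y = 0)"
    and slice: "AE y in M. (\<integral>\<^sup>+x. ennreal (F x y powr q) \<partial>N) \<le> ennreal (K y powr q * L)"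
  shows "AE x in N. (\<integral>\<^sup>+y. ennreal (F x y) \<partial>M) < \<infinity>"
    and "(\<integral>\<^sup>+x. ennreal (enn2real (\<integral>\<^sup>+y. ennreal (F x y) \<partial>M) powr q) \<partial>N) \<le> ennreal (\<kappa> powr q * L)"
proof -
  interpret N: sigma_finite_measure N by fact
  interpret M: sigma_finite_measure M by fact
  interpret NM: pair_sigma_finite N M ..
  \<comment> \<open>This is the integral of \<open>(F x y / K y) powr q\<close> with respect to
    \<open>K y\<close> dy, written without a division by \<open>K y\<close>.\<close>
  define J where "J x = (\<integral>\<^sup>+y. ennreal (F x y powr q * K y powr (1 - q)) \<partial>M)" for x
  have J[measurable]: "J \<in> borel_measurable N"
    unfolding J_def by measurable
  have "(\<integral>\<^sup>+x. J x \<partial>N) = (\<integral>\<^sup>+y. (\<integral>\<^sup>+x. ennreal (F x y powr q * K y powr (1 - q)) \<partial>N) \<partial>M)"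
    unfolding J_def by (rule NM.Fubini'[symmetric]) measurable
  also have "\<dots> = (\<integral>\<^sup>+y. (\<integral>\<^sup>+x. ennreal (F x y powr q) \<partial>N) * ennreal (K y powr (1 - q)) \<partial>M)"
  proof (rule nn_integral_cong)
    fix y assume "y \<in> space M"
    then have [measurable]: "(\<lambda>x. F x y) \<in> borel_measurable N"
      using measurable_compose[OF measurable_Pair2' F] by simp
    have "(\<integral>\<^sup>+x. ennreal (F x y powr q * K y powr (1 - q)) \<partial>N)
        = (\<integral>\<^sup>+x. ennreal (F x y powr q) * ennreal (K y powr (1 - q)) \<partial>N)"
      by (intro nn_integral_cong ennreal_mult) auto
    then show "(\<integral>\<^sup>+x. ennreal (F x y powr q * K y powr (1 - q)) \<partial>N)
        = (\<integral>\<^sup>+x. ennreal (F x y powr q) \<partial>N) * ennreal (K y powr (1 - q))"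
      by (simp add: nn_integral_multc)
  qed
  also have "\<dots> \<le> (\<integral>\<^sup>+y. ennreal (K y) * ennreal L \<partial>M)"
  proof (rule nn_integral_mono_AE, use slice in eventually_elim)
    case (elim y)
    have "(\<integral>\<^sup>+x. ennreal (F x y powr q) \<partial>N) * ennreal (K y powr (1 - q))
        \<le> ennreal (K y powr q * L) * ennreal (K y powr (1 - q))"
      using elim by (rule mult_right_mono) simp
    also have "\<dots> = ennreal (K y powr q * L * K y powr (1 - q))"
      by (rule ennreal_mult'[symmetric]) (use L in auto)
    also have "K y powr q * L * K y powr (1 - q) = K y * L"
      using K0[of y] by (cases "K y = 0") (auto simp flip: powr_add)
    finally show ?case using K0[of y] L by (simp add: ennreal_mult)
  qed
  also have "\<dots> = (\<integral>\<^sup>+y. ennreal (K y) \<partial>M) * ennreal L"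
    by (rule nn_integral_multc) measurable
  also have "\<dots> \<le> ennreal \<kappa> * ennreal L"
    by (rule mult_right_mono) (use \<kappa> in auto)
  finally have intJ: "(\<integral>\<^sup>+x. J x \<partial>N) \<le> ennreal \<kappa> * ennreal L" .
  also have "\<dots> < \<infinity>" by (simp add: ennreal_mult_less_top)
  finally have Jfin: "AE x in N. J x < \<infinity>"
    using nn_integral_PInf_AE[OF J] by (auto simp: less_top)
  have Gle: "(\<integral>\<^sup>+y. ennreal (F x y) \<partial>M) \<le> ennreal (enn2real (J x) powr (1 / q) * \<kappa> powr (1 - 1 / q))"
    if "J x < \<infinity>" "x \<in> space N" for x
  proof -
    have [measurable]: "F x \<in> borel_measurable M"
      using measurable_compose[OF measurable_Pair1'[OF that(2)] F] by simp
    \<comment> \<open>The powers of \<open>K y\<close> cancel unless \<open>K y = 0\<close>. There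
      the right-hand side is 0 by the convention for \<open>powr\<close>, and \<open>zero\<close>
      makes the left-hand side 0 too.\<close>
    have "(\<integral>\<^sup>+y. ennreal (F x y) \<partial>M)
       \<le> (\<integral>\<^sup>+y. ennreal ((F x y powr q * K y powr (1 - q)) powr (1 / q) * K y powr (1 - 1 / q)) \<partial>M)"
    proof (rule nn_integral_mono_AE, use zero in eventually_elim)
      case (elim y)
      show ?case
      proof (cases "K y = 0")
        case False
        then have "(F x y powr q * K y powr (1 - q)) powr (1 / q) * K y powr (1 - 1 / q) =
             F x y * K y powr ((1 - q) / q + (1 - 1 / q))"
          using F0[of x y] K0[of y] q by (simp add: powr_mult powr_powr powr_add)
        also have "(1 - q) / q + (1 - 1 / q) = 0" using q by (simp add: field_simps)
        finally show ?thesis using False K0[of y] by simp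
      qed (use elim in simp)
    qed
    also have "\<dots> \<le> ennreal (enn2real (J x) powr (1 / q) * \<kappa> powr (1 - 1 / q))"
      using q \<kappa> K0 that
      by (intro Holder_nn_integral_two) (auto simp: J_def[symmetric] ennreal_enn2real_if less_top)
    finally show ?thesis .
  qed
  show "AE x in N. (\<integral>\<^sup>+y. ennreal (F x y) \<partial>M) < \<infinity>"
    using Jfin AE_space
  proof eventually_elim
    case (elim x)
    show ?case using Gle[OF elim] by (auto simp: le_less_trans)
  qed
  have "(\<integral>\<^sup>+x. ennreal (enn2real (\<integral>\<^sup>+y. ennreal (F x y) \<partial>M) powr q) \<partial>N)
      \<le> (\<integral>\<^sup>+x. J x * ennreal (\<kappa> powr (q - 1)) \<partial>N)"
  proof (rule nn_integral_mono_AE, use Jfin AE_space in eventually_elim)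
    case (elim x)
    let ?G = "enn2real (\<integral>\<^sup>+y. ennreal (F x y) \<partial>M)"
    have "?G \<le> enn2real (J x) powr (1 / q) * \<kappa> powr (1 - 1 / q)"
      using enn2real_mono[OF Gle[OF elim]] by simp
    then have "?G powr q \<le> (enn2real (J x) powr (1 / q) * \<kappa> powr (1 - 1 / q)) powr q"
      using q by (intro powr_mono2) auto
    also have "\<dots> = enn2real (J x) * \<kappa> powr (q - 1)"
      using q \<kappa>(2) by (simp add: powr_mult powr_powr left_diff_distrib)
    finally have "ennreal (?G powr q) \<le> ennreal (enn2real (J x)) * ennreal (\<kappa> powr (q - 1))"
      by (simp add: ennreal_leI flip: ennreal_mult)
    then show ?case using elim by (simp add: less_top[symmetric] ennreal_enn2real_if)
  qed
  also have "\<dots> = (\<integral>\<^sup>+x. J x \<partial>N) * ennreal (\<kappa> powr (q - 1))"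
    by (rule nn_integral_multc) measurable
  also have "\<dots> \<le> ennreal \<kappa> * ennreal L * ennreal (\<kappa> powr (q - 1))"
    by (rule mult_right_mono) (use intJ in auto)
  also have "\<dots> = ennreal (\<kappa> * L * \<kappa> powr (q - 1))"
    using \<kappa> L by (simp add: ennreal_mult)
  also have "\<kappa> * L * \<kappa> powr (q - 1) = \<kappa> powr q * L"
    using \<kappa>(2) by (cases "\<kappa> = 0") (auto simp: powr_diff)
  finally show "(\<integral>\<^sup>+x. ennreal (enn2real (\<integral>\<^sup>+y. ennreal (F x y) \<partial>M) powr q) \<partial>N)
      \<le> ennreal (\<kappa> powr q * L)" .
qed

subsection \<open>p-adic numbers\<close>

locale padic_field =
  fixes p :: nat and absp :: "'a::field_char_0 \<Rightarrow> real"
  assumes is_Qp: "is_Qp p absp"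
begin

lemma prime_p: "prime p" and absp_nonneg [simp]: "0 \<le> absp x"
  and absp_eq_0_iff [simp]: "absp x = 0 \<longleftrightarrow> x = 0"
  and absp_mult: "absp (x * y) = absp x * absp y"
  and absp_add_max: "absp (x + y) \<le> max (absp x) (absp y)"
  and absp_of_rat: "absp (of_rat u) = padic_abs_rat p u"
  and rat_dense: "0 < e \<Longrightarrow> \<exists>u. absp (x - of_rat u) < e"
proof -
  note Q = is_Qp[unfolded is_Qp_def]
  show "prime p" using Q by (elim conjE)
  show "0 \<le> absp x" using Q by (elim conjE) (erule spec)
  show "absp x = 0 \<longleftrightarrow> x = 0" using Q by (elim conjE) (erule spec)
  show "absp (x * y) = absp x * absp y" using Q by (elim conjE) blast
  show "absp (x + y) \<le> max (absp x) (absp y)" using Q by (elim conjE) blast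
  show "absp (of_rat u) = padic_abs_rat p u" using Q by (elim conjE) (erule spec)
  show "\<exists>u. absp (x - of_rat u) < e" if "0 < e" using Q that by (elim conjE) simp
qed

lemma p_gt_1 [simp]: "1 < p" and p_pos [simp]: "0 < p" and real_p_gt_1: "1 < real p"
  using prime_p prime_gt_1_nat[of p] by auto

lemma p_nonzero [simp]: "p \<noteq> 0"
  using p_pos by blast

lemma absp_1 [simp]: "absp 1 = 1"
proof -
  have "absp 1 * absp 1 = absp 1" "absp 1 \<noteq> 0"
    using absp_mult[of 1 1] by simp_all
  then show ?thesis by simp
qed

lemma absp_0 [simp]: "absp 0 = 0"
  by simp

lemma absp_le_0_iff [simp]: "absp x \<le> 0 \<longleftrightarrow> x = 0"
  using absp_nonneg[of x] absp_eq_0_iff[of x] by linarith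

lemma absp_minus [simp]: "absp (- x) = absp x"
proof -
  have "absp (-1) ^ 2 = 1" using absp_mult[of "-1" "-1"] by (simp add: power2_eq_square)
  then have "absp (-1) = 1"
    using absp_nonneg[of "-1"] by (auto simp: power2_eq_1_iff)
  then show ?thesis using absp_mult[of "-1" x] by simp
qed

lemma absp_diff_commute: "absp (x - y) = absp (y - x)"
  using absp_minus[of "x - y"] by simp

lemma absp_add_le: "absp x \<le> c \<Longrightarrow> absp y \<le> c \<Longrightarrow> absp (x + y) \<le> c"
  using absp_add_max[of x y] by linarith

lemma absp_diff_le: "absp x \<le> c \<Longrightarrow> absp y \<le> c \<Longrightarrow> absp (x - y) \<le> c"
  using absp_add_le[of x c "- y"] by simp

lemma absp_inverse: "absp (inverse x) = inverse (absp x)"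
proof (cases "x = 0")
  case False
  then have "absp (inverse x) * absp x = 1" using absp_mult[of "inverse x" x] by simp
  then show ?thesis by (metis inverse_unique mult.commute)
qed simp

lemma absp_divide: "absp (x / y) = absp x / absp y"
  by (simp add: divide_inverse absp_mult absp_inverse)

lemma absp_sum_le: "0 \<le> c \<Longrightarrow> (\<And>i. i \<in> I \<Longrightarrow> absp (f i) \<le> c) \<Longrightarrow> absp (sum f I) \<le> c"
proof (induction I rule: infinite_finite_induct)
  case (insert i I)
  then show ?case by (simp add: absp_add_le)
qed auto

lemma absp_add_eq: assumes "absp y < absp x" shows "absp (x + y) = absp x"
proof -
  have "absp x \<le> max (absp (x + y)) (absp y)"
    using absp_add_max[of "x + y" "- y"] by simp
  then show ?thesis using assms absp_add_max[of x y] by linarith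
qed

lemma absp_of_int: "n \<noteq> 0 \<Longrightarrow> absp (of_int n) = p powr - real (multiplicity (int p) n)"
  using absp_of_rat[of "of_int n"] by (simp add: padic_abs_rat_def)

lemma absp_of_int_le_1: "absp (of_int n) \<le> 1"
  using real_p_gt_1 by (cases "n = 0") (simp_all add: absp_of_int powr_minus inverse_le_1_iff ge_one_powr_ge_zero)

lemma absp_of_int_eq_1: assumes "\<not> int p dvd n" shows "absp (of_int n) = 1"
proof -
  have "n \<noteq> 0" using assms by auto
  then show ?thesis using assms by (simp add: absp_of_int not_dvd_imp_multiplicity_0)
qed

lemma absp_p: "absp (of_nat p) = 1 / p"
proof -
  have "\<not> is_unit (int p)" using p_gt_1 by simp
  then have "multiplicity (int p) (int p) = 1"
    by (intro multiplicity_self) (use p_pos in auto)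
  then show ?thesis using absp_of_int[of "int p"] by (simp add: powr_minus_divide)
qed

lemma absp_of_int_dvd: assumes "int p dvd n" shows "absp (of_int n) \<le> 1 / p"
proof -
  obtain d where "n = int p * d" using assms by blast
  then have "absp (of_int n) = absp (of_nat p) * absp (of_int d)"
    by (simp add: absp_mult)
  also have "\<dots> \<le> 1 / p * 1"
    using absp_of_int_le_1[of d] by (intro mult_mono) (auto simp: absp_p)
  finally show ?thesis by simp
qed

lemma absp_powi_p: "absp (of_nat p powi k) = p powr - real_of_int k"
proof -
  have *: "absp (x ^ n) = absp x ^ n" for x n
    by (induction n) (simp_all add: absp_mult)
  have "absp (of_nat p powi k) = (1 / p) powi k"
    by (cases "0 \<le> k") (simp_all add: power_int_def * absp_inverse absp_p)
  also have "\<dots> = p powr - real_of_int k"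
    by (simp add: powr_minus powr_real_of_int' power_int_divide_distrib inverse_eq_divide)
  finally show ?thesis .
qed

text \<open>A rational closer to \<open>x\<close> than \<open>absp x\<close> has the same absolute
  value as \<open>x\<close>, by the ultrametric inequality; so the value group is that of the
  rationals.\<close>

lemma absp_discrete: assumes "x \<noteq> 0" shows "\<exists>k::int. absp x = p powr real_of_int k"
proof -
  obtain u where u: "absp (x - of_rat u) < absp x" using rat_dense[of "absp x" x] assms
    by (metis absp_eq_0_iff absp_nonneg less_eq_real_def)
  have "absp (of_rat u) = absp x"
    using absp_add_eq[of "of_rat u - x" x] u by (simp add: absp_diff_commute)
  moreover have "u \<noteq> 0" using calculation assms by auto
  ultimately show ?thesis
    by (auto simp: absp_of_rat padic_abs_rat_def split: prod.splits)
       (metis of_int_diff of_int_of_nat_eq)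
qed

text \<open>The residue field has p elements: a rational \<open>a / b\<close> near \<open>x\<close>
  has absolute value at most 1, hence a denominator prime to p in lowest terms, and can be reduced
  modulo p.\<close>

lemma digit: assumes "absp x \<le> 1" shows "\<exists>i<p. absp (x - of_nat i) \<le> 1 / p"
proof -
  obtain u where u: "absp (x - of_rat u) < 1 / p" using rat_dense[of "1 / p" x] p_pos by auto
  have u1: "absp (of_rat u) \<le> 1"
    using absp_diff_le[of x 1 "x - of_rat u"] u assms p_pos real_p_gt_1
    by (smt (verit) add_diff_cancel_left' diff_add_cancel divide_le_eq_1 mult_cancel_right1)
  obtain a b where ab: "quotient_of u = (a, b)" by (cases "quotient_of u")
  have b: "0 < b" "coprime a b" using quotient_of_denom_pos[OF ab] quotient_of_coprime[OF ab] by auto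
  have "u = of_int a / of_int b" using quotient_of_div[OF ab] .
  then have ueq: "of_rat u = (of_int a / of_int b :: 'a)" by (simp add: of_rat_divide)
  have pb: "\<not> int p dvd b"
  proof
    assume d: "int p dvd b"
    then have "\<not> int p dvd a"
      using b(2) p_gt_1 coprime_common_divisor_int[of a b "int p"] by fastforce
    then have "absp (of_rat u) * absp (of_int b) = 1"
      using ueq b by (simp add: absp_divide absp_of_int_eq_1)
    moreover have "absp (of_rat u) * absp (of_int b) \<le> 1 * (1 / p)"
      using u1 absp_of_int_dvd[OF d] by (intro mult_mono) auto
    ultimately show False using real_p_gt_1 by simp
  qed
  then have "coprime b (int p)"
    using prime_p by (metis coprime_commute prime_imp_coprime prime_nat_int_transfer)
  then have "gcd b (int p) = 1" by simp
  then obtain c d where c: "c * b + d * int p = 1" using bezout_int[of b "int p"] by auto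
  \<comment> \<open>By \<open>c\<close>, the integer \<open>c\<close> inverts \<open>b\<close>
    modulo p, so this is the residue of \<open>a / b\<close>.\<close>
  define i where "i = (a * c) mod int p"
  have i: "0 \<le> i" "i < int p" unfolding i_def using p_pos by auto
  have ac: "a * c = int p * (a * c div int p) + i" unfolding i_def by simp
  have "a - i * b = a * (c * b + d * int p) - (a * c - int p * (a * c div int p)) * b"
    using ac c by simp
  also have "\<dots> = int p * (a * d + (a * c div int p) * b)"
    by (simp add: algebra_simps)
  finally have "int p dvd a - i * b" by simp
  moreover have "of_rat u - of_int i = (of_int (a - i * b) / of_int b :: 'a)"
    using b ueq by (simp add: field_simps)
  ultimately have "absp (of_rat u - of_int i) \<le> 1 / p"
    using absp_of_int_dvd[of "a - i * b"] pb by (simp add: absp_divide absp_of_int_eq_1)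
  then have "absp ((x - of_rat u) + (of_rat u - of_int i)) \<le> 1 / p"
    using u by (intro absp_add_le) auto
  then have "absp (x - of_nat (nat i)) \<le> 1 / p" using i by simp
  then show ?thesis using i by (intro exI[of _ "nat i"]) auto
qed

lemma absp_of_nat_diff: assumes "i < p" "j < p" "i \<noteq> j" shows "absp (of_nat i - of_nat j) = 1"
proof -
  have "\<not> int p dvd int i - int j"
    using assms dvd_imp_le_int[of "int i - int j" "int p"] by auto
  from absp_of_int_eq_1[OF this] show ?thesis by simp
qed

section \<open>Balls in p-adic space\<close>

lemma powr_le_iff: "real p powr a \<le> real p powr b \<longleftrightarrow> a \<le> b"
  using real_p_gt_1 by simp

lemma vnorm_le_iff: "vnorm absp x \<le> c \<longleftrightarrow> (\<forall>j. absp (x $ j) \<le> c)" for x :: "'a^'n::finite"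
  unfolding vnorm_def by (subst Max_le_iff) auto

lemma absp_le_vnorm: "absp (x $ j) \<le> vnorm absp x" for x :: "'a^'n::finite"
  unfolding vnorm_def by (rule Max_ge) auto

lemma mem_pball: "x \<in> pball p absp a g \<longleftrightarrow> (\<forall>j. absp (x $ j - a $ j) \<le> p powr real_of_int g)"
  for x a :: "'a^'n::finite"
  by (simp add: pball_def vnorm_le_iff)

lemma pball_eqI:
  fixes x a :: "'a^'n::finite"
  assumes "x \<in> pball p absp a g"
  shows "pball p absp a g = pball p absp x g"
proof -
  have "absp (y $ j - a $ j) \<le> p powr g \<longleftrightarrow> absp (y $ j - x $ j) \<le> p powr g" for y j
    using absp_diff_le[of "y $ j - a $ j" "p powr g" "x $ j - a $ j"]
      absp_add_le[of "y $ j - x $ j" "p powr g" "x $ j - a $ j"] assms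
    by (auto simp: mem_pball)
  then show ?thesis by (auto simp: mem_pball)
qed

lemma pball_mono: "g \<le> h \<Longrightarrow> pball p absp a g \<subseteq> pball p absp a h"
  for a :: "'a^'n::finite"
proof
  fix x assume "g \<le> h" "x \<in> pball p absp a g"
  then show "x \<in> pball p absp a h"
    using powr_le_iff[of g h] by (auto simp: mem_pball intro: order.trans)
qed

lemma centre_in_pball [simp]: "a \<in> pball p absp a g" for a :: "'a^'n::finite"
  by (simp add: mem_pball)

text \<open>Two balls that meet can be centred at a common point, and then the smaller one is the
  intersection. The empty set is added for balls that do not meet.\<close>

lemma Int_stable_pballs:
  "Int_stable (insert {} (range (\<lambda>(a :: 'a^'n::finite, g). pball p absp a g)))"
proof (rule Int_stableI)
  fix X Y :: "('a^'n::finite) set"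
  assume X: "X \<in> insert {} (range (\<lambda>(a, g). pball p absp a g))"
    and Y: "Y \<in> insert {} (range (\<lambda>(a, g). pball p absp a g))"
  show "X \<inter> Y \<in> insert {} (range (\<lambda>(a, g). pball p absp a g))"
  proof (cases "X \<inter> Y = {}")
    case False
    then obtain x where x: "x \<in> X" "x \<in> Y" by auto
    then obtain a g b h where ag: "X = pball p absp a g" "Y = pball p absp b h"
      using X Y by auto
    then have "X = pball p absp x g" "Y = pball p absp x h"
      using x pball_eqI by blast+
    then have "X \<inter> Y = pball p absp x (min g h)"
      using pball_mono[of g h x] pball_mono[of h g x] by (auto simp: min_def)
    then show ?thesis by auto
  qed simp
qed

lemma rat_vec_dense: "\<exists>u :: rat^'n. (\<chi> j. of_rat (u $ j)) \<in> pball p absp x g" for x :: "'a^'n::finite"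
proof -
  have "\<forall>j. \<exists>u. absp (x $ j - of_rat u) < p powr real_of_int g"
    using p_pos by (intro allI rat_dense) simp
  then obtain u where u: "\<And>j. absp (x $ j - of_rat (u j)) < p powr real_of_int g" by metis
  show ?thesis
    by (rule exI[of _ "\<chi> j. u j"]) (use u in \<open>simp add: mem_pball absp_diff_commute less_imp_le\<close>)
qed

lemma exists_ball_radius: assumes "0 < e" shows "\<exists>g::int. real p powr real_of_int g \<le> e"
proof
  have "p powr real_of_int \<lfloor>log p e\<rfloor> \<le> p powr log p e"
    using p_gt_1 by (intro powr_mono) auto
  then show "real p powr real_of_int \<lfloor>log p e\<rfloor> \<le> e" using assms real_p_gt_1 by simp
qed

section \<open>Borel measurability of the field operations\<close>

abbreviation "Q \<equiv> Qp_space p absp"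

lemma space_Q [simp]: "space Q = UNIV"
  by (simp add: Qp_space_def)

lemma ball_in_Q [measurable]: "{x. absp (x - a) \<le> p powr real_of_int g} \<in> sets Q"
  unfolding Qp_space_def by (subst sets_measure_of) auto

text \<open>The sigma algebra is generated by uncountably many balls, but those with rational
  centres already form a countable base, so that every open set is a countable union of
  generators.\<close>

lemma Q_open_sets:
  assumes "\<And>x. x \<in> U \<Longrightarrow> \<exists>g::int. \<forall>y. absp (y - x) \<le> p powr g \<longrightarrow> y \<in> U"
  shows "U \<in> sets Q"
proof -
  let ?b = "\<lambda>(u::rat, g::int). {y. absp (y - of_rat u) \<le> p powr g}"
  let ?C = "{c. ?b c \<subseteq> U}"
  have "x \<in> (\<Union>c\<in>?C. ?b c)" if "x \<in> U" for x
  proof -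
    obtain g where g: "\<And>y. absp (y - x) \<le> p powr real_of_int g \<Longrightarrow> y \<in> U"
      using assms[OF \<open>x \<in> U\<close>] by blast
    obtain u where u: "absp (x - of_rat u) < p powr real_of_int g"
      using rat_dense[of "p powr real_of_int g" x] by auto
    have "absp (y - x) \<le> p powr g" if "absp (y - of_rat u) \<le> p powr g" for y
      using absp_diff_le[OF that, of "x - of_rat u"] u by simp
    then have "(u, g) \<in> ?C" using g by auto
    then show ?thesis using u by (intro UN_I[of "(u, g)"]) auto
  qed
  then have "U = (\<Union>c\<in>?C. ?b c)" by auto
  also have "\<dots> \<in> sets Q"
    by (rule sets.countable_UN') (auto intro: ball_in_Q)
  finally show ?thesis .
qed

text \<open>By the countable base again, open sets of the plane belong to the product sigma algebra;
  continuity of addition and multiplication thereby yields their joint measurability.\<close>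

lemma Q_pair_open_sets:
  assumes "\<And>x y. (x, y) \<in> U \<Longrightarrow> \<exists>g::int. \<forall>x' y'. absp (x' - x) \<le> p powr g \<longrightarrow> absp (y' - y) \<le> p powr g \<longrightarrow> (x', y') \<in> U"
  shows "U \<in> sets (Q \<Otimes>\<^sub>M Q)"
proof -
  let ?b = "\<lambda>(u::rat, v::rat, g::int). {y. absp (y - of_rat u) \<le> p powr g} \<times> {y. absp (y - of_rat v) \<le> p powr g}"
  let ?C = "{c. ?b c \<subseteq> U}"
  have "(x, y) \<in> (\<Union>c\<in>?C. ?b c)" if xy: "(x, y) \<in> U" for x y
  proof -
    obtain g where g: "\<And>x' y'. absp (x' - x) \<le> p powr real_of_int g \<Longrightarrow>
        absp (y' - y) \<le> p powr real_of_int g \<Longrightarrow> (x', y') \<in> U"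
      using assms[OF xy] by blast
    obtain u v where u: "absp (x - of_rat u) < p powr real_of_int g" "absp (y - of_rat v) < p powr real_of_int g"
      using rat_dense[of "p powr real_of_int g" x] rat_dense[of "p powr real_of_int g" y] by auto
    have "absp (x' - x) \<le> p powr g" if "absp (x' - of_rat u) \<le> p powr g" for x'
      using absp_diff_le[OF that, of "x - of_rat u"] u by simp
    moreover have "absp (y' - y) \<le> p powr g" if "absp (y' - of_rat v) \<le> p powr g" for y'
      using absp_diff_le[OF that, of "y - of_rat v"] u by simp
    ultimately have "(u, v, g) \<in> ?C" using g by auto
    then show ?thesis using u by (intro UN_I[of "(u, v, g)"]) auto
  qed
  then have "U = (\<Union>c\<in>?C. ?b c)" by auto
  also have "\<dots> \<in> sets (Q \<Otimes>\<^sub>M Q)"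
    by (rule sets.countable_UN') (auto intro!: pair_measureI ball_in_Q)
  finally show ?thesis .
qed

lemma measurable_absp [measurable]: "absp \<in> borel_measurable Q"
proof (rule borel_measurableI_less)
  fix c
  show "{x \<in> space Q. absp x < c} \<in> sets Q"
  proof (rule Q_open_sets)
    fix x assume "x \<in> {x \<in> space Q. absp x < c}"
    then have x: "absp x < c" by simp
    then have "0 < c" using absp_nonneg[of x] by linarith
    then obtain g :: int where "real p powr g \<le> c / 2" using exists_ball_radius[of "c / 2"] by auto
    then have "absp y < c" if "absp (y - x) \<le> p powr g" for y
      using absp_add_max[of "y - x" x] that x \<open>0 < c\<close> by simp
    then show "\<exists>g::int. \<forall>y. absp (y - x) \<le> p powr g \<longrightarrow> y \<in> {x \<in> space Q. absp x < c}"
      by auto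
  qed
qed

lemma measurable_into_Q:
  assumes "\<And>a g. {x \<in> space N. absp (f x - a) \<le> p powr real_of_int g} \<in> sets N"
  shows "f \<in> measurable N Q"
  unfolding Qp_space_def
proof (rule measurable_measure_of)
  fix X assume "X \<in> range (\<lambda>(a, g::int). {x. absp (x - a) \<le> real p powr g})"
  then obtain a g where X: "X = {x. absp (x - a) \<le> real p powr real_of_int g}" by auto
  show "f -` X \<inter> space N \<in> sets N"
  proof -
    have "f -` X \<inter> space N = {x \<in> space N. absp (f x - a) \<le> p powr real_of_int g}"
      unfolding X by blast
    then show ?thesis using assms[of a g] by (rule ssubst)
  qed
qed auto

lemma measurable_add_Q [measurable (raw)]:
  assumes [measurable]: "f \<in> measurable N Q" "h \<in> measurable N Q"
  shows "(\<lambda>x. f x + h x) \<in> measurable N Q"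
proof -
  have "(\<lambda>(x, y). x + y) \<in> measurable (Q \<Otimes>\<^sub>M Q) Q"
  proof (rule measurable_into_Q, rule Q_pair_open_sets)
    fix a x y and g :: int
    assume "(x, y) \<in> {z \<in> space (Q \<Otimes>\<^sub>M Q). absp ((case z of (x, y) \<Rightarrow> x + y) - a) \<le> p powr g}"
    then have xy: "absp (x + y - a) \<le> p powr g" by simp
    have "absp (x' + y' - a) \<le> p powr g" if "absp (x' - x) \<le> p powr g" "absp (y' - y) \<le> p powr g" for x' y'
      using absp_add_le[OF xy absp_add_le[OF that]] by (simp add: algebra_simps)
    then show "\<exists>k::int. \<forall>x' y'. absp (x' - x) \<le> p powr k \<longrightarrow> absp (y' - y) \<le> p powr k \<longrightarrow>
       (x', y') \<in> {z \<in> space (Q \<Otimes>\<^sub>M Q). absp ((case z of (x, y) \<Rightarrow> x + y) - a) \<le> p powr g}"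
      by (intro exI[of _ g]) (auto simp: space_pair_measure)
  qed
  then have "(\<lambda>x. case (f x, h x) of (x, y) \<Rightarrow> x + y) \<in> measurable N Q"
    by (rule measurable_compose[rotated]) measurable
  then show ?thesis by simp
qed

lemma measurable_mult_Q [measurable (raw)]:
  assumes [measurable]: "f \<in> measurable N Q" "h \<in> measurable N Q"
  shows "(\<lambda>x. f x * h x) \<in> measurable N Q"
proof -
  have "(\<lambda>(x, y). x * y) \<in> measurable (Q \<Otimes>\<^sub>M Q) Q"
  proof (rule measurable_into_Q, rule Q_pair_open_sets)
    fix a x y and g :: int
    assume "(x, y) \<in> {z \<in> space (Q \<Otimes>\<^sub>M Q). absp ((case z of (x, y) \<Rightarrow> x * y) - a) \<le> p powr g}"
    then have xy: "absp (x * y - a) \<le> p powr g" by simp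
    define c where "c = max 1 (max (absp x) (absp y))"
    have c: "1 \<le> c" "absp x \<le> c" "absp y \<le> c" unfolding c_def by auto
    \<comment> \<open>The bound 1 keeps \<open>absp x'\<close> below \<open>c\<close>; the other
      bound then controls both terms of
      \<open>x' * y' - x * y = x' * (y' - y) + (x' - x) * y\<close>.\<close>
    obtain k where k: "p powr real_of_int k \<le> min 1 (p powr g / c)"
      using exists_ball_radius[of "min 1 (p powr g / c)"] c p_pos by (auto simp: divide_pos_pos)
    have "absp (x' * y' - a) \<le> p powr g"
      if h: "absp (x' - x) \<le> p powr k" "absp (y' - y) \<le> p powr k" for x' y'
    proof -
      have "absp (x' - x) \<le> c" "absp ((x' - x)) \<le> p powr g / c" "absp (y' - y) \<le> p powr g / c"
        using h k c by auto
      then have "absp x' \<le> c"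
        using absp_add_le[of "x' - x" c x] c by simp
      have "absp (x' * (y' - y)) \<le> c * (p powr g / c)"
        unfolding absp_mult by (intro mult_mono) (use \<open>absp x' \<le> c\<close> \<open>absp (y' - y) \<le> p powr g / c\<close> c in auto)
      moreover have "absp ((x' - x) * y) \<le> (p powr g / c) * c"
        unfolding absp_mult using \<open>absp (x' - x) \<le> p powr g / c\<close> c by (intro mult_mono) auto
      ultimately have "absp (x' * (y' - y) + (x' - x) * y) \<le> p powr g"
        using c by (intro absp_add_le) auto
      from absp_add_le[OF this xy] show ?thesis by (simp add: algebra_simps)
    qed
    then show "\<exists>k::int. \<forall>x' y'. absp (x' - x) \<le> p powr k \<longrightarrow> absp (y' - y) \<le> p powr k \<longrightarrow>
       (x', y') \<in> {z \<in> space (Q \<Otimes>\<^sub>M Q). absp ((case z of (x, y) \<Rightarrow> x * y) - a) \<le> p powr g}"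
      by (intro exI[of _ k]) (auto simp: space_pair_measure)
  qed
  then have "(\<lambda>x. case (f x, h x) of (x, y) \<Rightarrow> x * y) \<in> measurable N Q"
    by (rule measurable_compose[rotated]) measurable
  then show ?thesis by simp
qed

lemma measurable_const_Q [measurable]: "(\<lambda>x. c) \<in> measurable N Q"
  by simp

lemma measurable_diff_Q [measurable (raw)]:
  assumes [measurable]: "f \<in> measurable N Q" "h \<in> measurable N Q"
  shows "(\<lambda>x. f x - h x) \<in> measurable N Q"
proof -
  have "(\<lambda>x. f x + (-1) * h x) \<in> measurable N Q" by measurable
  then show ?thesis by simp
qed

lemma measurable_sum_Q [measurable (raw)]:
  "(\<And>i. i \<in> I \<Longrightarrow> f i \<in> measurable N Q) \<Longrightarrow> (\<lambda>x. \<Sum>i\<in>I. f i x) \<in> measurable N Q"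
proof (induction I rule: infinite_finite_induct)
  case (insert i I)
  then have "(\<lambda>x. f i x + (\<Sum>i\<in>I. f i x)) \<in> measurable N Q"
    by (intro measurable_add_Q) auto
  with insert show ?case by simp
qed simp_all

lemma measurable_prod_Q [measurable (raw)]:
  "(\<And>i. i \<in> I \<Longrightarrow> f i \<in> measurable N Q) \<Longrightarrow> (\<lambda>x. \<Prod>i\<in>I. f i x) \<in> measurable N Q"
proof (induction I rule: infinite_finite_induct)
  case (insert i I)
  then have "(\<lambda>x. f i x * (\<Prod>i\<in>I. f i x)) \<in> measurable N Q"
    by (intro measurable_mult_Q) auto
  with insert show ?case by simp
qed simp_all

lemma measurable_det_Q:
  fixes A :: "'b \<Rightarrow> 'a^'n::finite^'n"
  assumes "\<And>j k. (\<lambda>y. A y $ j $ k) \<in> measurable N Q"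
  shows "(\<lambda>y. det (A y)) \<in> measurable N Q"
  unfolding det_def using assms by (intro measurable_sum_Q measurable_mult_Q measurable_const_Q measurable_prod_Q)

lemma measurable_mnorm:
  fixes A :: "'b \<Rightarrow> 'a^'n::finite^'n"
  assumes [measurable]: "\<And>j k. (\<lambda>y. A y $ j $ k) \<in> measurable N Q"
  shows "(\<lambda>y. mnorm absp (A y)) \<in> borel_measurable N"
  unfolding mnorm_def
  by (intro borel_measurable_Max) (auto split: prod.splits)

end

subsection \<open>Haar measure\<close>

locale haar_space = padic_field p absp
  for p :: nat and absp :: "'a::field_char_0 \<Rightarrow> real" +
  fixes M :: "('a^'n::finite) measure"
  assumes is_haar: "is_haar p absp M"
begin

lemma space_M [simp]: "space M = UNIV"
  and sets_M: "sets M = sigma_sets UNIV (range (\<lambda>(a, g). pball p absp a g))"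
  and emeasure_B0_0: "emeasure M (B0 p absp 0) = 1"
  and emeasure_translate: "E \<in> sets M \<Longrightarrow> emeasure M ((\<lambda>x. a + x) ` E) = emeasure M E"
  using is_haar by (simp_all add: is_haar_def)

lemma pball_sets [measurable]: "pball p absp a g \<in> sets M"
  unfolding sets_M by (rule sigma_sets.Basic) auto

lemma open_sets_M:
  assumes "\<And>x. x \<in> U \<Longrightarrow> \<exists>g. pball p absp x g \<subseteq> U"
  shows "U \<in> sets M"
proof -
  let ?v = "\<lambda>u :: rat^'n. \<chi> j. of_rat (u $ j)"
  let ?C = "{(u, g). pball p absp (?v u) g \<subseteq> U}"
  have "x \<in> (\<Union>(u, g)\<in>?C. pball p absp (?v u) g)" if "x \<in> U" for x
  proof -
    obtain g where g: "pball p absp x g \<subseteq> U"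
      using assms[OF \<open>x \<in> U\<close>] by blast
    obtain u where u: "?v u \<in> pball p absp x g"
      using rat_vec_dense[of x g] by blast
    then have "pball p absp (?v u) g = pball p absp x g" using pball_eqI by blast
    then show ?thesis using g by (intro UN_I[of "(u, g)"]) auto
  qed
  then have "U = (\<Union>(u, g)\<in>?C. pball p absp (?v u) g)" by blast
  also have "\<dots> \<in> sets M"
    by (rule sets.countable_UN') auto
  finally show ?thesis .
qed

lemma measurable_component [measurable]: "(\<lambda>x. x $ j) \<in> measurable M Q"
proof (rule measurable_into_Q, rule open_sets_M)
  fix a x and g :: int
  assume "x \<in> {x \<in> space M. absp (x $ j - a) \<le> p powr g}"
  then have x: "absp (x $ j - a) \<le> p powr g" by simp
  have "absp (y $ j - a) \<le> p powr g" if "y \<in> pball p absp x g" for y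
    using absp_add_le[OF x, of "y $ j - x $ j"] that by (simp add: mem_pball)
  then show "\<exists>k. pball p absp x k \<subseteq> {x \<in> space M. absp (x $ j - a) \<le> p powr g}"
    by auto
qed

lemma measurable_into_M:
  assumes [measurable]: "\<And>j. (\<lambda>x. f x $ j) \<in> measurable N Q"
  shows "f \<in> measurable N M"
proof (rule measurable_sigma_sets[OF sets_M])
  fix X assume "X \<in> range (\<lambda>(a :: 'a^'n, g). pball p absp a g)"
  then obtain a :: "'a^'n" and g where X: "X = pball p absp a g" by auto
  have "f -` X \<inter> space N = {x \<in> space N. \<forall>j. absp (f x $ j - a $ j) \<le> p powr g}"
    unfolding X by (auto simp: mem_pball)
  also have "\<dots> \<in> sets N" by measurable
  finally show "f -` X \<inter> space N \<in> sets N" .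
qed auto

lemma measurable_matrix_vector [measurable (raw)]:
  fixes A :: "'b \<Rightarrow> 'a^'n^'n"
  assumes [measurable]: "\<And>j k. (\<lambda>x. A x $ j $ k) \<in> measurable N Q" "f \<in> measurable N M"
  shows "(\<lambda>x. A x *v f x) \<in> measurable N M"
  by (rule measurable_into_M) (simp add: matrix_vector_mult_def)

lemma measurable_matrix [measurable]: "(*v) A \<in> measurable M M" for A :: "'a^'n^'n"
  by (rule measurable_matrix_vector) auto

lemma measurable_plus_const: "(\<lambda>x. a + x) \<in> measurable M M" for a :: "'a^'n"
  by (rule measurable_into_M) simp

lemma measurable_vnorm [measurable]: "(\<lambda>x :: 'a^'n. vnorm absp x) \<in> borel_measurable M"
  unfolding vnorm_def by (intro borel_measurable_Max) auto

section \<open>Boxes and the uniqueness of Haar measure\<close>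

definition pbox :: "('n \<Rightarrow> int) \<Rightarrow> ('a^'n) set" where
  "pbox k = {x. \<forall>j. absp (x $ j) \<le> p powr real_of_int (k j)}"

lemma pball_0_eq_pbox: "B0 p absp g = pbox (\<lambda>_. g)"
  by (auto simp: pbox_def mem_pball)

lemma pbox_sets [measurable]: "pbox k \<in> sets M"
proof -
  have "pbox k = {x \<in> space M. \<forall>j. absp (x $ j) \<le> p powr real_of_int (k j)}"
    by (simp add: pbox_def)
  also have "\<dots> \<in> sets M" by measurable
  finally show ?thesis .
qed

lemma image_plus_eq_vimage: "(\<lambda>x. a + x) ` X = (\<lambda>x. - a + x) -` X" for a :: "'a^'n"
  by (auto simp: image_iff algebra_simps intro!: bexI[of _ "_ - a"])

text \<open>Scaled by a power of p, the coordinate \<open>x $ j\<close> of a point of the box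
  becomes a p-adic integer, and its leading digit \<open>i\<close> selects the translate. Existence
  of a digit gives the union, distinctness of digits the disjointness. Splitting one direction at a
  time is the reason for boxes with independent side lengths.\<close>

lemma pbox_split:
  defines "t \<equiv> \<lambda>k j i. axis j (of_nat i * of_nat p powi (- k j)) :: 'a^'n"
  shows "pbox k = (\<Union>i<p. (\<lambda>x. t k j i + x) ` pbox (k(j := k j - 1)))"
    and "disjoint_family_on (\<lambda>i. (\<lambda>x. t k j i + x) ` pbox (k(j := k j - 1))) {..<p}"
proof -
  define P where "P = (of_nat p powi (- k j) :: 'a)"
  have P: "absp P = p powr k j" unfolding P_def absp_powi_p by simp
  have P0: "P \<noteq> 0" using p_pos by (simp add: P_def)
  have pm1: "p powr real_of_int (k j - 1) = p powr k j * (1 / p)"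
    using p_pos by (simp add: powr_diff)
  have mem: "x \<in> (\<lambda>x. t k j i + x) ` pbox (k(j := k j - 1)) \<longleftrightarrow>
      absp (x $ j / P - of_nat i) \<le> 1 / p \<and> (\<forall>l. l \<noteq> j \<longrightarrow> absp (x $ l) \<le> p powr k l)" for x i
  proof -
    have "x $ j - of_nat i * P = P * (x $ j / P - of_nat i)"
      using P0 by (simp add: field_simps)
    then have "absp (x $ j - of_nat i * P) \<le> p powr real_of_int (k j - 1) \<longleftrightarrow>
        absp (x $ j / P - of_nat i) \<le> 1 / p"
      unfolding pm1 using p_pos mult_le_cancel_left_pos[of "p powr k j" "absp (x $ j / P - of_nat i)" "1 / p"]
      by (simp add: absp_mult P)
    then show ?thesis
      unfolding image_plus_eq_vimage
      by (auto simp: pbox_def t_def axis_def P_def[symmetric] split: if_splits)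
  qed
  show "pbox k = (\<Union>i<p. (\<lambda>x. t k j i + x) ` pbox (k(j := k j - 1)))"
  proof (intro set_eqI iffI)
    fix x assume x: "x \<in> pbox k"
    then have "absp (x $ j / P) \<le> 1" using p_pos by (auto simp: pbox_def absp_divide P)
    then obtain i where "i < p" "absp (x $ j / P - of_nat i) \<le> 1 / p" using digit by blast
    then show "x \<in> (\<Union>i<p. (\<lambda>x. t k j i + x) ` pbox (k(j := k j - 1)))"
      using x mem[of x i] by (auto simp: pbox_def[of k])
  next
    fix x assume "x \<in> (\<Union>i<p. (\<lambda>x. t k j i + x) ` pbox (k(j := k j - 1)))"
    then obtain i where i: "absp (x $ j / P - of_nat i) \<le> 1 / p"
      "\<forall>l. l \<noteq> j \<longrightarrow> absp (x $ l) \<le> p powr k l" unfolding UN_iff mem by blast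
    have "1 / real p \<le> 1" using real_p_gt_1 by simp
    then have "absp ((x $ j / P - of_nat i) + of_nat i) \<le> 1"
      using order_trans[OF i(1) \<open>1 / real p \<le> 1\<close>] absp_of_int_le_1[of "int i"] by (intro absp_add_le) auto
    then have "absp (x $ j) \<le> p powr k j" using p_pos by (simp add: absp_divide P)
    then show "x \<in> pbox k" using i(2) unfolding pbox_def by auto
  qed
  show "disjoint_family_on (\<lambda>i. (\<lambda>x. t k j i + x) ` pbox (k(j := k j - 1))) {..<p}"
    unfolding disjoint_family_on_def
  proof (intro ballI impI equals0I)
    fix i i' x assume *: "i \<in> {..<p}" "i' \<in> {..<p}" "i \<noteq> i'"
      and x: "x \<in> (\<lambda>x. t k j i + x) ` pbox (k(j := k j - 1)) \<inter> (\<lambda>x. t k j i' + x) ` pbox (k(j := k j - 1))"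
    have "absp (x $ j / P - of_nat i) \<le> 1 / p" "absp (x $ j / P - of_nat i') \<le> 1 / p"
      using x unfolding Int_iff mem by blast+
    then have "absp ((x $ j / P - of_nat i') - (x $ j / P - of_nat i)) \<le> 1 / p"
      using absp_diff_le by blast
    then have "1 \<le> 1 / real p" using absp_of_nat_diff[of i i'] * by simp
    then show False using real_p_gt_1 by simp
  qed
qed

lemma scale_int:
  fixes h :: "int \<Rightarrow> ennreal"
  assumes "\<And>i. h i = of_nat p * h (i - 1)"
  shows "h i = ennreal (p powr real_of_int (i - l)) * h l"
proof -
  have up: "h (l + int d) = ennreal (p powr real d) * h l" for l d
  proof (induction d)
    case (Suc d)
    have "h (l + int (Suc d)) = of_nat p * h (l + int d)"
      using assms[of "l + int (Suc d)"] by simp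
    also have "\<dots> = ennreal (real p * p powr real d) * h l"
      unfolding Suc.IH by (simp add: ennreal_mult ennreal_of_nat_eq_real_of_nat mult.assoc)
    also have "real p * p powr real d = p powr real (Suc d)"
      using p_pos by (simp add: powr_add)
    finally show ?case .
  qed (use p_pos in simp)
  show ?thesis
  proof (cases "l \<le> i")
    case True
    then show ?thesis using up[of l "nat (i - l)"] by simp
  next
    case False
    then have "h l = ennreal (p powr real_of_int (l - i)) * h i"
      using up[of i "nat (l - i)"] by simp
    then have "ennreal (p powr real_of_int (i - l)) * h l =
        ennreal (p powr real_of_int (i - l) * p powr real_of_int (l - i)) * h i"
      by (simp add: ennreal_mult mult.assoc)
    also have "p powr real_of_int (i - l) * p powr real_of_int (l - i) = 1"
      using p_pos by (simp flip: powr_add)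
    finally show ?thesis by simp
  qed
qed

text \<open>Only invariance is used, so that the ratio of two invariant measures can be read off
  from a single box.\<close>

lemma emeasure_pbox_scale:
  assumes N: "sets N = sets M"
    and inv: "\<And>E a. E \<in> sets M \<Longrightarrow> emeasure N ((\<lambda>x. a + x) ` E) = emeasure N E"
  shows "emeasure N (pbox k) = ennreal (p powr (\<Sum>j\<in>UNIV. real_of_int (k j - l j))) * emeasure N (pbox l)"
proof -
  have step: "emeasure N (pbox k) = of_nat p * emeasure N (pbox (k(j := k j - 1)))" for k j
  proof -
    let ?B = "pbox (k(j := k j - 1))"
    let ?t = "\<lambda>i. axis j (of_nat i * of_nat p powi (- k j)) :: 'a^'n"
    have "emeasure N (pbox k) = emeasure N (\<Union>i<p. (\<lambda>x. ?t i + x) ` ?B)"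
      using pbox_split(1)[of k j] by simp
    also have "\<dots> = (\<Sum>i<p. emeasure N ((\<lambda>x. ?t i + x) ` ?B))"
    proof (rule sum_emeasure[symmetric])
      have "(\<lambda>x. ?t i + x) ` ?B \<in> sets M" for i
        unfolding image_plus_eq_vimage
        using measurable_sets[OF measurable_plus_const pbox_sets, of "- ?t i" "k(j := k j - 1)"]
        by (simp del: add_uminus_conv_diff uminus_add_conv_diff)
      then show "(\<lambda>i. (\<lambda>x. ?t i + x) ` ?B) ` {..<p} \<subseteq> sets N" using N by auto
    qed (use pbox_split(2) in auto)
    also have "\<dots> = of_nat p * emeasure N ?B"
      using inv by simp
    finally show ?thesis .
  qed
  have coord: "emeasure N (pbox (k(j := i))) = ennreal (p powr real_of_int (i - k j)) * emeasure N (pbox k)" for k j i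
  proof -
    have "emeasure N (pbox (k(j := i))) = of_nat p * emeasure N (pbox (k(j := i - 1)))" for i
      using step[of "k(j := i)" j] by simp
    then have "emeasure N (pbox (k(j := i))) =
        ennreal (p powr real_of_int (i - k j)) * emeasure N (pbox (k(j := k j)))"
      by (rule scale_int)
    then show ?thesis by simp
  qed
  \<comment> \<open>\<open>S\<close> collects the coordinates whose side length has already been
    changed from \<open>l\<close> to \<open>k\<close>.\<close>
  have "emeasure N (pbox (\<lambda>j. if j \<in> S then k j else l j)) =
     ennreal (p powr (\<Sum>j\<in>S. real_of_int (k j - l j))) * emeasure N (pbox l)" for S
    using finite[of S]
  proof (induction S rule: finite_induct)
    case (insert j S)
    have "(\<lambda>i. if i \<in> insert j S then k i else l i) = (\<lambda>i. if i \<in> S then k i else l i)(j := k j)"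
      by auto
    then show ?case
      using insert coord[of "\<lambda>i. if i \<in> S then k i else l i" j "k j"]
      by (simp add: powr_add ennreal_mult mult.assoc)
  qed (use p_pos in simp)
  from this[of UNIV] show ?thesis by simp
qed

lemma emeasure_pbox: "emeasure M (pbox k) = ennreal (p powr (\<Sum>j\<in>UNIV. real_of_int (k j)))"
  using emeasure_pbox_scale[of M k "\<lambda>_. 0"] emeasure_B0_0 emeasure_translate
  by (simp add: pball_0_eq_pbox)

lemma emeasure_B0: "emeasure M (B0 p absp g) = ennreal (p powr (real CARD('n) * real_of_int g))"
  by (simp add: pball_0_eq_pbox emeasure_pbox)

lemma measure_B0: "measure M (B0 p absp g) = p powr (real CARD('n) * real_of_int g)"
  by (simp add: measure_def emeasure_B0)

lemma measure_B0_pos [simp]: "0 < measure M (B0 p absp g)"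
  using p_pos by (simp add: measure_B0)

lemma emeasure_B0_eq: "emeasure M (B0 p absp g) = ennreal (measure M (B0 p absp g))"
  by (simp add: emeasure_B0 measure_B0)

lemma pball_translate: "pball p absp a g = (\<lambda>x. a + x) ` B0 p absp g" for a :: "'a^'n"
  unfolding image_plus_eq_vimage by (auto simp: mem_pball)

lemma UN_B0: "(\<Union>i::nat. B0 p absp (int i)) = (UNIV :: ('a^'n) set)"
proof (intro set_eqI iffI UNIV_I)
  fix x :: "'a^'n"
  obtain N where "vnorm absp x < p ^ N" using real_arch_pow[OF real_p_gt_1, of "vnorm absp x"] by auto
  then have "vnorm absp x \<le> p powr real_of_int (int N)" using p_pos by (simp add: powr_realpow)
  then show "x \<in> (\<Union>i::nat. B0 p absp (int i))"
    by (auto simp: pball_def)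
qed

sublocale sigma_finite_measure M
proof
  show "\<exists>A. countable A \<and> A \<subseteq> sets M \<and> \<Union>A = space M \<and> (\<forall>a\<in>A. emeasure M a \<noteq> \<infinity>)"
    by (intro exI[of _ "range (\<lambda>i::nat. B0 p absp (int i))"])
       (auto simp: UN_B0 emeasure_B0)
qed

text \<open>Scaling of boxes carries the ratio from one box to all central balls, invariance carries
  it to all balls, and the balls are an intersection-stable generator with an exhausting sequence of
  finite measure.\<close>

lemma haar_unique:
  assumes N: "sets N = sets M"
    and inv: "\<And>E a. E \<in> sets M \<Longrightarrow> emeasure N ((\<lambda>x. a + x) ` E) = emeasure N E"
    and box: "emeasure N (pbox l) = ennreal c * emeasure M (pbox l)" and X: "X \<in> sets M"
  shows "emeasure N X = ennreal c * emeasure M X"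
proof -
  let ?E = "insert {} (range (\<lambda>(a :: 'a^'n, g). pball p absp a g))"
  have sets_E: "sigma_sets UNIV ?E = sets M"
    unfolding sets_M
    by (intro antisym sigma_sets_mono) (auto intro: sigma_sets.Empty sigma_sets.Basic)
  have eq: "emeasure N (pball p absp a g) = ennreal c * emeasure M (pball p absp a g)" for a g
  proof -
    have "emeasure N (B0 p absp g) = ennreal c * emeasure M (B0 p absp g)"
      using emeasure_pbox_scale[OF N inv, of "\<lambda>_. g" l]
        emeasure_pbox_scale[OF refl emeasure_translate, of "\<lambda>_. g" l]
      by (simp add: pball_0_eq_pbox box ac_simps)
    then show ?thesis
      using inv[of "B0 p absp g" a] emeasure_translate[of "B0 p absp g" a]
      by (simp add: pball_translate[of a])
  qed
  have "N = scale_measure (ennreal c) M"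
  proof (rule measure_eqI_generator_eq[OF Int_stable_pballs, where \<Omega> = UNIV and A = "\<lambda>i::nat. B0 p absp (int i)"])
    show "range (\<lambda>i. B0 p absp (int i)) \<subseteq> ?E" by auto
    show "emeasure N (B0 p absp (int i)) \<noteq> \<infinity>" for i
      by (simp add: eq emeasure_B0 ennreal_mult_eq_top_iff)
  qed (auto simp: sets_E N UN_B0 eq)
  then show ?thesis by simp
qed

subsection \<open>Linear change of variables\<close>

text \<open>Preimages are used because the condition then describes the push-forward of
  \<open>M\<close> under \<open>A\<close>, the measure to which uniqueness applies.\<close>

definition scales_haar :: "'a^'n^'n \<Rightarrow> bool" where
  "scales_haar A \<longleftrightarrow> (\<forall>X\<in>sets M. emeasure M ((*v) A -` X) = ennreal (1 / absp (det A)) * emeasure M X)"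

lemma vimage_sets: "X \<in> sets M \<Longrightarrow> (*v) A -` X \<in> sets M" for A :: "'a^'n^'n"
  using measurable_sets[OF measurable_matrix, of X A] by simp

lemma scales_haar_mult:
  assumes "scales_haar A" "scales_haar B" shows "scales_haar (A ** B)"
  unfolding scales_haar_def
proof
  fix X assume X: "X \<in> sets M"
  have "(*v) (A ** B) -` X = (*v) B -` ((*v) A -` X)"
    by (auto simp: matrix_vector_mul_assoc)
  then have "emeasure M ((*v) (A ** B) -` X) =
      ennreal (1 / absp (det B)) * (ennreal (1 / absp (det A)) * emeasure M X)"
    using assms X vimage_sets[OF X, of A] by (simp add: scales_haar_def)
  also have "\<dots> = ennreal (1 / absp (det B) * (1 / absp (det A))) * emeasure M X"
    by (subst ennreal_mult) (simp_all add: mult.assoc)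
  also have "1 / absp (det B) * (1 / absp (det A)) = 1 / absp (det (A ** B))"
    by (simp add: det_mul absp_mult)
  finally show "emeasure M ((*v) (A ** B) -` X) = ennreal (1 / absp (det (A ** B))) * emeasure M X" .
qed

text \<open>The push-forward of \<open>M\<close> under \<open>A\<close> is again translation
  invariant, since a translation by \<open>a\<close> pulls back to the translation by the inverse
  image of \<open>a\<close>. By uniqueness a single box determines the factor.\<close>

lemma scales_haarI:
  fixes A :: "'a^'n^'n"
  assumes A: "invertible A"
    and eq: "emeasure M ((*v) A -` pbox l) = ennreal (1 / absp (det A)) * emeasure M (pbox l)"
  shows "scales_haar A"
  unfolding scales_haar_def
proof
  fix X assume X: "X \<in> sets M"
  let ?N = "distr M M ((*v) A)"
  have em: "emeasure ?N E = emeasure M ((*v) A -` E)" if "E \<in> sets M" for E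
    using that by (simp add: emeasure_distr)
  have inv: "emeasure ?N ((\<lambda>x. a + x) ` E) = emeasure ?N E" if E: "E \<in> sets M" for E a
  proof -
    have aE: "(\<lambda>x. a + x) ` E \<in> sets M"
      unfolding image_plus_eq_vimage using measurable_sets[OF measurable_plus_const E, of "- a"]
      by (simp del: add_uminus_conv_diff uminus_add_conv_diff)
    obtain B where B: "A ** B = mat 1" using A unfolding invertible_def by blast
    have AB: "A *v (B *v v) = v" for v by (simp add: matrix_vector_mul_assoc B)
    have "(*v) A -` ((\<lambda>x. a + x) ` E) = (\<lambda>x. B *v a + x) ` ((*v) A -` E)"
      unfolding image_plus_eq_vimage
      by (auto simp: matrix_vector_mult_diff_distrib AB)
    then show ?thesis
      using E aE by (simp add: em emeasure_translate vimage_sets)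
  qed
  have "emeasure ?N (pbox l) = ennreal (1 / absp (det A)) * emeasure M (pbox l)"
    using eq by (simp add: em)
  from haar_unique[OF _ inv this X]
  have "emeasure ?N X = ennreal (1 / absp (det A)) * emeasure M X" by simp
  then show "emeasure M ((*v) A -` X) = ennreal (1 / absp (det A)) * emeasure M X"
    using X by (simp add: em)
qed

definition set_row :: "'n \<Rightarrow> 'a^'n \<Rightarrow> 'a^'n^'n" where
  "set_row k v = (\<chi> i. if i = k then v else axis i 1)"

lemma sum_axis_mult: "(\<Sum>j\<in>UNIV. axis i 1 $ j * x $ j) = x $ i" for x :: "'a^'n"
proof -
  have "(\<Sum>j\<in>UNIV. axis i 1 $ j * x $ j) = (\<Sum>j\<in>UNIV. if j = i then x $ j else 0)"
    by (intro sum.cong refl) (simp add: axis_def)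
  then show ?thesis by simp
qed

lemma set_row_mult_vec: "(set_row k v *v x) $ i = (if i = k then (\<Sum>j\<in>UNIV. v $ j * x $ j) else x $ i)"
  by (cases "i = k") (simp_all add: set_row_def matrix_vector_mult_def sum_axis_mult)

lemma det_set_row: "det (set_row k v) = v $ k"
proof -
  have rows: "row i (mat 1 :: 'a^'n^'n) = axis i 1" for i
    by (auto simp: vec_eq_iff row_def mat_def axis_def)
  have "(\<Sum>i\<in>UNIV. v $ i *s axis i 1) = v"
  proof -
    have "(\<Sum>i\<in>UNIV. v $ i * axis i 1 $ j) = (\<Sum>i\<in>UNIV. if i = j then v $ i else 0)" for j
      by (intro sum.cong refl) (simp add: axis_def)
    then show ?thesis by (simp add: vec_eq_iff)
  qed
  then have "set_row k v = (\<chi> i. if i = k then \<Sum>i\<in>UNIV. v $ i *s row i (mat 1) else row i (mat 1))"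
    by (simp only: rows set_row_def)
  then show ?thesis
    using cramer_lemma_transpose[of k v "mat 1"] by simp
qed

text \<open>On a box that is long enough in direction \<open>k\<close>, the map only stretches this direction.\<close>

lemma scales_haar_set_row:
  assumes "v $ k \<noteq> 0" shows "scales_haar (set_row k v)"
proof -
  obtain d :: int where d: "absp (v $ k) = p powr d" using absp_discrete[OF assms] by blast
  \<comment> \<open>All entries of \<open>v\<close> are bounded by \<open>p ^ N\<close>, so on
    points whose other coordinates have absolute value at most 1 the sum over
    \<open>j \<noteq> k\<close> is absorbed by the radius \<open>p ^ N\<close> in direction
    \<open>k\<close>, and only \<open>v $ k * x $ k\<close> decides membership.\<close>
  obtain N where N: "vnorm absp v < p ^ N"
    using real_arch_pow[OF real_p_gt_1, of "vnorm absp v"] by auto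
  let ?l = "(\<lambda>_. 0)(k := int N)"
  let ?l' = "(\<lambda>_. 0)(k := int N - d)"
  have vj: "absp (v $ j) \<le> p powr real_of_int (int N)" for j
    using absp_le_vnorm[of v j] N by (simp add: powr_realpow)
  have "(*v) (set_row k v) -` pbox ?l = pbox ?l'"
  proof -
    have "absp (\<Sum>j\<in>UNIV. v $ j * x $ j) \<le> p powr real_of_int (int N) \<longleftrightarrow>
        absp (x $ k) \<le> p powr real_of_int (int N - d)"
      if x: "\<And>j. j \<noteq> k \<Longrightarrow> absp (x $ j) \<le> 1" for x
    proof -
      have rest: "absp (\<Sum>j\<in>UNIV - {k}. v $ j * x $ j) \<le> p powr real_of_int (int N)"
      proof (rule absp_sum_le)
        fix j assume "j \<in> UNIV - {k}"
        then have "absp (v $ j) * absp (x $ j) \<le> p powr real_of_int (int N) * 1"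
          using x vj by (intro mult_mono) auto
        then show "absp (v $ j * x $ j) \<le> p powr real_of_int (int N)" by (simp add: absp_mult)
      qed simp
      have split: "(\<Sum>j\<in>UNIV. v $ j * x $ j) = v $ k * x $ k + (\<Sum>j\<in>UNIV - {k}. v $ j * x $ j)"
        by (simp add: sum.remove)
      have "absp (\<Sum>j\<in>UNIV. v $ j * x $ j) \<le> p powr real_of_int (int N) \<longleftrightarrow>
          absp (v $ k * x $ k) \<le> p powr real_of_int (int N)"
        using absp_add_le[OF _ rest, of "v $ k * x $ k"]
          absp_diff_le[OF _ rest, of "\<Sum>j\<in>UNIV. v $ j * x $ j"]
        unfolding split by auto
      also have "\<dots> \<longleftrightarrow> absp (x $ k) \<le> p powr real_of_int (int N - d)"
        by (simp add: absp_mult d powr_diff field_simps)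
      finally show ?thesis .
    qed
    moreover have "x \<in> (*v) (set_row k v) -` pbox ?l \<longleftrightarrow>
        absp (\<Sum>j\<in>UNIV. v $ j * x $ j) \<le> p powr real_of_int (int N) \<and> (\<forall>j. j \<noteq> k \<longrightarrow> absp (x $ j) \<le> 1)" for x
      by (auto simp: pbox_def set_row_mult_vec)
    moreover have "x \<in> pbox ?l' \<longleftrightarrow>
        absp (x $ k) \<le> p powr real_of_int (int N - d) \<and> (\<forall>j. j \<noteq> k \<longrightarrow> absp (x $ j) \<le> 1)" for x
      by (auto simp: pbox_def)
    ultimately show ?thesis by blast
  qed
  moreover have "(\<Sum>j\<in>UNIV. real_of_int (?l j)) = N" "(\<Sum>j\<in>UNIV. real_of_int (?l' j)) = N - d"
    by (simp_all add: if_distrib cong: if_cong)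
  ultimately have "emeasure M ((*v) (set_row k v) -` pbox ?l) =
      ennreal (1 / absp (det (set_row k v))) * emeasure M (pbox ?l)"
    by (simp add: emeasure_pbox det_set_row d powr_diff flip: ennreal_mult)
  moreover have "invertible (set_row k v)"
    using assms by (simp add: invertible_det_nz det_set_row)
  ultimately show ?thesis by (rule scales_haarI[rotated])
qed

definition swap_mat :: "'n \<Rightarrow> 'n \<Rightarrow> 'a^'n^'n" where
  "swap_mat k l = (\<chi> i. axis (Transposition.transpose k l i) 1)"

lemma swap_mat_mult_vec: "(swap_mat k l *v x) $ i = x $ Transposition.transpose k l i"
  by (simp add: swap_mat_def matrix_vector_mult_def sum_axis_mult)

lemma swap_mat_involution: "swap_mat k l ** swap_mat k l = mat 1"
proof (rule iffD2[OF matrix_eq], rule allI)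
  fix x :: "'a^'n"
  show "(swap_mat k l ** swap_mat k l) *v x = mat 1 *v x"
    by (simp add: vec_eq_iff swap_mat_mult_vec flip: matrix_vector_mul_assoc)
qed

text \<open>An involution has a determinant of square 1, so no sign has to be computed, and the unit
  ball is symmetric in the coordinates.\<close>

lemma scales_haar_swap_mat: "scales_haar (swap_mat k l)"
proof -
  have "absp (det (swap_mat k l)) ^ 2 = 1"
    using arg_cong[OF swap_mat_involution[of k l], of "\<lambda>A. absp (det A)"]
    by (simp add: det_mul absp_mult power2_eq_square)
  then have det1: "absp (det (swap_mat k l)) = 1"
    using absp_nonneg[of "det (swap_mat k l)"] by (auto simp: power2_eq_1_iff)
  have "(*v) (swap_mat k l) -` pbox (\<lambda>_. 0) = pbox (\<lambda>_. 0)"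
  proof -
    have "(\<forall>i. absp (x $ Transposition.transpose k l i) \<le> 1) \<longleftrightarrow> (\<forall>i. absp (x $ i) \<le> 1)" for x :: "'a^'n"
      by (metis transpose_involutory)
    then show ?thesis by (auto simp: pbox_def swap_mat_mult_vec)
  qed
  moreover have "invertible (swap_mat k l)"
    using swap_mat_involution[of k l] unfolding invertible_def by blast
  ultimately show ?thesis by (intro scales_haarI[where l = "\<lambda>_. 0"]) (simp_all add: det1)
qed

text \<open>Gaussian elimination on columns, by induction on the number of rows that are not yet unit
  vectors: \<open>B = A' ** set_row k (B $ k)\<close>, where \<open>A'\<close> has one more unit row, after a
  column swap that makes the pivot nonzero.\<close>

lemma scales_haar_invertible: "invertible A \<Longrightarrow> scales_haar A"
proof (induction "card {i. A $ i \<noteq> axis i 1}" arbitrary: A rule: less_induct)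
  case less
  let ?R = "\<lambda>A :: 'a^'n^'n. {i. A $ i \<noteq> axis i 1}"
  \<comment> \<open>One elimination step. It is stated for a matrix \<open>B\<close> with no more
    non-unit rows than \<open>A\<close>, because it is also applied after a column swap.\<close>
  have pivot: "scales_haar B" if B: "invertible B" and card: "card (?R B) \<le> card (?R A)"
    and k: "B $ k \<noteq> axis k 1" "B $ k $ k \<noteq> 0" for B k
  proof -
    let ?E = "set_row k (B $ k)"
    have "invertible ?E" using k by (simp add: invertible_det_nz det_set_row)
    then obtain F where F: "?E ** F = mat 1" "F ** ?E = mat 1" unfolding invertible_def by blast
    then have "invertible F" unfolding invertible_def by blast
    let ?A' = "B ** F"
    have BE: "B = ?A' ** ?E" by (simp add: F matrix_mul_assoc[symmetric])
    have row: "?A' $ i = axis i 1" if "B $ i = ?E $ i" for i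
    proof -
      have "?A' $ i = (?E ** F) $ i" using that by (simp add: matrix_matrix_mult_def vec_eq_iff)
      then show ?thesis by (simp add: F vec_eq_iff mat_def axis_def)
    qed
    have "?R ?A' \<subset> ?R B"
    proof
      show "?R ?A' \<subseteq> ?R B"
      proof clarify
        fix i assume i: "?A' $ i \<noteq> axis i 1" "B $ i = axis i 1"
        then have "B $ i = ?E $ i" by (auto simp: set_row_def)
        then show False using row i(1) by blast
      qed
      show "?R ?A' \<noteq> ?R B" using row[of k] k(1) by (auto simp: set_row_def)
    qed
    then have "card (?R ?A') < card (?R B)" by (intro psubset_card_mono) auto
    moreover have "invertible ?A'" using B \<open>invertible F\<close> by (rule invertible_mult)
    ultimately have "scales_haar ?A'" using less.hyps card by force
    then show ?thesis
      using scales_haar_mult[OF _ scales_haar_set_row[OF k(2)], of ?A'] BE by simp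
  qed
  show ?case
  proof (cases "?R A = {}")
    case True
    then have "A = mat 1" by (auto simp: vec_eq_iff mat_def axis_def)
    then show ?thesis by (simp add: scales_haar_def vimage_def)
  next
    case False
    then obtain k where k: "A $ k \<noteq> axis k 1" by auto
    have "\<exists>l\<in>?R A. A $ k $ l \<noteq> 0"
    proof (rule ccontr)
      assume "\<not> ?thesis"
      then have zero: "A $ k $ l = 0" if "A $ l \<noteq> axis l 1" for l using that by blast
      \<comment> \<open>If row \<open>k\<close> vanished in every non-unit column, it would be a
        combination of the unit rows. These are the coefficients of that dependence; the coefficient
        at \<open>k\<close> is 1 because row \<open>k\<close> is not a unit vector.\<close>
      define v where "v = (\<chi> i. (if i = k then 1 else 0) - (if A $ i = axis i 1 then A $ k $ i else 0))"
      have "(v v* A) $ l = 0" for l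
      proof -
        have "(v v* A) $ l = (\<Sum>i\<in>UNIV. (if i = k then A $ i $ l else 0)
            - (if A $ i = axis i 1 then A $ k $ i * A $ i $ l else 0))"
          by (auto simp: vector_matrix_mult_def v_def left_diff_distrib mult.commute intro!: sum.cong)
        also have "\<dots> = A $ k $ l - (\<Sum>i\<in>UNIV. if A $ i = axis i 1 then A $ k $ i * A $ i $ l else 0)"
          by (simp add: sum_subtractf)
        also have "(\<Sum>i\<in>UNIV. if A $ i = axis i 1 then A $ k $ i * A $ i $ l else 0) =
            (\<Sum>i\<in>UNIV. if i = l then A $ k $ i else 0)"
          by (intro sum.cong refl) (auto simp: axis_def zero)
        finally show ?thesis by simp
      qed
      then have vA: "v v* A = 0" by (simp add: vec_eq_iff)
      obtain B where B: "A ** B = mat 1" using less.prems unfolding invertible_def by blast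
      have "v = (v v* A) v* B" by (simp add: vector_matrix_mul_assoc B)
      also have "\<dots> = 0" by (simp add: vA)
      finally have "v $ k = 0" by simp
      then show False using k by (simp add: v_def)
    qed
    then obtain l where l: "A $ l \<noteq> axis l 1" "A $ k $ l \<noteq> 0" by auto
    show ?thesis
    proof (cases "A $ k $ k = 0")
      case False
      then show ?thesis using pivot[of A k] less.prems k by blast
    next
      case True
      let ?S = "swap_mat k l"
      let ?B = "A ** ?S"
      have B: "?B $ i $ j = A $ i $ Transposition.transpose k l j" for i j
      proof -
        have "?B $ i $ j = (\<Sum>h\<in>UNIV. if h = Transposition.transpose k l j then A $ i $ h else 0)"
          unfolding matrix_matrix_mult_def swap_mat_def vec_lambda_beta
        proof (intro sum.cong refl)
          fix h
          have "j = Transposition.transpose k l h \<longleftrightarrow> h = Transposition.transpose k l j"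
            by (metis transpose_involutory)
          then show "A $ i $ h * axis (Transposition.transpose k l h) 1 $ j =
              (if h = Transposition.transpose k l j then A $ i $ h else 0)"
            by (simp add: axis_def)
        qed
        then show ?thesis by simp
      qed
      \<comment> \<open>The swap affects only columns \<open>k\<close> and \<open>l\<close>. Rows
        \<open>k\<close> and \<open>l\<close> are not unit vectors, and any other unit row has zeros
        in both columns.\<close>
      have "?R ?B \<subseteq> ?R A"
      proof clarify
        fix i assume "?B $ i \<noteq> axis i 1" "A $ i = axis i 1"
        moreover from this k l have "i \<noteq> k" "i \<noteq> l" by auto
        ultimately show False
          by (auto simp: vec_eq_iff B axis_def Transposition.transpose_def split: if_splits)
      qed
      then have card: "card (?R ?B) \<le> card (?R A)" by (intro card_mono) auto
      have "invertible ?S"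
        using swap_mat_involution[of k l] unfolding invertible_def by blast
      then have "invertible ?B" using less.prems by (intro invertible_mult)
      moreover have "?B $ k $ k \<noteq> 0" using l by (simp add: B)
      \<comment> \<open>The swap may by itself turn row \<open>k\<close> into a unit vector; then
        \<open>pivot\<close> does not apply, but the number of non-unit rows has dropped and the
        induction hypothesis does.\<close>
      moreover have "scales_haar ?B" if "?B $ k = axis k 1"
      proof -
        have "?R ?B \<subset> ?R A" using \<open>?R ?B \<subseteq> ?R A\<close> k that by blast
        then have "card (?R ?B) < card (?R A)" by (intro psubset_card_mono) auto
        then show ?thesis using less.hyps \<open>invertible ?B\<close> by blast
      qed
      ultimately have "scales_haar ?B" using pivot[of ?B k] card by blast
      then have "scales_haar (?B ** ?S)" by (rule scales_haar_mult[OF _ scales_haar_swap_mat])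
      then show ?thesis by (simp add: matrix_mul_assoc[symmetric] swap_mat_involution)
    qed
  qed
qed

lemma nn_integral_matrix:
  fixes A :: "'a^'n^'n"
  assumes A: "invertible A" and h [measurable]: "h \<in> borel_measurable M"
  shows "(\<integral>\<^sup>+x. h (A *v x) \<partial>M) = ennreal (1 / absp (det A)) * (\<integral>\<^sup>+x. h x \<partial>M)"
proof -
  have "distr M M ((*v) A) = scale_measure (ennreal (1 / absp (det A))) M"
    using scales_haar_invertible[OF A]
    by (intro measure_eqI) (auto simp: emeasure_distr scales_haar_def)
  then have "(\<integral>\<^sup>+x. h x \<partial>distr M M ((*v) A)) = ennreal (1 / absp (det A)) * (\<integral>\<^sup>+x. h x \<partial>M)"
    by (simp add: nn_integral_scale_measure)
  then show ?thesis by (simp add: nn_integral_distr)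
qed

lemma absp_le_mnorm: "absp (A $ i $ j) \<le> mnorm absp A" for A :: "'a^'n^'n"
  unfolding mnorm_def by (rule Max_ge) (auto intro!: image_eqI[of _ _ "(i, j)"])

text \<open>This makes the ball scaled by the matrix norm one of the balls \<open>B (g + k)\<close>
  with an integer index.\<close>

lemma mnorm_discrete:
  fixes A :: "'a^'n^'n"
  assumes "invertible A"
  shows "\<exists>k::int. mnorm absp A = p powr real_of_int k"
proof -
  have "mnorm absp A \<in> range (\<lambda>(i, j). absp (A $ i $ j))"
    unfolding mnorm_def by (rule Max_in) auto
  then obtain i j where ij: "mnorm absp A = absp (A $ i $ j)" by auto
  have "A $ i $ j \<noteq> 0"
  proof
    assume "A $ i $ j = 0"
    then have "A $ i' $ j' = 0" for i' j'
      using absp_le_mnorm[of A i' j'] ij by simp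
    then have "A = 0" by (simp add: vec_eq_iff)
    then have "(mat 1 :: 'a^'n^'n) = 0"
      using assms unfolding invertible_def by (auto simp: vec_eq_iff matrix_matrix_mult_def)
    then have "(mat 1 :: 'a^'n^'n) $ i $ i = 0" by simp
    then show False by (simp add: mat_def)
  qed
  then show ?thesis using absp_discrete ij by auto
qed

lemma matrix_maps_B0:
  fixes A :: "'a^'n^'n"
  assumes k: "mnorm absp A = p powr real_of_int k" and x: "x \<in> B0 p absp g"
  shows "A *v x \<in> B0 p absp (g + k)"
proof -
  have "absp ((A *v x) $ i) \<le> p powr real_of_int (g + k)" for i
  proof -
    have "absp (A $ i $ j) * absp (x $ j) \<le> p powr real_of_int k * p powr real_of_int g" for j
      using absp_le_mnorm[of A i j] k x by (intro mult_mono) (auto simp: mem_pball)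
    then show ?thesis
      unfolding matrix_vector_mult_def
      by (auto intro!: absp_sum_le simp: absp_mult powr_add mult.commute)
  qed
  then show ?thesis by (simp add: mem_pball)
qed

end

subsection \<open>Muckenhoupt weights\<close>

locale weighted_haar = haar_space p absp M
  for p :: nat and absp :: "'a::field_char_0 \<Rightarrow> real" and M :: "('a^'n::finite) measure" +
  fixes zeta :: real and w :: "'a^'n \<Rightarrow> real"
  assumes zeta: "1 \<le> zeta" and A_class: "A_class p absp M zeta w"
begin

abbreviation "B g \<equiv> (B0 p absp g :: ('a^'n) set)"
abbreviation "V g \<equiv> measure M (B g)"
abbreviation "W g \<equiv> wm M w (B g)"
abbreviation "MB g \<equiv> restrict_space M (B g)"

lemma w_measurable [measurable]: "w \<in> borel_measurable M"
  using A_class unfolding A_class_def by simp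

lemma w_pos: "AE x in M. 0 < w x"
  using A_class unfolding A_class_def by simp

lemma measurable_MB [measurable (raw)]: "f \<in> borel_measurable M \<Longrightarrow> f \<in> borel_measurable (MB g)"
  by (rule measurable_restrict_space1)

lemma AE_MB: "AE x in M. P x \<Longrightarrow> AE x in MB g. P x"
  by (auto simp: AE_restrict_space_iff elim: AE_mp)

lemma w_pos_MB: "AE x in MB g. 0 < w x"
  by (rule AE_MB[OF w_pos])

lemma space_MB [simp]: "space (MB g) = B g"
  by (simp add: space_restrict_space)

lemma emeasure_MB: "emeasure (MB g) (B g) = ennreal (V g)"
  by (simp add: emeasure_restrict_space emeasure_B0_eq)

sublocale MB: finite_measure "MB g" for g
  by standard (simp add: emeasure_MB)

lemma measure_MB: "measure (MB g) (B g) = V g"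
  using emeasure_MB[of g] by (simp add: measure_def)

lemma set_integrable_MB: "set_integrable M (B g) f \<longleftrightarrow> integrable (MB g) f"
  for f :: "'a^'n \<Rightarrow> 'e::{banach, second_countable_topology}"
  by (subst integrable_restrict_space) (simp_all add: set_integrable_def)

lemma set_integral_MB: "(LINT x:B g|M. f x) = integral\<^sup>L (MB g) f"
  for f :: "'a^'n \<Rightarrow> 'e::{banach, second_countable_topology}"
  by (subst integral_restrict_space) (simp_all add: set_lebesgue_integral_def)

lemma w_integrable: "integrable (MB g) w"
  using A_class unfolding A_class_def set_integrable_MB[symmetric] by (auto split: if_splits)

lemma W_eq: "W g = integral\<^sup>L (MB g) w"
  by (simp add: wm_def set_integral_MB)

lemma nn_integral_w: "(\<integral>\<^sup>+x. ennreal (w x) \<partial>MB g) = ennreal (W g)"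
  unfolding W_eq using w_pos_MB[of g]
  by (intro nn_integral_eq_integral w_integrable) (auto elim: eventually_mono)

lemma W_pos [simp]: "0 < W g"
proof -
  have "(\<integral>\<^sup>+x. ennreal (w x) \<partial>MB g) \<noteq> 0"
  proof
    assume "(\<integral>\<^sup>+x. ennreal (w x) \<partial>MB g) = 0"
    then have "AE x in MB g. ennreal (w x) = 0"
      by (subst (asm) nn_integral_0_iff_AE) auto
    then have "AE x in MB g. False"
      using w_pos_MB[of g] by eventually_elim simp
    then have "emeasure (MB g) (B g) = 0"
      using AE_iff_measurable[of "B g" "MB g" "\<lambda>_. False"] by (simp add: sets_restrict_space_iff)
    then show False by (simp add: emeasure_MB order_less_imp_not_eq2)
  qed
  then have "ennreal (W g) \<noteq> 0" unfolding nn_integral_w .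
  then show ?thesis by (simp add: ennreal_eq_0_iff)
qed

lemma V_nonzero [simp]: "V g \<noteq> 0" and W_nonzero [simp]: "W g \<noteq> 0"
  using measure_B0_pos[of g] W_pos[of g] by linarith+

lemma V_ratio: "V (g + k) / V g = p powr (real CARD('n) * real_of_int k)"
  by (simp add: measure_B0 powr_diff[symmetric] algebra_simps)

text \<open>The \<open>A\<^sub>\<zeta>\<close> condition as it is used from here on: the plain
  average of \<open>h\<close> is bounded by the weighted average of \<open>h powr zeta\<close>,
  raised to \<open>1 / zeta\<close>. It follows from Hoelder's inequality after inserting the weight
  and its dual power. The bound \<open>C \<ge> 1\<close> lets later powers of the constant be
  enlarged freely.\<close>

lemma A_Holder:
  "\<exists>C\<ge>1. \<forall>g h Y. h \<in> borel_measurable M \<longrightarrow> (\<forall>x. 0 \<le> h x) \<longrightarrow> 0 \<le> Y \<longrightarrow>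
     (\<integral>\<^sup>+x. ennreal (h x powr zeta * w x) \<partial>MB g) \<le> ennreal Y \<longrightarrow>
     (\<integral>\<^sup>+x. ennreal (h x) \<partial>MB g) \<le> ennreal (V g * (C * Y / W g) powr (1 / zeta))"
proof (cases "zeta = 1")
  case True
  then obtain C where C: "\<And>g. AE x in M. x \<in> B g \<longrightarrow> avg M (B g) w \<le> C * w x"
    using A_class unfolding A_class_def by auto
  show ?thesis
  proof (intro exI[of _ "max 1 C"] conjI allI impI)
    fix g h and Y :: real
    assume h [measurable]: "h \<in> borel_measurable M" and h0: "\<forall>x. 0 \<le> h x" and Y: "0 \<le> Y"
      and le: "(\<integral>\<^sup>+x. ennreal (h x powr zeta * w x) \<partial>MB g) \<le> ennreal Y"
    \<comment> \<open>The condition reads \<open>1 \<le> ?C * w x\<close> almost everywhere on the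
      ball, so the weight can simply be inserted under the integral.\<close>
    let ?C = "max 1 C * V g / W g"
    have C0: "0 \<le> ?C" by (simp add: less_imp_le)
    have "AE x in MB g. W g / V g \<le> C * w x"
      using C[of g] by (simp add: AE_restrict_space_iff avg_def wm_def)
    note C' = this
    have "(\<integral>\<^sup>+x. ennreal (h x) \<partial>MB g) \<le> (\<integral>\<^sup>+x. ennreal ?C * ennreal (h x powr zeta * w x) \<partial>MB g)"
    proof (rule nn_integral_mono_AE, use C' w_pos_MB[of g] in eventually_elim)
      case (elim x)
      have "W g / V g \<le> max 1 C * w x"
        using elim by (intro order_trans[OF elim(1)] mult_right_mono) auto
      then have "1 \<le> ?C * w x"
        using W_pos[of g] measure_B0_pos[of g] by (simp add: field_simps)
      then have "h x * 1 \<le> h x * (?C * w x)" using h0 by (intro mult_left_mono) auto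
      then have "h x \<le> ?C * (h x powr zeta * w x)" using True h0 by (simp add: mult.left_commute)
      then show ?case using C0 by (simp add: ennreal_leI flip: ennreal_mult')
    qed
    also have "\<dots> = ennreal ?C * (\<integral>\<^sup>+x. ennreal (h x powr zeta * w x) \<partial>MB g)"
      by (rule nn_integral_cmult) measurable
    also have "\<dots> \<le> ennreal ?C * ennreal Y" using le by (rule mult_left_mono) simp
    also have "\<dots> = ennreal (V g * (max 1 C * Y / W g) powr (1 / zeta))"
      using True Y C0 by (simp add: less_imp_le mult_ac flip: ennreal_mult')
    finally show "(\<integral>\<^sup>+x. ennreal (h x) \<partial>MB g) \<le> ennreal (V g * (max 1 C * Y / W g) powr (1 / zeta))" .
  qed simp
next
  case False
  then have z1: "1 < zeta" using zeta by simp
  define \<sigma> where "\<sigma> = zeta - 1"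
  have \<sigma>: "0 < \<sigma>" using z1 by (simp add: \<sigma>_def)
  let ?u = "\<lambda>x. w x powr (- 1 / \<sigma>)"
  obtain C where int_u: "\<And>g. set_integrable M (B g) ?u"
    and C: "\<And>g. avg M (B g) w * avg M (B g) ?u powr \<sigma> \<le> C"
    using A_class False unfolding A_class_def \<sigma>_def by auto
  show ?thesis
  proof (intro exI[of _ "max 1 C"] conjI allI impI)
    fix g h and Y :: real
    assume h [measurable]: "h \<in> borel_measurable M" and h0: "\<forall>x. 0 \<le> h x" and Y: "0 \<le> Y"
      and le: "(\<integral>\<^sup>+x. ennreal (h x powr zeta * w x) \<partial>MB g) \<le> ennreal Y"
    define S where "S = integral\<^sup>L (MB g) ?u"
    have S: "(\<integral>\<^sup>+x. ennreal (?u x) \<partial>MB g) = ennreal S" "0 \<le> S"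
      unfolding S_def using int_u[of g] unfolding set_integrable_MB
      by (intro nn_integral_eq_integral integral_nonneg_AE) auto
    have "W g / V g * (S / V g) powr \<sigma> \<le> max 1 C"
      using C[of g] by (simp add: avg_def wm_def S_def set_integral_MB)
    then have "(S / V g) powr \<sigma> \<le> max 1 C * V g / W g"
      using W_pos[of g] measure_B0_pos[of g] by (simp add: field_simps)
    then have "((S / V g) powr \<sigma>) powr (1 / zeta) \<le> (max 1 C * V g / W g) powr (1 / zeta)"
      using zeta by (intro powr_mono2) auto
    then have S2: "(S / V g) powr (1 - 1 / zeta) \<le> (max 1 C * V g / W g) powr (1 / zeta)"
      using z1 by (simp add: powr_powr \<sigma>_def diff_divide_distrib)
    \<comment> \<open>The two powers of the weight cancel because
      \<open>1 / zeta = (1 / \<sigma>) * (1 - 1 / zeta)\<close>. The absolute value is there because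
      the weight is positive only almost everywhere, whereas Hoelder's inequality asks for factors
      that are nonnegative everywhere.\<close>
    have "(\<integral>\<^sup>+x. ennreal (h x) \<partial>MB g)
       = (\<integral>\<^sup>+x. ennreal ((h x powr zeta * \<bar>w x\<bar>) powr (1 / zeta) * ?u x powr (1 - 1 / zeta)) \<partial>MB g)"
    proof (rule nn_integral_cong_AE, use w_pos_MB[of g] in eventually_elim)
      case (elim x)
      have "(h x powr zeta * \<bar>w x\<bar>) powr (1 / zeta) * ?u x powr (1 - 1 / zeta) =
          h x * (w x powr (1 / zeta) * w x powr ((- 1 / \<sigma>) * (1 - 1 / zeta)))"
        using elim h0 z1 by (simp add: powr_mult powr_powr)
      also have "w x powr (1 / zeta) * w x powr ((- 1 / \<sigma>) * (1 - 1 / zeta)) =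
          w x powr (1 / zeta + (- 1 / \<sigma>) * (1 - 1 / zeta))"
        by (simp only: powr_add)
      also have "1 / zeta + (- 1 / \<sigma>) * (1 - 1 / zeta) = 0"
        using z1 \<sigma> unfolding \<sigma>_def by (simp add: field_simps)
      finally show ?case using elim by simp
    qed
    also have "\<dots> \<le> ennreal (Y powr (1 / zeta) * S powr (1 - 1 / zeta))"
    proof (rule Holder_nn_integral_two)
      have "(\<integral>\<^sup>+x. ennreal (h x powr zeta * \<bar>w x\<bar>) \<partial>MB g) = (\<integral>\<^sup>+x. ennreal (h x powr zeta * w x) \<partial>MB g)"
        using w_pos_MB[of g] by (intro nn_integral_cong_AE) (auto elim: eventually_mono)
      then show "(\<integral>\<^sup>+x. ennreal (h x powr zeta * \<bar>w x\<bar>) \<partial>MB g) \<le> ennreal Y" using le by simp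
    qed (use z1 Y S in auto)
    also have "Y powr (1 / zeta) * S powr (1 - 1 / zeta)
        = Y powr (1 / zeta) * (V g powr (1 - 1 / zeta) * (S / V g) powr (1 - 1 / zeta))"
      using S(2) measure_B0_pos[of g] by (simp add: powr_divide)
    also have "\<dots> \<le> Y powr (1 / zeta) * (V g powr (1 - 1 / zeta) * (max 1 C * V g / W g) powr (1 / zeta))"
      using S2 by (intro mult_left_mono) auto
    also have "\<dots> = V g powr ((1 - 1 / zeta) + 1 / zeta) * (max 1 C * Y / W g) powr (1 / zeta)"
      unfolding powr_add using Y W_pos[of g] measure_B0_pos[of g]
      by (simp add: powr_mult powr_divide less_imp_le)
    also have "\<dots> = V g * (max 1 C * Y / W g) powr (1 / zeta)"
      using measure_B0_pos[of g] by simp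
    finally show "(\<integral>\<^sup>+x. ennreal (h x) \<partial>MB g) \<le> ennreal (V g * (max 1 C * Y / W g) powr (1 / zeta))"
      by (simp add: ennreal_leI)
  qed simp
qed

text \<open>Choice fixes one constant attached to the weight, so that the final constant is visibly
  independent of the kernel, the matrices and the functions.\<close>

definition CA :: real where
  "CA = (SOME C. C \<ge> 1 \<and> (\<forall>g h Y. h \<in> borel_measurable M \<longrightarrow> (\<forall>x. 0 \<le> h x) \<longrightarrow> 0 \<le> Y \<longrightarrow>
     (\<integral>\<^sup>+x. ennreal (h x powr zeta * w x) \<partial>MB g) \<le> ennreal Y \<longrightarrow>
     (\<integral>\<^sup>+x. ennreal (h x) \<partial>MB g) \<le> ennreal (V g * (C * Y / W g) powr (1 / zeta))))"

lemma CA_ge_1: "1 \<le> CA"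
  and CA: "h \<in> borel_measurable M \<Longrightarrow> (\<And>x. 0 \<le> h x) \<Longrightarrow> 0 \<le> Y \<Longrightarrow>
     (\<integral>\<^sup>+x. ennreal (h x powr zeta * w x) \<partial>MB g) \<le> ennreal Y \<Longrightarrow>
     (\<integral>\<^sup>+x. ennreal (h x) \<partial>MB g) \<le> ennreal (V g * (CA * Y / W g) powr (1 / zeta))"
  using someI_ex[OF A_Holder, folded CA_def] by blast+

lemma nn_integral_MB_subset:
  assumes "g \<le> g'" and [measurable]: "h \<in> borel_measurable M"
  shows "(\<integral>\<^sup>+x. h x * indicator (B g) x \<partial>MB g') = (\<integral>\<^sup>+x. h x \<partial>MB g)"
  using pball_mono[OF assms(1), of 0]
  by (auto simp: nn_integral_restrict_space intro!: nn_integral_cong split: split_indicator)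

text \<open>The test function is the indicator of the smaller ball: its volume share is at most a
  constant times its weight share to the power \<open>1 / zeta\<close>.\<close>

lemma W_le_contraction:
  assumes "k \<le> 0"
  shows "W g \<le> CA * p powr (- real CARD('n) * k * zeta) * W (g + k)"
proof -
  have "(\<integral>\<^sup>+x. ennreal (indicator (B (g + k)) x powr zeta * w x) \<partial>MB g) = ennreal (W (g + k))"
  proof -
    have "(\<integral>\<^sup>+x. ennreal (indicator (B (g + k)) x powr zeta * w x) \<partial>MB g) =
        (\<integral>\<^sup>+x. ennreal (w x) * indicator (B (g + k)) x \<partial>MB g)"
      by (intro nn_integral_cong) (simp split: split_indicator)
    also have "\<dots> = ennreal (W (g + k))"
      unfolding nn_integral_w[symmetric] using assms by (intro nn_integral_MB_subset) auto
    finally show ?thesis .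
  qed
  then have "(\<integral>\<^sup>+x. ennreal (indicator (B (g + k)) x) \<partial>MB g)
      \<le> ennreal (V g * (CA * W (g + k) / W g) powr (1 / zeta))"
    by (intro CA) (auto simp: less_imp_le)
  moreover have "(\<integral>\<^sup>+x. ennreal (indicator (B (g + k)) x) \<partial>MB g) = ennreal (V (g + k))"
    using nn_integral_MB_subset[of "g + k" g "\<lambda>x. 1"] assms
    by (simp add: ennreal_indicator nn_integral_const emeasure_MB)
  ultimately have "V (g + k) \<le> V g * (CA * W (g + k) / W g) powr (1 / zeta)"
    by (simp add: ennreal_le_iff)
  then have "V (g + k) / V g \<le> (CA * W (g + k) / W g) powr (1 / zeta)"
    using measure_B0_pos[of g] by (simp add: divide_le_eq mult.commute)
  then have "(V (g + k) / V g) powr zeta \<le> ((CA * W (g + k) / W g) powr (1 / zeta)) powr zeta"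
    using zeta by (intro powr_mono2) auto
  then have "p powr (real CARD('n) * k * zeta) \<le> CA * W (g + k) / W g"
    using zeta CA_ge_1 by (simp add: V_ratio powr_powr less_imp_le)
  then show ?thesis
    using W_pos[of g] by (simp add: powr_minus field_simps)
qed

text \<open>The reverse Hoelder inequality on central balls, raised to the power
  \<open>\<rho>\<close> and freed of the averages, so that it can serve as a hypothesis of Hoelder's
  inequality for the factor \<open>w x powr \<rho>\<close>.\<close>

definition is_RH :: "real \<Rightarrow> real \<Rightarrow> bool" where
  "is_RH \<rho> C \<longleftrightarrow> 1 < \<rho> \<and> 1 \<le> C \<and>
     (\<forall>g. (\<integral>\<^sup>+x. ennreal (w x powr \<rho>) \<partial>MB g) \<le> ennreal (V g * (C * (W g / V g)) powr \<rho>))"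

lemma RH_set_is_RH: assumes "\<rho> \<in> RH_set p absp M w" shows "\<exists>C. is_RH \<rho> C"
proof -
  from assms have \<rho>: "1 < \<rho>" by (simp add: RH_set_def)
  from assms obtain C where int: "\<And>g. set_integrable M (B g) (\<lambda>x. w x powr \<rho>)"
    and C: "\<And>g. avg M (B g) (\<lambda>x. w x powr \<rho>) powr (1 / \<rho>) \<le> C * avg M (B g) w"
    unfolding RH_set_def RH_class_def by auto
  have "is_RH \<rho> (max 1 C)"
    unfolding is_RH_def
  proof (intro conjI allI \<rho>)
    fix g
    define S where "S = integral\<^sup>L (MB g) (\<lambda>x. w x powr \<rho>)"
    have S: "(\<integral>\<^sup>+x. ennreal (w x powr \<rho>) \<partial>MB g) = ennreal S" "0 \<le> S"
      unfolding S_def using int[of g] unfolding set_integrable_MB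
      by (intro nn_integral_eq_integral integral_nonneg_AE) auto
    have "(S / V g) powr (1 / \<rho>) \<le> C * (W g / V g)"
      using C[of g] by (simp add: avg_def wm_def S_def set_integral_MB)
    also have "\<dots> \<le> max 1 C * (W g / V g)"
      by (intro mult_right_mono) (auto simp: less_imp_le)
    finally have "((S / V g) powr (1 / \<rho>)) powr \<rho> \<le> (max 1 C * (W g / V g)) powr \<rho>"
      using \<rho> by (intro powr_mono2) auto
    then have "S \<le> V g * (max 1 C * (W g / V g)) powr \<rho>"
      using \<rho> S(2) measure_B0_pos[of g] by (simp add: powr_powr divide_le_eq mult.commute)
    then show "(\<integral>\<^sup>+x. ennreal (w x powr \<rho>) \<partial>MB g) \<le> ennreal (V g * (max 1 C * (W g / V g)) powr \<rho>)"
      by (simp add: S ennreal_leI)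
  qed simp
  then show ?thesis by blast
qed

text \<open>Hoelder's inequality on the larger ball for the weight in \<open>L\<^sup>\<rho>\<close>
  and the indicator of the smaller ball; the reverse Hoelder inequality then bounds the norm of the
  weight by its average.\<close>

lemma W_le_expansion:
  assumes RH: "is_RH \<rho> C" and k: "0 \<le> k"
  shows "W g \<le> C * p powr (- real CARD('n) * k * (1 - 1 / \<rho>)) * W (g + k)"
proof -
  have \<rho>: "1 < \<rho>" and C: "1 \<le> C"
    and le: "(\<integral>\<^sup>+x. ennreal (w x powr \<rho>) \<partial>MB (g + k)) \<le> ennreal (V (g + k) * (C * (W (g + k) / V (g + k))) powr \<rho>)"
    using RH unfolding is_RH_def by auto
  have "ennreal (W g) = (\<integral>\<^sup>+x. ennreal ((w x powr \<rho>) powr (1 / \<rho>) * indicator (B g) x powr (1 - 1 / \<rho>)) \<partial>MB (g + k))"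
  proof -
    have "ennreal (W g) = (\<integral>\<^sup>+x. ennreal (w x) * indicator (B g) x \<partial>MB (g + k))"
      unfolding nn_integral_w[symmetric] using k by (intro nn_integral_MB_subset[symmetric]) auto
    also have "\<dots> = (\<integral>\<^sup>+x. ennreal ((w x powr \<rho>) powr (1 / \<rho>) * indicator (B g) x powr (1 - 1 / \<rho>)) \<partial>MB (g + k))"
    proof (rule nn_integral_cong_AE, use w_pos_MB[of "g + k"] in eventually_elim)
      case (elim x)
      then show ?case using \<rho> by (simp add: powr_powr split: split_indicator)
    qed
    finally show ?thesis .
  qed
  also have "\<dots> \<le> ennreal ((V (g + k) * (C * (W (g + k) / V (g + k))) powr \<rho>) powr (1 / \<rho>) * V g powr (1 - 1 / \<rho>))"
  proof (rule Holder_nn_integral_two)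
    show "(\<integral>\<^sup>+x. ennreal (indicator (B g) x) \<partial>MB (g + k)) \<le> ennreal (V g)"
      using nn_integral_MB_subset[of g "g + k" "\<lambda>x. 1"] k
      by (simp add: ennreal_indicator nn_integral_const emeasure_MB)
  qed (use \<rho> le in auto)
  finally have "W g \<le> (V (g + k) * (C * (W (g + k) / V (g + k))) powr \<rho>) powr (1 / \<rho>) * V g powr (1 - 1 / \<rho>)"
    by (simp add: ennreal_le_iff)
  also have "\<dots> = C * (V g powr (1 - 1 / \<rho>) * V (g + k) powr (1 / \<rho> - 1)) * W (g + k)"
    using \<rho> C measure_B0_pos[of "g + k"]
    by (simp add: powr_mult powr_powr powr_diff less_imp_le mult_ac)
  also have "V g powr (1 - 1 / \<rho>) * V (g + k) powr (1 / \<rho> - 1) = p powr (- real CARD('n) * k * (1 - 1 / \<rho>))"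
    by (simp add: measure_B0 powr_powr powr_add[symmetric] algebra_simps)
  finally show ?thesis .
qed

text \<open>Contraction and expansion both bound \<open>W (g + k)\<close> from below, which bounds a
  negative power from above. For \<open>\<delta> \<le> \<rho>\<close> the exponent
  \<open>1 - 1 / \<rho>\<close> may be weakened to \<open>(\<delta> - 1) / \<delta>\<close>. Only
  one of the two summands is nonzero; their sum is the factor that occurs in
  \<open>C10\<close>.\<close>

lemma W_powr_neg_le:
  assumes RH: "is_RH \<rho> C" and l: "l < 0" and d: "1 < \<delta>" "\<delta> \<le> \<rho>" and D: "CA \<le> D" "C \<le> D"
    and k: "t = p powr real_of_int k"
  shows "W (g + k) powr l \<le> D powr (- l) * W g powr l *
     ((if t \<le> 1 then t powr (real CARD('n) * zeta * l) else 0) +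
      (if t > 1 then t powr (real CARD('n) * l * (\<delta> - 1) / \<delta>) else 0))"
proof -
  have D0: "0 < D" using D CA_ge_1 by linarith
  have gen: "W (g + k) powr l \<le> D powr (- l) * W g powr l * p powr (a * l)"
    if le: "W g \<le> D * p powr (- a) * W (g + k)" for a
  proof -
    have "W g * p powr a / D \<le> W (g + k)"
      using le D0 by (simp add: powr_minus field_simps)
    then have "W (g + k) powr l \<le> (W g * p powr a / D) powr l"
      using l D0 by (intro powr_mono2') auto
    also have "\<dots> = D powr (- l) * W g powr l * p powr (a * l)"
      using D0 by (simp add: powr_mult powr_divide powr_powr powr_minus_divide less_imp_le mult_ac)
    finally show ?thesis .
  qed
  show ?thesis
  proof (cases "k \<le> 0")
    case True
    have t: "t \<le> 1" using True powr_le_iff[of k 0] k by simp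
    have "W g \<le> CA * p powr (- real CARD('n) * k * zeta) * W (g + k)"
      by (rule W_le_contraction[OF True])
    also have "\<dots> \<le> D * p powr (- (real CARD('n) * k * zeta)) * W (g + k)"
      using D by (intro mult_right_mono) (auto simp: less_imp_le)
    finally have "W g \<le> D * p powr (- (real CARD('n) * k * zeta)) * W (g + k)" .
    from gen[OF this] show ?thesis using t k by (simp add: powr_powr mult_ac)
  next
    case False
    have t: "1 < t" using False powr_le_iff[of k 0] k by (simp add: not_le[symmetric])
    have "W g \<le> C * p powr (- real CARD('n) * k * (1 - 1 / \<rho>)) * W (g + k)"
      using False by (intro W_le_expansion[OF RH]) auto
    also have "\<dots> \<le> D * p powr (- (real CARD('n) * k * ((\<delta> - 1) / \<delta>))) * W (g + k)"
    proof (intro mult_right_mono mult_mono D)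
      have "1 / \<rho> \<le> 1 / \<delta>" using d by (simp add: frac_le)
      then have "(\<delta> - 1) / \<delta> \<le> 1 - 1 / \<rho>" using d by (simp add: diff_divide_distrib)
      then have "real CARD('n) * k * ((\<delta> - 1) / \<delta>) \<le> real CARD('n) * k * (1 - 1 / \<rho>)"
        using False by (intro mult_left_mono) auto
      then show "p powr (- real CARD('n) * k * (1 - 1 / \<rho>)) \<le> p powr (- (real CARD('n) * k * ((\<delta> - 1) / \<delta>)))"
        by (simp add: powr_le_iff)
    qed (use D0 in \<open>auto simp: less_imp_le\<close>)
    finally have "W g \<le> D * p powr (- (real CARD('n) * k * ((\<delta> - 1) / \<delta>))) * W (g + k)" .
    from gen[OF this] show ?thesis using t k by (simp add: powr_powr mult_ac)
  qed
qed

subsection \<open>Averaged norms on balls\<close>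

text \<open>The \<open>L\<^sup>s\<close> norm of \<open>f\<close> on the ball with respect to normalised Haar measure is at most \<open>X\<close>.\<close>

definition Lb :: "real \<Rightarrow> int \<Rightarrow> ('a^'n \<Rightarrow> complex) \<Rightarrow> real \<Rightarrow> bool" where
  "Lb s g f X \<longleftrightarrow> f \<in> borel_measurable M \<and> 0 \<le> X \<and>
     (\<integral>\<^sup>+x. ennreal (norm (f x) powr s) \<partial>MB g) \<le> ennreal (V g * X powr s)"

lemma Lb_mono:
  assumes f: "Lb s g f X" and le: "X \<le> Y" and s: "0 \<le> s"
  shows "Lb s g f Y"
proof -
  have X: "0 \<le> X" using f by (simp add: Lb_def)
  then have "V g * X powr s \<le> V g * Y powr s"
    using le s by (intro mult_left_mono powr_mono2) auto
  then show ?thesis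
    using f X le unfolding Lb_def by (auto intro: order_trans ennreal_leI)
qed

text \<open>The \<open>A\<^sub>\<zeta>\<close> estimate for
  \<open>norm (f x) powr (q / zeta)\<close>; the integrability exponent drops by the factor
  \<open>zeta\<close>. From \<open>1 \<le> CA\<close> and \<open>1 \<le> q\<close> one gets
  \<open>CA \<le> CA powr q\<close>, which puts the constant next to \<open>Z\<close>.\<close>

lemma Lb_of_weighted:
  assumes f [measurable]: "f \<in> borel_measurable M" and q: "1 \<le> q" and Z: "0 \<le> Z"
    and le: "(\<integral>\<^sup>+x. ennreal (norm (f x) powr q * w x) \<partial>MB g) \<le> ennreal (Z powr q * W g)"
  shows "Lb (q / zeta) g f (CA * Z)"
  unfolding Lb_def
proof (intro conjI f)
  show "0 \<le> CA * Z" using CA_ge_1 Z by simp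
  have "(\<integral>\<^sup>+x. ennreal (norm (f x) powr (q / zeta)) \<partial>MB g)
      \<le> ennreal (V g * (CA * (Z powr q * W g) / W g) powr (1 / zeta))"
    using le zeta by (intro CA) (auto simp: powr_powr less_imp_le)
  also have "\<dots> \<le> ennreal (V g * (CA * Z) powr (q / zeta))"
  proof (intro ennreal_leI mult_left_mono)
    have "CA \<le> CA powr q" using powr_mono[of 1 q CA] q CA_ge_1 by simp
    then have "CA * Z powr q \<le> (CA * Z) powr q"
      using Z CA_ge_1 by (auto simp: powr_mult intro!: mult_right_mono)
    then have "(CA * Z powr q) powr (1 / zeta) \<le> ((CA * Z) powr q) powr (1 / zeta)"
      using zeta CA_ge_1 by (intro powr_mono2) auto
    then show "(CA * (Z powr q * W g) / W g) powr (1 / zeta) \<le> (CA * Z) powr (q / zeta)"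
      using W_pos[of g] by (simp add: powr_powr)
  qed simp
  finally show "(\<integral>\<^sup>+x. ennreal (norm (f x) powr (q / zeta)) \<partial>MB g) \<le> ennreal (V g * (CA * Z) powr (q / zeta))" .
qed

text \<open>Substitution contributes the inverse determinant, and enlarging the image of the ball to
  \<open>B (g + k)\<close> contributes the volume ratio, a power of the matrix norm. For
  \<open>s = q / zeta\<close> the resulting factor is \<open>mu_star\<close>.\<close>

lemma Lb_matrix:
  fixes A :: "'a^'n^'n"
  assumes A: "invertible A" and k: "mnorm absp A = p powr real_of_int k" and s: "0 < s"
    and f: "Lb s (g + k) f X"
  shows "Lb s g (\<lambda>x. f (A *v x)) (X * (inverse (absp (det A)) powr (1 / s) * mnorm absp A powr (real CARD('n) / s)))"
  unfolding Lb_def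
proof (intro conjI)
  have [measurable]: "f \<in> borel_measurable M" and X: "0 \<le> X"
    and le: "(\<integral>\<^sup>+x. ennreal (norm (f x) powr s) \<partial>MB (g + k)) \<le> ennreal (V (g + k) * X powr s)"
    using f unfolding Lb_def by auto
  show "(\<lambda>x. f (A *v x)) \<in> borel_measurable M"
    by (rule measurable_compose[OF measurable_matrix]) measurable
  show "0 \<le> X * (inverse (absp (det A)) powr (1 / s) * mnorm absp A powr (real CARD('n) / s))"
    using X by simp
  have det: "0 < absp (det A)"
    using A absp_nonneg[of "det A"] by (simp add: invertible_det_nz order_less_le)
  have "(\<integral>\<^sup>+x. ennreal (norm (f (A *v x)) powr s) \<partial>MB g) =
      (\<integral>\<^sup>+x. ennreal (norm (f (A *v x)) powr s) * indicator (B g) x \<partial>M)"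
    by (simp add: nn_integral_restrict_space)
  also have "\<dots> \<le> (\<integral>\<^sup>+x. ennreal (norm (f (A *v x)) powr s) * indicator (B (g + k)) (A *v x) \<partial>M)"
    using matrix_maps_B0[OF k] by (intro nn_integral_mono) (auto split: split_indicator)
  also have "\<dots> = ennreal (1 / absp (det A)) *
      (\<integral>\<^sup>+x. ennreal (norm (f x) powr s) * indicator (B (g + k)) x \<partial>M)"
    by (rule nn_integral_matrix[OF A, where h = "\<lambda>x. ennreal (norm (f x) powr s) * indicator (B (g + k)) x"]) measurable
  also have "(\<integral>\<^sup>+x. ennreal (norm (f x) powr s) * indicator (B (g + k)) x \<partial>M) =
      (\<integral>\<^sup>+x. ennreal (norm (f x) powr s) \<partial>MB (g + k))"
    by (simp add: nn_integral_restrict_space)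
  also have "ennreal (1 / absp (det A)) * \<dots> \<le> ennreal (1 / absp (det A)) * ennreal (V (g + k) * X powr s)"
    using le by (rule mult_left_mono) simp
  also have "\<dots> = ennreal (1 / absp (det A) * (V (g + k) * X powr s))"
    by (rule ennreal_mult'[symmetric]) simp
  also have "1 / absp (det A) * (V (g + k) * X powr s) = V g *
      (X * (inverse (absp (det A)) powr (1 / s) * mnorm absp A powr (real CARD('n) / s))) powr s"
  proof -
    have "V (g + k) = V g * mnorm absp A powr real CARD('n)"
      by (simp add: measure_B0 k powr_powr powr_add[symmetric] algebra_simps)
    then show ?thesis
      using X s det by (simp add: powr_mult powr_powr inverse_eq_divide)
  qed
  finally show "(\<integral>\<^sup>+x. ennreal (norm (f (A *v x)) powr s) \<partial>MB g) \<le> ennreal (V g *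
      (X * (inverse (absp (det A)) powr (1 / s) * mnorm absp A powr (real CARD('n) / s))) powr s)" .
qed

lemma Lb_const: "0 < s \<Longrightarrow> Lb s g (\<lambda>_. c) (norm c)"
  by (simp add: Lb_def nn_integral_const emeasure_MB mult.commute flip: ennreal_mult)

text \<open>A crude triangle inequality: one factor 3 comes from bounding the sum by three times the
  maximum, the other from \<open>3 \<le> 3 powr s\<close>.\<close>

lemma Lb_add3:
  assumes s: "1 \<le> s" and f: "Lb s g f1 X1" "Lb s g f2 X2" "Lb s g f3 X3"
  shows "Lb s g (\<lambda>x. f1 x + f2 x + f3 x) (9 * (X1 + X2 + X3))"
  unfolding Lb_def
proof (intro conjI)
  have [measurable]: "f1 \<in> borel_measurable M" "f2 \<in> borel_measurable M" "f3 \<in> borel_measurable M"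
    and X: "0 \<le> X1" "0 \<le> X2" "0 \<le> X3"
    using f unfolding Lb_def by auto
  show "(\<lambda>x. f1 x + f2 x + f3 x) \<in> borel_measurable M" by measurable
  show "0 \<le> 9 * (X1 + X2 + X3)" using X by simp
  have pt: "norm (a + b + c) powr s \<le> 3 powr s * (norm a powr s + norm b powr s + norm c powr s)" for a b c :: complex
  proof -
    define m where "m = max (norm a) (max (norm b) (norm c))"
    have "norm (a + b + c) \<le> 3 * m"
      using norm_triangle_ineq[of "a + b" c] norm_triangle_ineq[of a b] unfolding m_def by linarith
    then have "norm (a + b + c) powr s \<le> (3 * m) powr s" using s by (intro powr_mono2) auto
    also have "\<dots> = 3 powr s * m powr s" by (simp add: powr_mult m_def)
    also have "m powr s \<le> norm a powr s + norm b powr s + norm c powr s"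
      unfolding m_def by (auto simp: max_def)
    finally show ?thesis by simp
  qed
  have "(\<integral>\<^sup>+x. ennreal (norm (f1 x + f2 x + f3 x) powr s) \<partial>MB g) \<le>
      (\<integral>\<^sup>+x. ennreal (3 powr s) * (ennreal (norm (f1 x) powr s) + ennreal (norm (f2 x) powr s) + ennreal (norm (f3 x) powr s)) \<partial>MB g)"
    using pt by (intro nn_integral_mono) (auto intro!: ennreal_leI simp flip: ennreal_mult ennreal_plus)
  also have "\<dots> = ennreal (3 powr s) * ((\<integral>\<^sup>+x. ennreal (norm (f1 x) powr s) \<partial>MB g)
      + (\<integral>\<^sup>+x. ennreal (norm (f2 x) powr s) \<partial>MB g) + (\<integral>\<^sup>+x. ennreal (norm (f3 x) powr s) \<partial>MB g))"
    by (subst nn_integral_cmult, measurable) (subst nn_integral_add, measurable)+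
  also have "\<dots> \<le> ennreal (3 powr s) * (ennreal (V g * X1 powr s) + ennreal (V g * X2 powr s) + ennreal (V g * X3 powr s))"
    using f unfolding Lb_def by (intro mult_left_mono add_mono) auto
  also have "\<dots> = ennreal (3 powr s * (V g * X1 powr s + V g * X2 powr s + V g * X3 powr s))"
    by (simp flip: ennreal_mult ennreal_plus)
  also have "\<dots> \<le> ennreal (V g * (9 * (X1 + X2 + X3)) powr s)"
  proof (rule ennreal_leI)
    let ?S = "X1 + X2 + X3"
    have "X1 powr s + X2 powr s + X3 powr s \<le> ?S powr s + ?S powr s + ?S powr s"
      using X s by (intro add_mono powr_mono2) auto
    also have "\<dots> = 3 powr 1 * ?S powr s" by simp
    also have "\<dots> \<le> 3 powr s * ?S powr s" using s by (intro mult_right_mono powr_mono) auto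
    finally have "3 powr s * (X1 powr s + X2 powr s + X3 powr s) \<le> 3 powr s * (3 powr s * ?S powr s)"
      by (intro mult_left_mono) auto
    also have "\<dots> = (9 * ?S) powr s"
      using X powr_mult[of 3 3 s] powr_mult[of 9 ?S s] by simp
    finally have "V g * (3 powr s * (X1 powr s + X2 powr s + X3 powr s)) \<le> V g * (9 * ?S) powr s"
      by (intro mult_left_mono) auto
    then show "3 powr s * (V g * X1 powr s + V g * X2 powr s + V g * X3 powr s) \<le> V g * (9 * ?S) powr s"
      by (simp add: algebra_simps)
  qed
  finally show "(\<integral>\<^sup>+x. ennreal (norm (f1 x + f2 x + f3 x) powr s) \<partial>MB g) \<le> ennreal (V g * (9 * (X1 + X2 + X3)) powr s)" .
qed

lemma Lb_1_of_Lb: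
  assumes s: "1 \<le> s" and f: "Lb s g f X"
  shows "Lb 1 g f X"
  unfolding Lb_def
proof (intro conjI)
  have [measurable]: "f \<in> borel_measurable M" and X: "0 \<le> X"
    and le: "(\<integral>\<^sup>+x. ennreal (norm (f x) powr s) \<partial>MB g) \<le> ennreal (V g * X powr s)"
    using f unfolding Lb_def by auto
  show "f \<in> borel_measurable M" "0 \<le> X" by fact+
  have "(\<integral>\<^sup>+x. ennreal (norm (f x) powr 1) \<partial>MB g) =
      (\<integral>\<^sup>+x. ennreal ((norm (f x) powr s) powr (1 / s) * 1 powr (1 - 1 / s)) \<partial>MB g)"
    using s by (simp add: powr_powr)
  also have "\<dots> \<le> ennreal ((V g * X powr s) powr (1 / s) * V g powr (1 - 1 / s))"
    using s le by (intro Holder_nn_integral_two) (auto simp: nn_integral_const emeasure_MB)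
  also have "(V g * X powr s) powr (1 / s) * V g powr (1 - 1 / s) = V g * X powr 1"
    using s X by (simp add: powr_mult powr_powr powr_diff)
  finally show "(\<integral>\<^sup>+x. ennreal (norm (f x) powr 1) \<partial>MB g) \<le> ennreal (V g * X powr 1)" .
qed

lemma Lb_1_smaller:
  assumes f: "Lb 1 (g + 1) f X"
  shows "Lb 1 g f (p powr real CARD('n) * X)"
  unfolding Lb_def
proof (intro conjI)
  have [measurable]: "f \<in> borel_measurable M" and X: "0 \<le> X"
    and le: "(\<integral>\<^sup>+x. ennreal (norm (f x) powr 1) \<partial>MB (g + 1)) \<le> ennreal (V (g + 1) * X powr 1)"
    using f unfolding Lb_def by auto
  show "f \<in> borel_measurable M" "0 \<le> p powr real CARD('n) * X" using X by auto
  have "(\<integral>\<^sup>+x. ennreal (norm (f x) powr 1) \<partial>MB g) =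
      (\<integral>\<^sup>+x. ennreal (norm (f x) powr 1) * indicator (B g) x \<partial>MB (g + 1))"
    by (intro nn_integral_MB_subset[symmetric]) auto
  also have "\<dots> \<le> (\<integral>\<^sup>+x. ennreal (norm (f x) powr 1) \<partial>MB (g + 1))"
    by (intro nn_integral_mono) (auto split: split_indicator)
  also note le
  also have "V (g + 1) * X powr 1 = V g * (p powr real CARD('n) * X) powr 1"
    using X by (simp add: measure_B0 powr_add[symmetric] distrib_left)
  finally show "(\<integral>\<^sup>+x. ennreal (norm (f x) powr 1) \<partial>MB g) \<le> ennreal (V g * (p powr real CARD('n) * X) powr 1)" .
qed

lemma mean_dist_le:
  assumes int: "set_integrable M (B g) b" and le: "Lb 1 g (\<lambda>x. b x - c) X"
  shows "norm (mean M (B g) b - c) \<le> X"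
proof -
  have X: "0 \<le> X" and nn: "(\<integral>\<^sup>+x. ennreal (norm (b x - c)) \<partial>MB g) \<le> ennreal (V g * X)"
    using le unfolding Lb_def by auto
  have b: "integrable (MB g) b" using int by (simp add: set_integrable_MB)
  have bc: "integrable (MB g) (\<lambda>x. b x - c)" using b by simp
  have "mean M (B g) b - c = (integral\<^sup>L (MB g) b - V g *\<^sub>R c) / V g"
    using measure_B0_pos[of g] by (simp add: mean_def set_integral_MB diff_divide_distrib scaleR_conv_of_real)
  also have "integral\<^sup>L (MB g) b - V g *\<^sub>R c = integral\<^sup>L (MB g) (\<lambda>x. b x - c)"
    using b by (simp add: measure_MB)
  finally have "norm (mean M (B g) b - c) = norm (integral\<^sup>L (MB g) (\<lambda>x. b x - c)) / V g"
    by (simp add: norm_divide)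
  also have "norm (integral\<^sup>L (MB g) (\<lambda>x. b x - c)) \<le> integral\<^sup>L (MB g) (\<lambda>x. norm (b x - c))"
    by (rule integral_norm_bound)
  also have "\<dots> \<le> V g * X"
    using nn bc by (subst (asm) nn_integral_eq_integral) (auto simp: X ennreal_le_iff)
  finally show ?thesis by (simp add: divide_right_mono)
qed

subsection \<open>Central mean oscillation and central Morrey spaces\<close>

text \<open>A bound on \<open>cmo_osc\<close> carries information only if its integrand is
  integrable, since the Bochner integral of a non-integrable function is 0. Local integrability of
  \<open>b\<close> and of the weight ensures it.\<close>

lemma integrable_oscillation:
  fixes b :: "'a^'n \<Rightarrow> complex"
  assumes b: "loc_Lq p absp M w r b" and r: "1 \<le> r"
  shows "integrable (MB g) (\<lambda>x. norm (b x - c) powr r * w x)"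
proof (rule Bochner_Integration.integrable_bound)
  have [measurable]: "b \<in> borel_measurable M" and int: "integrable (MB g) (\<lambda>x. norm (b x) powr r * w x)"
    using b unfolding loc_Lq_def set_integrable_MB by auto
  show "integrable (MB g) (\<lambda>x. 2 powr r * (norm (b x) powr r * w x) + 2 powr r * norm c powr r * w x)"
    using int w_integrable[of g] by simp
  show "(\<lambda>x. norm (b x - c) powr r * w x) \<in> borel_measurable (MB g)" by measurable
  show "AE x in MB g. norm (norm (b x - c) powr r * w x) \<le>
      norm (2 powr r * (norm (b x) powr r * w x) + 2 powr r * norm c powr r * w x)"
    using w_pos_MB[of g]
  proof eventually_elim
    case (elim x)
    have "norm (b x - c) \<le> 2 * max (norm (b x)) (norm c)"
      using norm_triangle_ineq4[of "b x" c] by linarith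
    then have "norm (b x - c) powr r \<le> (2 * max (norm (b x)) (norm c)) powr r"
      using r by (intro powr_mono2) auto
    also have "\<dots> = 2 powr r * max (norm (b x)) (norm c) powr r"
      by (simp add: powr_mult)
    also have "max (norm (b x)) (norm c) powr r \<le> norm (b x) powr r + norm c powr r"
      by (auto simp: max_def)
    finally have "norm (b x - c) powr r * w x \<le> 2 powr r * (norm (b x) powr r + norm c powr r) * w x"
      using elim by (intro mult_right_mono) auto
    moreover have "0 \<le> norm (b x - c) powr r * w x" using elim by simp
    ultimately show ?case by (simp add: distrib_left distrib_right mult.assoc)
  qed
qed

lemma nn_integral_weighted_eq:
  assumes "integrable (MB g) (\<lambda>x. norm (h x) powr r * w x)"
  shows "(\<integral>\<^sup>+x. ennreal (norm (h x) powr r * w x) \<partial>MB g) = ennreal (LINT x:B g|M. norm (h x) powr r * w x)"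
    and "0 \<le> (LINT x:B g|M. norm (h x) powr r * w x)"
  using assms w_pos_MB[of g]
  by (auto simp: set_integral_MB intro!: nn_integral_eq_integral integral_nonneg_AE elim: eventually_mono)

lemma CMO_weighted:
  assumes b: "in_CMO p absp M w r b" and r: "1 \<le> r"
  shows "0 \<le> CMO_norm p absp M w r b"
    and "(\<integral>\<^sup>+x. ennreal (norm (b x - mean M (B g) b) powr r * w x) \<partial>MB g)
        \<le> ennreal (CMO_norm p absp M w r b powr r * W g)"
proof -
  let ?N = "CMO_norm p absp M w r b" and ?h = "\<lambda>g x. b x - mean M (B g) b"
  let ?I = "\<lambda>g. LINT x:B g|M. norm (?h g x) powr r * w x"
  have le: "cmo_osc p absp M w r b g \<le> ?N" for g
    using b unfolding in_CMO_def CMO_norm_def by (intro cSUP_upper) auto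
  then have "(1 / W g * ?I g) powr (1 / r) \<le> ?N" for g
    unfolding cmo_osc_def .
  then show N: "0 \<le> ?N" using powr_ge_zero order_trans by blast
  have int: "integrable (MB g) (\<lambda>x. norm (?h g x) powr r * w x)"
    using b r by (intro integrable_oscillation) (auto simp: in_CMO_def)
  note I = nn_integral_weighted_eq[OF int]
  have "((1 / W g * ?I g) powr (1 / r)) powr r \<le> ?N powr r"
    using le[of g] r unfolding cmo_osc_def by (intro powr_mono2) auto
  then have "1 / W g * ?I g \<le> ?N powr r"
    using r I(2) by (simp add: powr_powr less_imp_le)
  then have "?I g \<le> ?N powr r * W g"
    using W_pos[of g] by (simp add: field_simps)
  then show "(\<integral>\<^sup>+x. ennreal (norm (?h g x) powr r * w x) \<partial>MB g) \<le> ennreal (?N powr r * W g)"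
    unfolding I(1) by (rule ennreal_leI)
qed

text \<open>The bound has the shape that \<open>Lb_of_weighted\<close> expects, with
  \<open>Z\<close> equal to the norm times \<open>W g powr l\<close>.\<close>

lemma Bdot_weighted:
  assumes f: "in_Bdot p absp M w q l f" and q: "1 \<le> q"
  shows "0 \<le> Bdot_norm p absp M w q l f"
    and "(\<integral>\<^sup>+x. ennreal (norm (f x) powr q * w x) \<partial>MB g)
        \<le> ennreal ((Bdot_norm p absp M w q l f * W g powr l) powr q * W g)"
proof -
  let ?N = "Bdot_norm p absp M w q l f"
  let ?I = "\<lambda>g. LINT x:B g|M. norm (f x) powr q * w x"
  have le: "bdot_term p absp M w q l f g \<le> ?N" for g
    using f unfolding in_Bdot_def Bdot_norm_def by (intro cSUP_upper) auto
  then have "(W g powr (- 1 - l * q) * ?I g) powr (1 / q) \<le> ?N" for g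
    unfolding bdot_term_def .
  then show N: "0 \<le> ?N" using powr_ge_zero order_trans by blast
  have int: "integrable (MB g) (\<lambda>x. norm (f x) powr q * w x)"
    using f unfolding in_Bdot_def loc_Lq_def set_integrable_MB by auto
  note I = nn_integral_weighted_eq[OF int]
  have "((W g powr (- 1 - l * q) * ?I g) powr (1 / q)) powr q \<le> ?N powr q"
    using le[of g] q unfolding bdot_term_def by (intro powr_mono2) auto
  then have "W g powr (- 1 - l * q) * ?I g \<le> ?N powr q"
    using q I(2) by (simp add: powr_powr less_imp_le)
  then have "W g powr (1 + l * q) * (W g powr (- 1 - l * q) * ?I g) \<le> W g powr (1 + l * q) * ?N powr q"
    by (rule mult_left_mono) simp
  moreover have "W g powr (1 + l * q) * (W g powr (- 1 - l * q) * ?I g) = ?I g"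
    by (simp add: mult.assoc[symmetric] powr_add[symmetric])
  moreover have "W g powr (1 + l * q) * ?N powr q = (?N * W g powr l) powr q * W g"
    using N abs_of_pos[OF W_pos[of g]] by (simp add: powr_mult powr_powr powr_add)
  ultimately have "?I g \<le> (?N * W g powr l) powr q * W g" by simp
  then show "(\<integral>\<^sup>+x. ennreal (norm (f x) powr q * w x) \<partial>MB g) \<le> ennreal ((?N * W g powr l) powr q * W g)"
    unfolding I(1) by (rule ennreal_leI)
qed

lemma in_BdotI:
  assumes h [measurable]: "h \<in> borel_measurable M" and q: "1 \<le> q" and Z: "0 \<le> Z"
    and le: "\<And>g. (\<integral>\<^sup>+x. ennreal (norm (h x) powr q * w x) \<partial>MB g) \<le> ennreal ((Z * W g powr l) powr q * W g)"
  shows "in_Bdot p absp M w q l h" and "Bdot_norm p absp M w q l h \<le> Z"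
proof -
  have int: "integrable (MB g) (\<lambda>x. norm (h x) powr q * w x)" for g
  proof (rule integrableI_nonneg)
    show "AE x in MB g. 0 \<le> norm (h x) powr q * w x"
      using w_pos_MB[of g] by (auto elim: eventually_mono)
    show "(\<integral>\<^sup>+x. ennreal (norm (h x) powr q * w x) \<partial>MB g) < \<infinity>"
      using le[of g] by (simp add: le_less_trans)
  qed measurable
  have bd: "bdot_term p absp M w q l h g \<le> Z" for g
  proof -
    let ?I = "LINT x:B g|M. norm (h x) powr q * w x"
    note I = nn_integral_weighted_eq[OF int[of g]]
    have "?I \<le> (Z * W g powr l) powr q * W g"
      using le[of g] Z unfolding I(1) by (subst (asm) ennreal_le_iff) (auto simp: less_imp_le)
    then have "W g powr (- 1 - l * q) * ?I \<le> W g powr (- 1 - l * q) * ((Z * W g powr l) powr q * W g)"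
      by (rule mult_left_mono) simp
    also have "(Z * W g powr l) powr q * W g = W g powr (1 + l * q) * Z powr q"
      using Z abs_of_pos[OF W_pos[of g]] by (simp add: powr_mult powr_powr powr_add)
    also have "W g powr (- 1 - l * q) * (W g powr (1 + l * q) * Z powr q) = Z powr q"
      by (simp add: mult.assoc[symmetric] powr_add[symmetric])
    finally have "(W g powr (- 1 - l * q) * ?I) powr (1 / q) \<le> (Z powr q) powr (1 / q)"
      using q I(2) by (intro powr_mono2) auto
    then show ?thesis using q Z by (simp add: bdot_term_def powr_powr)
  qed
  then show "in_Bdot p absp M w q l h"
    using int unfolding in_Bdot_def loc_Lq_def set_integrable_MB by (auto intro!: bdd_aboveI2)
  show "Bdot_norm p absp M w q l h \<le> Z"
    unfolding Bdot_norm_def using bd by (intro cSUP_least) auto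
qed

text \<open>The oscillation around the mean of the larger ball is restricted to the smaller one,
  which costs the volume ratio, a factor \<open>p powr n\<close>. Since \<open>zeta \<le> r\<close>,
  the exponent \<open>r / zeta\<close> is at least 1 and passing to \<open>L\<^sup>1\<close> is
  possible.\<close>

lemma mean_adjacent:
  assumes b: "in_CMO p absp M w r b" and r: "1 \<le> r" "zeta \<le> r"
  shows "norm (mean M (B g) b - mean M (B (g + 1)) b) \<le> p powr real CARD('n) * (CA * CMO_norm p absp M w r b)"
proof -
  have [measurable]: "b \<in> borel_measurable M" using b by (simp add: in_CMO_def loc_Lq_def)
  have "Lb (r / zeta) (g + 1) (\<lambda>x. b x - mean M (B (g + 1)) b) (CA * CMO_norm p absp M w r b)"
    using CMO_weighted[OF b r(1)] r by (intro Lb_of_weighted) auto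
  then have "Lb 1 g (\<lambda>x. b x - mean M (B (g + 1)) b) (p powr real CARD('n) * (CA * CMO_norm p absp M w r b))"
    using r zeta by (intro Lb_1_smaller Lb_1_of_Lb[of "r / zeta"]) auto
  then show ?thesis
    using b by (intro mean_dist_le) (auto simp: in_CMO_def)
qed

lemma mean_telescope:
  assumes b: "in_CMO p absp M w r b" and r: "1 \<le> r" "zeta \<le> r"
  shows "norm (mean M (B g) b - mean M (B (g + k)) b)
     \<le> \<bar>real_of_int k\<bar> * (p powr real CARD('n) * (CA * CMO_norm p absp M w r b))"
proof -
  let ?P = "p powr real CARD('n) * (CA * CMO_norm p absp M w r b)"
  have up: "norm (mean M (B g) b - mean M (B (g + int k)) b) \<le> real k * ?P" for g k
  proof (induction k)
    case (Suc k)
    have "norm (mean M (B g) b - mean M (B (g + int (Suc k))) b)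
       \<le> norm (mean M (B g) b - mean M (B (g + int k)) b) + norm (mean M (B (g + int k)) b - mean M (B (g + int k + 1)) b)"
      using norm_triangle_ineq[of "mean M (B g) b - mean M (B (g + int k)) b"
          "mean M (B (g + int k)) b - mean M (B (g + int k + 1)) b"] by (simp add: add_ac)
    also have "\<dots> \<le> real k * ?P + ?P"
      using Suc mean_adjacent[OF b r] by (intro add_mono)
    finally show ?case by (simp add: algebra_simps)
  qed simp
  show ?thesis
  proof (cases "0 \<le> k")
    case True
    then show ?thesis using up[of g "nat k"] by simp
  next
    case False
    then show ?thesis using up[of "g + k" "nat (- k)"] by (simp add: norm_minus_commute)
  qed
qed

text \<open>Insert the means over \<open>B g\<close> and \<open>B (g + k)\<close>. The three
  differences are the oscillation of \<open>b\<close> itself, the distance of the means and the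
  oscillation after substitution; up to constants they are bounded by the summands 1, the logarithm
  and the determinant power of \<open>psi_star\<close>.\<close>

lemma Lb_commutator:
  fixes A :: "'a^'n^'n"
  assumes b: "in_CMO p absp M w r b" and r: "1 \<le> r" "zeta \<le> r" and A: "invertible A"
  shows "Lb (r / zeta) g (\<lambda>x. b x - b (A *v x))
     (9 * CA * p powr real CARD('n) * CMO_norm p absp M w r b * psi_star p absp zeta r A)"
proof -
  obtain k :: int where k: "mnorm absp A = p powr k" using mnorm_discrete[OF A] by blast
  have [measurable]: "b \<in> borel_measurable M" using b by (simp add: in_CMO_def loc_Lq_def)
  let ?c = "\<lambda>g. mean M (B g) b" and ?N = "CMO_norm p absp M w r b"
  let ?P = "p powr real CARD('n)"
  let ?D = "inverse (absp (det A)) powr (zeta / r) * mnorm absp A powr (real CARD('n) * zeta / r)"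
  have s: "1 \<le> r / zeta" using r zeta by simp
  have osc: "Lb (r / zeta) g (\<lambda>x. b x - ?c g) (CA * ?N)" for g
    using CMO_weighted[OF b r(1)] r by (intro Lb_of_weighted) auto
  have f3: "Lb (r / zeta) g (\<lambda>x. ?c (g + k) - b (A *v x)) (CA * ?N * ?D)"
  proof -
    have "Lb (r / zeta) g (\<lambda>x. b (A *v x) - ?c (g + k)) (CA * ?N * ?D)"
      using Lb_matrix[OF A k _ osc[of "g + k"]] s by simp
    then show ?thesis
      unfolding Lb_def by (subst norm_minus_commute) simp
  qed
  have f2: "Lb (r / zeta) g (\<lambda>x. ?c g - ?c (g + k)) (\<bar>real_of_int k\<bar> * (?P * (CA * ?N)))"
    using s by (intro Lb_mono[OF Lb_const mean_telescope[OF b r]]) auto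
  have "Lb (r / zeta) g (\<lambda>x. (b x - ?c g) + (?c g - ?c (g + k)) + (?c (g + k) - b (A *v x)))
      (9 * (CA * ?N + \<bar>real_of_int k\<bar> * (?P * (CA * ?N)) + CA * ?N * ?D))"
    by (rule Lb_add3[OF s osc f2 f3])
  then have "Lb (r / zeta) g (\<lambda>x. b x - b (A *v x))
      (9 * (CA * ?N + \<bar>real_of_int k\<bar> * (?P * (CA * ?N)) + CA * ?N * ?D))" by simp
  then show ?thesis
  proof (rule Lb_mono)
    have P: "1 \<le> ?P" using real_p_gt_1 by (intro ge_one_powr_ge_zero) auto
    have N: "0 \<le> CA * ?N" using CA_ge_1 CMO_weighted(1)[OF b r(1)] by simp
    have "\<bar>log p (mnorm absp A)\<bar> = \<bar>real_of_int k\<bar>" using real_p_gt_1 by (simp add: k)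
    then have psi: "1 + \<bar>real_of_int k\<bar> + ?D \<le> psi_star p absp zeta r A"
      unfolding psi_star_def by (simp add: k)
    have "CA * ?N + \<bar>real_of_int k\<bar> * (?P * (CA * ?N)) + CA * ?N * ?D
       = CA * ?N * (1 + \<bar>real_of_int k\<bar> * ?P + ?D)" by (simp add: algebra_simps)
    also have "\<dots> \<le> CA * ?N * (?P * (1 + \<bar>real_of_int k\<bar> + ?D))"
    proof (rule mult_left_mono[OF _ N])
      have "1 * (1 + ?D) \<le> ?P * (1 + ?D)" using P by (intro mult_right_mono) auto
      then show "1 + \<bar>real_of_int k\<bar> * ?P + ?D \<le> ?P * (1 + \<bar>real_of_int k\<bar> + ?D)"
        by (simp add: algebra_simps)
    qed
    also have "\<dots> \<le> CA * ?N * (?P * psi_star p absp zeta r A)"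
      using psi N by (intro mult_left_mono) auto
    finally have "9 * (CA * ?N + \<bar>real_of_int k\<bar> * (?P * (CA * ?N)) + CA * ?N * ?D)
        \<le> 9 * (CA * ?N * (?P * psi_star p absp zeta r A))" by (rule mult_left_mono) simp
    also have "\<dots> = 9 * CA * ?P * ?N * psi_star p absp zeta r A" by (simp add: mult_ac)
    finally show "9 * (CA * ?N + \<bar>real_of_int k\<bar> * (?P * (CA * ?N)) + CA * ?N * ?D)
        \<le> 9 * CA * ?P * ?N * psi_star p absp zeta r A" .
  qed (use s in auto)
qed

text \<open>The Morrey norm is evaluated on the ball \<open>B (g + k)\<close> that receives the
  image, substitution yields \<open>mu_star\<close>, and the power of \<open>W (g + k)\<close> is
  traded for that of \<open>W g\<close>.\<close>

lemma Lb_composition: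
  fixes A :: "'a^'n^'n"
  assumes f: "in_Bdot p absp M w q l f" and q: "1 \<le> q" and A: "invertible A" and l: "l < 0"
    and RH: "is_RH \<rho> C" and d: "1 < \<delta>" "\<delta> \<le> \<rho>" and D: "CA \<le> D" "C \<le> D"
  shows "Lb (q / zeta) g (\<lambda>x. f (A *v x))
     (CA * D powr (- l) * Bdot_norm p absp M w q l f * W g powr l * (mu_star absp zeta q A *
     ((if mnorm absp A \<le> 1 then mnorm absp A powr (real CARD('n) * zeta * l) else 0) +
      (if mnorm absp A > 1 then mnorm absp A powr (real CARD('n) * l * (\<delta> - 1) / \<delta>) else 0))))"
    (is "Lb _ _ _ (CA * _ * ?N * _ * (?mu * ?E))")
proof -
  obtain k :: int where k: "mnorm absp A = p powr k" using mnorm_discrete[OF A] by blast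
  have [measurable]: "f \<in> borel_measurable M" using f by (simp add: in_Bdot_def loc_Lq_def)
  note N = Bdot_weighted[OF f q]
  have "Lb (q / zeta) (g + k) f (CA * (?N * W (g + k) powr l))"
    using N(1) q by (intro Lb_of_weighted N(2)) auto
  then have "Lb (q / zeta) g (\<lambda>x. f (A *v x)) (CA * (?N * W (g + k) powr l) * ?mu)"
    using Lb_matrix[OF A k, of "q / zeta" g f] q zeta unfolding mu_star_def by simp
  then show ?thesis
  proof (rule Lb_mono)
    have "W (g + k) powr l \<le> D powr (- l) * W g powr l * ?E"
      by (rule W_powr_neg_le[OF RH l d D k])
    then have "CA * ?N * ?mu * W (g + k) powr l \<le> CA * ?N * ?mu * (D powr (- l) * W g powr l * ?E)"
      using N(1) CA_ge_1 by (intro mult_left_mono) (auto simp: mu_star_def)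
    then show "CA * (?N * W (g + k) powr l) * ?mu \<le> CA * D powr (- l) * ?N * W g powr l * (?mu * ?E)"
      by (simp add: mult_ac)
  qed (use q zeta in auto)
qed

subsection \<open>Boundedness of the commutator\<close>

text \<open>By the reverse Hoelder inequality the weight is just one more factor, in
  \<open>L\<^sup>\<rho>\<close>, besides the 2m given ones, so a single application of Hoelder's
  inequality suffices.\<close>

lemma Holder_slice:
  fixes s t X Y :: "nat \<Rightarrow> real"
  assumes s: "\<And>i. i < m \<Longrightarrow> 0 < s i" and t: "\<And>i. i < m \<Longrightarrow> 0 < t i" and q: "0 < q"
    and F: "\<And>i. i < m \<Longrightarrow> Lb (s i) g (F i) (X i)" and G: "\<And>i. i < m \<Longrightarrow> Lb (t i) g (G i) (Y i)"
    and RH: "is_RH \<rho> C" and exps: "(\<Sum>i<m. q / s i) + (\<Sum>i<m. q / t i) + 1 / \<rho> \<le> 1"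
  shows "(\<integral>\<^sup>+x. ennreal (norm ((\<Prod>i<m. F i x) * (\<Prod>i<m. G i x)) powr q * w x) \<partial>MB g)
     \<le> ennreal (C * W g * ((\<Prod>i<m. X i) * (\<Prod>i<m. Y i)) powr q)"
proof -
  let ?I = "({..<m} <+> {..<m}) <+> (UNIV :: bool set)"
  txt \<open>\<open>Inr True\<close> carries the weight; \<open>Inr False\<close> is the constant 1, which absorbs the slack in the exponents.\<close>
  define \<theta>0 where "\<theta>0 = 1 - ((\<Sum>i<m. q / s i) + (\<Sum>i<m. q / t i) + 1 / \<rho>)"
  define \<theta> :: "(nat + nat) + bool \<Rightarrow> real" where
    "\<theta> = case_sum (case_sum (\<lambda>i. q / s i) (\<lambda>i. q / t i)) (\<lambda>u. if u then 1 / \<rho> else \<theta>0)"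
  define h :: "(nat + nat) + bool \<Rightarrow> 'a^'n \<Rightarrow> real" where
    "h = case_sum (case_sum (\<lambda>i x. norm (F i x) powr s i) (\<lambda>i x. norm (G i x) powr t i))
       (\<lambda>u x. if u then w x powr \<rho> else 1)"
  define c :: "(nat + nat) + bool \<Rightarrow> real" where
    "c = case_sum (case_sum (\<lambda>i. X i powr s i) (\<lambda>i. Y i powr t i))
       (\<lambda>u. if u then (C * (W g / V g)) powr \<rho> else 1)"
  have \<rho>: "1 < \<rho>" "1 \<le> C" using RH by (auto simp: is_RH_def)
  have split: "z \<in> ?I \<Longrightarrow> (\<And>i. i < m \<Longrightarrow> P (Inl (Inl i))) \<Longrightarrow> (\<And>i. i < m \<Longrightarrow> P (Inl (Inr i))) \<Longrightarrow>
      P (Inr True) \<Longrightarrow> P (Inr False) \<Longrightarrow> P z" for P z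
    by (auto simp: UNIV_bool)
  have V0: "V g powr (\<Sum>z\<in>?I. \<theta> z) = (\<Prod>z\<in>?I. V g powr \<theta> z)"
    by (rule powr_sum) auto
  have X: "0 \<le> X i" "0 \<le> Y i" if "i < m" for i using F[OF that] G[OF that] by (auto simp: Lb_def)
  have sum1: "(\<Sum>z\<in>?I. \<theta> z) = 1"
    by (simp add: sum.Plus \<theta>_def UNIV_bool \<theta>0_def)
  have H: "(\<integral>\<^sup>+x. ennreal (\<Prod>z\<in>?I. h z x powr \<theta> z) \<partial>MB g) \<le> ennreal (\<Prod>z\<in>?I. (V g * c z) powr \<theta> z)"
  proof (rule Holder_nn_integral_prod[OF _ _ sum1])
    fix z assume z: "z \<in> ?I"
    show "0 \<le> \<theta> z" using z
      by (rule split) (use s t q \<rho> exps in \<open>auto simp: \<theta>_def \<theta>0_def less_imp_le\<close>)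
    show "h z \<in> borel_measurable (MB g)" using z
    proof (rule split)
      fix i assume "i < m"
      then have [measurable]: "F i \<in> borel_measurable M" "G i \<in> borel_measurable M"
        using F[of i] G[of i] by (auto simp: Lb_def)
      show "h (Inl (Inl i)) \<in> borel_measurable (MB g)" "h (Inl (Inr i)) \<in> borel_measurable (MB g)"
        by (auto simp: h_def)
    qed (auto simp: h_def)
    show "0 \<le> h z x" for x using z by (rule split) (auto simp: h_def)
    show "0 \<le> V g * c z" using z by (rule split) (auto simp: c_def)
    show "(\<integral>\<^sup>+x. ennreal (h z x) \<partial>MB g) \<le> ennreal (V g * c z)" using z
      by (rule split) (use F G RH in \<open>auto simp: h_def c_def Lb_def is_RH_def nn_integral_const emeasure_MB\<close>)
  qed simp
  have "(\<integral>\<^sup>+x. ennreal (norm ((\<Prod>i<m. F i x) * (\<Prod>i<m. G i x)) powr q * w x) \<partial>MB g) =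
      (\<integral>\<^sup>+x. ennreal (\<Prod>z\<in>?I. h z x powr \<theta> z) \<partial>MB g)"
  proof (rule nn_integral_cong_AE, use w_pos_MB[of g] in eventually_elim)
    case (elim x)
    have "(\<Prod>z\<in>?I. h z x powr \<theta> z) = (\<Prod>i<m. (norm (F i x) powr s i) powr (q / s i)) *
        (\<Prod>i<m. (norm (G i x) powr t i) powr (q / t i)) * (w x powr \<rho>) powr (1 / \<rho>)"
      by (simp add: prod.Plus h_def \<theta>_def UNIV_bool)
    also have "(\<Prod>i<m. (norm (F i x) powr s i) powr (q / s i)) = (\<Prod>i<m. norm (F i x) powr q)"
      using s by (intro prod.cong refl) (auto simp: powr_powr dest!: s)
    also have "(\<Prod>i<m. (norm (G i x) powr t i) powr (q / t i)) = (\<Prod>i<m. norm (G i x) powr q)"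
      using t by (intro prod.cong refl) (auto simp: powr_powr dest!: t)
    also have "(w x powr \<rho>) powr (1 / \<rho>) = w x"
      using elim \<rho> by (simp add: powr_powr)
    finally show ?case
      by (simp add: norm_mult powr_mult prod_powr_distrib flip: prod_norm)
  qed
  also note H
  \<comment> \<open>The exponents sum to 1, so the volume comes out exactly once; it cancels the
    volume in \<open>W g / V g\<close>.\<close>
  also have "(\<Prod>z\<in>?I. (V g * c z) powr \<theta> z) = V g * (\<Prod>z\<in>?I. c z powr \<theta> z)"
  proof -
    have "(\<Prod>z\<in>?I. (V g * c z) powr \<theta> z) = (\<Prod>z\<in>?I. V g powr \<theta> z * c z powr \<theta> z)"
      by (simp add: powr_mult)
    also have "\<dots> = V g powr (\<Sum>z\<in>?I. \<theta> z) * (\<Prod>z\<in>?I. c z powr \<theta> z)"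
      unfolding V0 by (rule prod.distrib)
    finally show ?thesis unfolding sum1 by simp
  qed
  also have "(\<Prod>z\<in>?I. c z powr \<theta> z) = (\<Prod>i<m. (X i powr s i) powr (q / s i)) *
      (\<Prod>i<m. (Y i powr t i) powr (q / t i)) * ((C * (W g / V g)) powr \<rho>) powr (1 / \<rho>)"
    by (simp add: prod.Plus c_def \<theta>_def UNIV_bool)
  also have "(\<Prod>i<m. (X i powr s i) powr (q / s i)) = (\<Prod>i<m. X i powr q)"
    by (intro prod.cong refl) (auto simp: powr_powr dest!: s)
  also have "(\<Prod>i<m. (Y i powr t i) powr (q / t i)) = (\<Prod>i<m. Y i powr q)"
    by (intro prod.cong refl) (auto simp: powr_powr dest!: t)
  also have "((C * (W g / V g)) powr \<rho>) powr (1 / \<rho>) = C * (W g / V g)"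
    using \<rho> by (simp add: powr_powr less_imp_le)
  also have "(\<Prod>i<m. X i powr q) * (\<Prod>i<m. Y i powr q) = ((\<Prod>i<m. X i) * (\<Prod>i<m. Y i)) powr q"
    using X by (simp add: powr_mult prod_powr_distrib prod_nonneg)
  also have "V g * (((\<Prod>i<m. X i) * (\<Prod>i<m. Y i)) powr q * (C * (W g / V g))) =
      C * W g * ((\<Prod>i<m. X i) * (\<Prod>i<m. Y i)) powr q"
    by simp
  finally show ?thesis .
qed

lemma measurable_hausdorff_comm_integrand:
  fixes A :: "nat \<Rightarrow> 'a^'n \<Rightarrow> 'a^'n^'n"
  assumes [measurable]: "Phi \<in> borel_measurable M"
    and A: "\<And>i j k. i < m \<Longrightarrow> (\<lambda>y. A i y $ j $ k) \<in> measurable M Q"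
    and b: "\<And>i. i < m \<Longrightarrow> b i \<in> borel_measurable M" and f: "\<And>i. i < m \<Longrightarrow> f i \<in> borel_measurable M"
  shows "(\<lambda>(x, y). hausdorff_comm_integrand absp m Phi A b f x y) \<in> borel_measurable (M \<Otimes>\<^sub>M M)"
proof -
  have Ax: "(\<lambda>z. A i (snd z) *v fst z) \<in> measurable (M \<Otimes>\<^sub>M M) M" if "i < m" for i
    using A[OF that] by (intro measurable_matrix_vector) (auto intro: measurable_compose[OF measurable_snd])
  have "(\<lambda>z. \<Prod>i<m. b i (fst z) - b i (A i (snd z) *v fst z)) \<in> borel_measurable (M \<Otimes>\<^sub>M M)"
    by (intro borel_measurable_prod borel_measurable_diff)
       (auto intro: measurable_compose[OF measurable_fst b] measurable_compose[OF Ax b])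
  moreover have "(\<lambda>z. \<Prod>i<m. f i (A i (snd z) *v fst z)) \<in> borel_measurable (M \<Otimes>\<^sub>M M)"
    by (intro borel_measurable_prod) (auto intro: measurable_compose[OF Ax f])
  moreover have "(\<lambda>z. complex_of_real (Phi (snd z) / vnorm absp (snd z) ^ CARD('n))) \<in> borel_measurable (M \<Otimes>\<^sub>M M)"
    by measurable
  ultimately show ?thesis
    unfolding hausdorff_comm_integrand_def case_prod_beta
    by (intro borel_measurable_times)
qed

text \<open>The constant is kept explicit so that its first two factors are seen to involve only the
  weight and the exponents and can be named before the kernel and the functions are chosen.\<close>

lemma hausdorff_comm_bound:
  fixes r q lam :: "nat \<Rightarrow> real"
  assumes qs: "1 \<le> qs"
    and r: "\<And>i. i < m \<Longrightarrow> 1 \<le> r i" "\<And>i. i < m \<Longrightarrow> zeta \<le> r i"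
    and q: "\<And>i. i < m \<Longrightarrow> 1 \<le> q i" and lam: "\<And>i. i < m \<Longrightarrow> lam i < 0"
    and RH: "is_RH \<rho> C" and d: "1 < \<delta>" "\<delta> \<le> \<rho>" and D: "CA \<le> D" "C \<le> D"
    and exps: "((\<Sum>i<m. 1 / r i) + (\<Sum>i<m. 1 / q i)) * zeta * qs + 1 / \<rho> \<le> 1"
    and Phi [measurable]: "Phi \<in> borel_measurable M" and Phi0: "\<And>y. 0 \<le> Phi y"
    and A: "\<And>i j k. i < m \<Longrightarrow> (\<lambda>y. A i y $ j $ k) \<in> measurable M Q"
    and inv: "\<And>i. i < m \<Longrightarrow> AE y in M. invertible (A i y)"
    and b: "\<And>i. i < m \<Longrightarrow> in_CMO p absp M w (r i) (b i)"
    and fin: "C10 p absp M m Phi A zeta \<delta> r q lam < \<infinity>"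
    and f: "\<And>i. i < m \<Longrightarrow> in_Bdot p absp M w (q i) (lam i) (f i)"
  defines "T \<equiv> C * (\<Prod>i<m. 9 * CA * p powr real CARD('n) * (CA * D powr (- lam i))) *
      enn2real (C10 p absp M m Phi A zeta \<delta> r q lam) *
      (\<Prod>i<m. CMO_norm p absp M w (r i) (b i)) * (\<Prod>i<m. Bdot_norm p absp M w (q i) (lam i) (f i))"
  shows "AE x in M. integrable M (hausdorff_comm_integrand absp m Phi A b f x)"
    and "in_Bdot p absp M w qs (\<Sum>i<m. lam i) (hausdorff_comm absp M m Phi A b f)"
    and "Bdot_norm p absp M w qs (\<Sum>i<m. lam i) (hausdorff_comm absp M m Phi A b f) \<le> T"
proof -
  let ?b = "\<lambda>i. CMO_norm p absp M w (r i) (b i)"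
  let ?f = "\<lambda>i. Bdot_norm p absp M w (q i) (lam i) (f i)"
  let ?psi = "\<lambda>i y. psi_star p absp zeta (r i) (A i y)"
  define ME where "ME i y = mu_star absp zeta (q i) (A i y) *
      ((if mnorm absp (A i y) \<le> 1 then mnorm absp (A i y) powr (real CARD('n) * zeta * lam i) else 0) +
       (if mnorm absp (A i y) > 1 then mnorm absp (A i y) powr (real CARD('n) * lam i * (\<delta> - 1) / \<delta>) else 0))" for i y
  \<comment> \<open>The integrand of \<open>C10\<close>. Everything in the slice estimate that does
    not depend on \<open>y\<close> goes into \<open>S\<close>, the weight constant \<open>C\<close>
    and the powers of \<open>W g\<close>.\<close>
  define K where "K y = Phi y / vnorm absp y ^ CARD('n) * (\<Prod>i<m. ?psi i y * ME i y)" for y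
  define \<kappa> where "\<kappa> = enn2real (C10 p absp M m Phi A zeta \<delta> r q lam)"
  define U where "U = (\<Prod>i<m. 9 * CA * p powr real CARD('n) * (CA * D powr (- lam i)))"
  define S where "S = U * (\<Prod>i<m. ?b i) * (\<Prod>i<m. ?f i)"
  let ?F = "hausdorff_comm_integrand absp m Phi A b f"
  let ?lam = "\<Sum>i<m. lam i"
  have C: "1 \<le> C" using RH by (simp add: is_RH_def)
  have D0: "0 < D" using D CA_ge_1 by linarith
  have b0: "0 \<le> ?b i" if "i < m" for i by (rule CMO_weighted(1)[OF b[OF that] r(1)[OF that]])
  have f0: "0 \<le> ?f i" if "i < m" for i by (rule Bdot_weighted(1)[OF f[OF that] q[OF that]])
  have U0: "0 \<le> U" unfolding U_def using CA_ge_1 by (intro prod_nonneg) auto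
  have S0: "0 \<le> S" unfolding S_def using U0 b0 f0 by (intro mult_nonneg_nonneg prod_nonneg) auto
  have \<kappa>0: "0 \<le> \<kappa>" by (simp add: \<kappa>_def)
  have T: "T = C * (\<kappa> * S)" by (simp add: T_def S_def U_def \<kappa>_def mult_ac)
  have vnorm0: "0 \<le> vnorm absp y" for y :: "'a^'n"
    using absp_le_vnorm[of y undefined] absp_nonneg order_trans by blast
  have mnorm0: "0 \<le> mnorm absp A" for A :: "'a^'n^'n"
    using absp_le_mnorm[of A undefined undefined] absp_nonneg order_trans by blast
  have psi1: "1 \<le> ?psi i y" for i y
    unfolding psi_star_def using mnorm0 by (simp add: add_nonneg_nonneg)
  have ME0: "0 \<le> ME i y" for i y unfolding ME_def mu_star_def by simp
  have psi_ME0: "0 \<le> ?psi i y * ME i y" for i y using psi1[of i y] ME0[of i y] by simp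
  have Phi': "0 \<le> Phi y / vnorm absp y ^ CARD('n)" for y using Phi0 vnorm0 by simp
  have K0: "0 \<le> K y" for y
    unfolding K_def by (intro mult_nonneg_nonneg[OF Phi'] prod_nonneg psi_ME0)
  have b_meas: "b i \<in> borel_measurable M" if "i < m" for i
    using b[OF that] by (simp add: in_CMO_def loc_Lq_def)
  have f_meas: "f i \<in> borel_measurable M" if "i < m" for i
    using f[OF that] by (simp add: in_Bdot_def loc_Lq_def)
  have F_meas [measurable]: "case_prod ?F \<in> borel_measurable (M \<Otimes>\<^sub>M M)"
    using measurable_hausdorff_comm_integrand[OF Phi A b_meas f_meas, where m = m] by simp
  have K_meas [measurable]: "K \<in> borel_measurable M"
  proof -
    have "(\<lambda>y. ?psi i y * ME i y) \<in> borel_measurable M" if "i < m" for i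
    proof -
      have [measurable]: "(\<lambda>y. mnorm absp (A i y)) \<in> borel_measurable M"
        "(\<lambda>y. absp (det (A i y))) \<in> borel_measurable M"
        using measurable_mnorm[OF A[OF that]] measurable_compose[OF measurable_det_Q[OF A[OF that]] measurable_absp] by auto
      show ?thesis unfolding psi_star_def ME_def mu_star_def by measurable
    qed
    then have [measurable]: "(\<lambda>y. \<Prod>i<m. ?psi i y * ME i y) \<in> borel_measurable M"
      by (intro borel_measurable_prod) auto
    show ?thesis unfolding K_def by measurable
  qed
  have C10: "(\<integral>\<^sup>+y. ennreal (K y) \<partial>M) = C10 p absp M m Phi A zeta \<delta> r q lam"
    unfolding C10_def K_def ME_def by (simp only: mult.assoc)
  have \<kappa>: "(\<integral>\<^sup>+y. ennreal (K y) \<partial>M) \<le> ennreal \<kappa>"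
    unfolding C10 \<kappa>_def using fin by simp
  have inv_all: "AE y in M. \<forall>i\<in>{..<m}. invertible (A i y)"
    using inv by (intro AE_ball_countable') auto
  have norm_F: "norm (?F x y) = Phi y / vnorm absp y ^ CARD('n) *
      norm ((\<Prod>i<m. b i x - b i (A i y *v x)) * (\<Prod>i<m. f i (A i y *v x)))" for x y
    unfolding hausdorff_comm_integrand_def mult.assoc norm_mult[of "complex_of_real _"]
    using Phi'[of y] by (simp only: norm_of_real abs_of_nonneg)
  have slice: "(\<integral>\<^sup>+x. ennreal (norm (?F x y) powr qs * w x) \<partial>MB g)
      \<le> ennreal (K y powr qs * (C * W g * (S * W g powr ?lam) powr qs))"
    if y: "\<forall>i\<in>{..<m}. invertible (A i y)" for y g
  proof -
    let ?P = "Phi y / vnorm absp y ^ CARD('n)"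
    let ?X = "\<lambda>i. 9 * CA * p powr real CARD('n) * ?b i * ?psi i y"
    let ?Y = "\<lambda>i. CA * D powr (- lam i) * ?f i * W g powr lam i * ME i y"
    have e: "(\<Sum>i<m. qs / (r i / zeta)) + (\<Sum>i<m. qs / (q i / zeta)) + 1 / \<rho> \<le> 1"
    proof -
      have "(\<Sum>i<m. qs / (v i / zeta)) = (\<Sum>i<m. 1 / v i) * zeta * qs" for v :: "nat \<Rightarrow> real"
        by (simp add: sum_distrib_left mult_ac)
      then show ?thesis using exps by (simp add: distrib_right)
    qed
    have "(\<integral>\<^sup>+x. ennreal (norm ((\<Prod>i<m. b i x - b i (A i y *v x)) * (\<Prod>i<m. f i (A i y *v x))) powr qs * w x) \<partial>MB g)
        \<le> ennreal (C * W g * ((\<Prod>i<m. ?X i) * (\<Prod>i<m. ?Y i)) powr qs)"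
    proof (rule Holder_slice[OF _ _ _ _ _ RH e])
      fix i assume i: "i < m"
      then have Ai: "invertible (A i y)" using y by simp
      show "0 < r i / zeta" "0 < q i / zeta" using r(1)[OF i] q[OF i] zeta by auto
      show "Lb (r i / zeta) g (\<lambda>x. b i x - b i (A i y *v x)) (?X i)"
        by (rule Lb_commutator[OF b[OF i] r(1)[OF i] r(2)[OF i] Ai])
      show "Lb (q i / zeta) g (\<lambda>x. f i (A i y *v x)) (?Y i)"
        unfolding ME_def by (rule Lb_composition[OF f[OF i] q[OF i] Ai lam[OF i] RH d D])
    qed (use qs in auto)
    moreover have "(\<Prod>i<m. ?X i) * (\<Prod>i<m. ?Y i) = (\<Prod>i<m. ?psi i y * ME i y) * (S * W g powr ?lam)"
    proof -
      have "W g powr ?lam = (\<Prod>i<m. W g powr lam i)" by (intro powr_sum) auto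
      then show ?thesis unfolding S_def U_def prod.distrib by (simp add: mult_ac)
    qed
    ultimately have le: "(\<integral>\<^sup>+x. ennreal (norm ((\<Prod>i<m. b i x - b i (A i y *v x)) * (\<Prod>i<m. f i (A i y *v x))) powr qs * w x) \<partial>MB g)
        \<le> ennreal (C * W g * ((\<Prod>i<m. ?psi i y * ME i y) * (S * W g powr ?lam)) powr qs)" by simp
    have [measurable]: "(\<lambda>x. ?F x y) \<in> borel_measurable M"
      using measurable_compose[OF measurable_Pair2'[of y M M] F_meas] by simp
    have weighted_meas: "(\<lambda>x. ennreal (h x powr qs * w x)) \<in> borel_measurable M"
      if [measurable]: "h \<in> borel_measurable M" for h by measurable
    have meas: "(\<lambda>x. norm ((\<Prod>i<m. b i x - b i (A i y *v x)) * (\<Prod>i<m. f i (A i y *v x)))) \<in> borel_measurable M"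
      by (intro measurable_compose[OF _ borel_measurable_norm] borel_measurable_times borel_measurable_prod borel_measurable_diff)
         (auto intro: measurable_compose[OF measurable_matrix] b_meas f_meas)
    have "(\<integral>\<^sup>+x. ennreal (norm (?F x y) powr qs * w x) \<partial>MB g) =
        (\<integral>\<^sup>+x. ennreal (?P powr qs) * ennreal (norm ((\<Prod>i<m. b i x - b i (A i y *v x)) * (\<Prod>i<m. f i (A i y *v x))) powr qs * w x) \<partial>MB g)"
      unfolding norm_F using Phi'[of y]
      by (intro nn_integral_cong) (simp only: powr_mult norm_ge_zero mult.assoc ennreal_mult' powr_ge_zero)
    also have "\<dots> = ennreal (?P powr qs) * (\<integral>\<^sup>+x. ennreal (norm ((\<Prod>i<m. b i x - b i (A i y *v x)) * (\<Prod>i<m. f i (A i y *v x))) powr qs * w x) \<partial>MB g)"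
      by (intro nn_integral_cmult measurable_MB weighted_meas meas)
    also have "\<dots> \<le> ennreal (?P powr qs) * ennreal (C * W g * ((\<Prod>i<m. ?psi i y * ME i y) * (S * W g powr ?lam)) powr qs)"
      by (rule mult_left_mono[OF le]) simp
    also have "\<dots> = ennreal (?P powr qs * (C * W g * ((\<Prod>i<m. ?psi i y * ME i y) * (S * W g powr ?lam)) powr qs))"
      by (rule ennreal_mult'[symmetric]) simp
    also have "?P powr qs * (C * W g * ((\<Prod>i<m. ?psi i y * ME i y) * (S * W g powr ?lam)) powr qs) =
        K y powr qs * (C * W g * (S * W g powr ?lam) powr qs)"
    proof -
      have "0 \<le> (\<Prod>i<m. ?psi i y * ME i y)"
        by (intro prod_nonneg psi_ME0)
      then show ?thesis
        unfolding K_def using Phi'[of y] S0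
        by (simp only: powr_mult mult_nonneg_nonneg powr_ge_zero mult_ac)
    qed
    finally show ?thesis .
  qed
  \<comment> \<open>For invertible matrices the product is positive, so \<open>K y = 0\<close> can
    only come from the kernel factor, which the integrand shares; this includes
    \<open>y = 0\<close>, where the division by zero yields 0.\<close>
  have zero: "AE y in M. K y = 0 \<longrightarrow> (\<forall>x. norm (?F x y) = 0)"
    using inv_all
  proof eventually_elim
    case (elim y)
    have "?psi i y * ME i y \<noteq> 0" if "i < m" for i
    proof -
      have Ai: "invertible (A i y)" using elim that by simp
      obtain k :: int where k: "mnorm absp (A i y) = p powr k" using mnorm_discrete[OF Ai] by blast
      have "det (A i y) \<noteq> 0" using Ai by (simp add: invertible_det_nz)
      then have "ME i y \<noteq> 0" using p_gt_1 by (auto simp: ME_def mu_star_def k)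
      moreover have "?psi i y \<noteq> 0" using psi1[of i y] by linarith
      ultimately show ?thesis by simp
    qed
    then have "(\<Prod>i<m. ?psi i y * ME i y) \<noteq> 0" by (simp add: prod_zero_iff)
    then show ?case unfolding norm_F by (auto simp: K_def)
  qed
  \<comment> \<open>Minkowski's inequality is applied with the weighted measure on the ball in the
    variable \<open>x\<close>; it is finite, with total mass \<open>W g\<close>.\<close>
  define N where "N g = density (MB g) (\<lambda>x. ennreal (w x))" for g
  have N_int: "(\<integral>\<^sup>+x. ennreal (h x) \<partial>N g) = (\<integral>\<^sup>+x. ennreal (h x * w x) \<partial>MB g)"
    if "h \<in> borel_measurable M" "\<And>x. 0 \<le> h x" for h g
  proof -
    have "(\<integral>\<^sup>+x. ennreal (h x) \<partial>N g) = (\<integral>\<^sup>+x. ennreal (w x) * ennreal (h x) \<partial>MB g)"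
      unfolding N_def using that by (intro nn_integral_density) auto
    also have "\<dots> = (\<integral>\<^sup>+x. ennreal (h x * w x) \<partial>MB g)"
      using that(2) by (intro nn_integral_cong) (simp add: ennreal_mult' mult.commute)
    finally show ?thesis .
  qed
  have N_fin: "sigma_finite_measure (N g)" for g
  proof -
    have "emeasure (N g) (space (N g)) = ennreal (W g)"
      using N_int[of "\<lambda>_. 1" g] nn_integral_w[of g] by simp
    then interpret finite_measure "N g" by (intro finite_measureI) simp
    show ?thesis ..
  qed
  have sets_N: "sets (N g) = sets (MB g)" for g by (simp add: N_def)
  have F_N: "case_prod (\<lambda>x y. norm (?F x y)) \<in> borel_measurable (N g \<Otimes>\<^sub>M M)" for g
  proof -
    have "id \<in> measurable (N g) M"
      using measurable_restrict_space1[of id M M "B g"] by (simp add: measurable_cong_sets[OF sets_N refl])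
    then have "(\<lambda>z. (fst z, snd z)) \<in> measurable (N g \<Otimes>\<^sub>M M) (M \<Otimes>\<^sub>M M)"
      by (intro measurable_Pair) (auto intro: measurable_compose[OF measurable_fst, where g = id, simplified])
    from measurable_compose[OF this F_meas]
    show ?thesis by (simp add: case_prod_beta)
  qed
  have slice_meas: "(\<lambda>x. norm (?F x y) powr qs) \<in> borel_measurable M" for y
    using measurable_compose[OF measurable_Pair2'[of y M M] F_meas] by simp
  have L: "0 \<le> C * W g * (S * W g powr ?lam) powr qs" for g using C by (simp add: less_imp_le)
  have slice': "AE y in M. (\<integral>\<^sup>+x. ennreal (norm (?F x y) powr qs) \<partial>N g)
      \<le> ennreal (K y powr qs * (C * W g * (S * W g powr ?lam) powr qs))" for g
    using inv_all by eventually_elim (simp only: N_int[OF slice_meas] powr_ge_zero slice)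
  note Mink = Minkowski_nn_integral[OF N_fin sigma_finite_measure_axioms F_N norm_ge_zero K_meas K0 \<kappa> \<kappa>0 qs L zero slice']
  let ?G = "\<lambda>x. \<integral>\<^sup>+y. ennreal (norm (?F x y)) \<partial>M"
  have "AE x in M. x \<in> B g \<longrightarrow> ?G x < \<infinity>" for g
  proof -
    \<comment> \<open>Since the weight is positive almost everywhere, the weighted and the plain
      measure on the ball have the same null sets. Countably many balls then exhaust the
      space.\<close>
    have "AE x in MB g. 0 < ennreal (w x) \<longrightarrow> ?G x < \<infinity>"
      using Mink(1)[of g] unfolding N_def by (subst (asm) AE_density) auto
    then have "AE x in MB g. ?G x < \<infinity>"
      using w_pos_MB[of g] by eventually_elim simp
    then show ?thesis by (simp add: AE_restrict_space_iff)
  qed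
  then have "AE x in M. \<forall>n::nat. x \<in> B (int n) \<longrightarrow> ?G x < \<infinity>"
    by (intro AE_all_countable[THEN iffD2] allI)
  then show "AE x in M. integrable M (?F x)"
  proof eventually_elim
    case (elim x)
    have "?F x \<in> borel_measurable M"
      using measurable_compose[OF measurable_Pair1'[of x M M] F_meas] by simp
    moreover have "?G x < \<infinity>" using elim UN_B0 by blast
    ultimately show ?case by (rule integrableI_bounded)
  qed
  have H_meas: "hausdorff_comm absp M m Phi A b f \<in> borel_measurable M"
    unfolding hausdorff_comm_def using F_meas by (rule borel_measurable_lebesgue_integral)
  \<comment> \<open>This holds for every \<open>x\<close>: without integrability the Bochner
    integral on the left is 0.\<close>
  have H_le: "norm (hausdorff_comm absp M m Phi A b f x) \<le> enn2real (?G x)" for x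
  proof (cases "integrable M (?F x)")
    case True
    have "norm (hausdorff_comm absp M m Phi A b f x) \<le> (LINT y|M. norm (?F x y))"
      unfolding hausdorff_comm_def by (rule integral_norm_bound)
    also have "\<dots> = enn2real (?G x)"
      using True by (intro integral_eq_nn_integral) auto
    finally show ?thesis .
  qed (simp add: hausdorff_comm_def not_integrable_integral_eq)
  have G_meas: "(\<lambda>x. enn2real (?G x)) \<in> borel_measurable M"
    using F_meas by measurable
  have bound: "(\<integral>\<^sup>+x. ennreal (norm (hausdorff_comm absp M m Phi A b f x) powr qs * w x) \<partial>MB g)
      \<le> ennreal ((T * W g powr ?lam) powr qs * W g)" for g
  proof -
    have "(\<integral>\<^sup>+x. ennreal (norm (hausdorff_comm absp M m Phi A b f x) powr qs * w x) \<partial>MB g)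
        \<le> (\<integral>\<^sup>+x. ennreal (enn2real (?G x) powr qs * w x) \<partial>MB g)"
    proof (rule nn_integral_mono_AE, use w_pos_MB[of g] in eventually_elim)
      case (elim x)
      then show ?case using H_le[of x] qs
        by (intro ennreal_leI mult_right_mono powr_mono2) auto
    qed
    also have "\<dots> = (\<integral>\<^sup>+x. ennreal (enn2real (?G x) powr qs) \<partial>N g)"
      using G_meas by (subst N_int) auto
    also have "\<dots> \<le> ennreal (\<kappa> powr qs * (C * W g * (S * W g powr ?lam) powr qs))"
      by (rule Mink(2))
    also have "\<dots> \<le> ennreal ((T * W g powr ?lam) powr qs * W g)"
    proof (rule ennreal_leI)
      \<comment> \<open>Minkowski leaves \<open>C\<close> outside the power \<open>qs\<close>,
        whereas \<open>T\<close> contains it inside; \<open>C \<ge> 1\<close> permits the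
        move.\<close>
      have "C \<le> C powr qs" using powr_mono[of 1 qs C] C qs by simp
      then have "C * (\<kappa> powr qs * (S * W g powr ?lam) powr qs * W g)
          \<le> C powr qs * (\<kappa> powr qs * (S * W g powr ?lam) powr qs * W g)"
        by (intro mult_right_mono) (auto simp: less_imp_le)
      also have "\<dots> = (T * W g powr ?lam) powr qs * W g"
        unfolding T using C \<kappa>0 S0 by (simp add: powr_mult)
      finally show "\<kappa> powr qs * (C * W g * (S * W g powr ?lam) powr qs) \<le> (T * W g powr ?lam) powr qs * W g"
        by (simp add: mult_ac)
    qed
    finally show ?thesis .
  qed
  have T0: "0 \<le> T" unfolding T using C \<kappa>0 S0 by simp
  show "in_Bdot p absp M w qs ?lam (hausdorff_comm absp M m Phi A b f)"
    "Bdot_norm p absp M w qs ?lam (hausdorff_comm absp M m Phi A b f) \<le> T"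
    using in_BdotI[OF H_meas qs T0 bound] by auto
qed

end

theorem theorem4p8:
  fixes p :: nat and absp :: "'a::field_char_0 \<Rightarrow> real"
    and M :: "('a^'n::finite) measure"
    and m :: nat and zeta delta qs :: real
    and w :: "'a^'n \<Rightarrow> real"
    and r q lam :: "nat \<Rightarrow> real"
  assumes Qp: "is_Qp p absp"
    and haar: "is_haar p absp M"
    and m: "1 \<le> m"
    and qs: "1 \<le> qs"
    and r_ge: "\<forall>i<m. 1 \<le> r i"
    and q_ge: "\<forall>i<m. 1 \<le> q i"
    and zeta: "1 \<le> zeta"
    and Aw: "A_class p absp M zeta w"
    and rw_fin: "RH_set p absp M w \<noteq> {}" "bdd_above (RH_set p absp M w)"
    and delta: "1 < delta" "delta < crit_index p absp M w"
    and zeta_r: "\<forall>i<m. zeta \<le> r i"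
    and exps: "1 / qs > ((\<Sum>i<m. 1 / r i) + (\<Sum>i<m. 1 / q i)) * zeta *
                  (crit_index p absp M w / (crit_index p absp M w - 1))"
    and lam: "\<forall>i<m. - 1 / q i < lam i \<and> lam i < 0"
  shows "\<exists>C. \<forall>(Phi :: 'a^'n \<Rightarrow> real) (A :: nat \<Rightarrow> 'a^'n \<Rightarrow> 'a^'n^'n) (b :: nat \<Rightarrow> 'a^'n \<Rightarrow> complex).
           Phi \<in> borel_measurable M \<and> (\<forall>y. 0 \<le> Phi y) \<and>
           (\<forall>i<m. \<forall>j k. (\<lambda>y. A i y $ j $ k) \<in> measurable M (Qp_space p absp)) \<and>
           (\<forall>i<m. AE y in M. invertible (A i y)) \<and>
           (\<forall>i<m. in_CMO p absp M w (r i) (b i)) \<and>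
           C10 p absp M m Phi A zeta delta r q lam < \<infinity>
           \<longrightarrow>
           (\<forall>f :: nat \<Rightarrow> 'a^'n \<Rightarrow> complex.
              (\<forall>i<m. in_Bdot p absp M w (q i) (lam i) (f i)) \<longrightarrow>
              (AE x in M. integrable M (hausdorff_comm_integrand absp m Phi A b f x)) \<and>
              in_Bdot p absp M w qs (\<Sum>i<m. lam i) (hausdorff_comm absp M m Phi A b f) \<and>
              Bdot_norm p absp M w qs (\<Sum>i<m. lam i) (hausdorff_comm absp M m Phi A b f)
                \<le> C * enn2real (C10 p absp M m Phi A zeta delta r q lam) *
                   (\<Prod>i<m. CMO_norm p absp M w (r i) (b i)) *
                   (\<Prod>i<m. Bdot_norm p absp M w (q i) (lam i) (f i)))"
proof -
  interpret weighted_haar p absp M zeta w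
    using Qp haar zeta Aw by unfold_locales
  let ?R = "crit_index p absp M w"
  \<comment> \<open>The total Hoelder exponent of the factors other than the weight. The hypothesis
    on the exponents says \<open>u < 1 - 1 / ?R\<close>, equivalently
    \<open>1 / (1 - u) < ?R\<close>.\<close>
  define u where "u = ((\<Sum>i<m. 1 / r i) + (\<Sum>i<m. 1 / q i)) * zeta * qs"
  have R: "1 < ?R" using delta by simp
  have "u * (?R / (?R - 1)) < 1"
    using exps qs unfolding u_def by (simp add: field_simps)
  then have "u < 1 - 1 / ?R" using R by (simp add: field_simps)
  moreover have "0 < 1 / ?R" using R by simp
  ultimately have u: "u < 1" "1 / ?R < 1 - u" by linarith+
  then have "1 / (1 - u) < ?R" using R by (simp add: field_simps)
  then have "max delta (1 / (1 - u)) < Sup (RH_set p absp M w)"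
    using delta by (simp add: crit_index_def)
  \<comment> \<open>Exceeding \<open>delta\<close> gives the expansion bound with the exponent
    \<open>(delta - 1) / delta\<close>; exceeding \<open>1 / (1 - u)\<close> leaves
    \<open>1 / \<rho> \<le> 1 - u\<close> for the weight. The critical index itself need not belong
    to the set, so the strict inequalities are essential here.\<close>
  then obtain \<rho> where \<rho>: "\<rho> \<in> RH_set p absp M w" "max delta (1 / (1 - u)) < \<rho>"
    using less_cSup_iff[OF rw_fin] by blast
  then obtain C where C: "is_RH \<rho> C" using RH_set_is_RH by blast
  have "1 / \<rho> \<le> 1 - u"
    using \<rho>(2) u delta by (simp add: field_simps)
  then have e: "((\<Sum>i<m. 1 / r i) + (\<Sum>i<m. 1 / q i)) * zeta * qs + 1 / \<rho> \<le> 1"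
    by (simp add: u_def)
  have d: "1 < delta" "delta \<le> \<rho>" using \<rho>(2) delta by auto
  define D where "D = max CA C"
  have D: "CA \<le> D" "C \<le> D" by (auto simp: D_def)
  show ?thesis
  proof (intro exI[of _ "C * (\<Prod>i<m. 9 * CA * p powr real CARD('n) * (CA * D powr (- lam i)))"] allI impI,
      elim conjE)
    fix Phi :: "'a^'n \<Rightarrow> real" and A :: "nat \<Rightarrow> 'a^'n \<Rightarrow> 'a^'n^'n" and b f :: "nat \<Rightarrow> 'a^'n \<Rightarrow> complex"
    assume h: "Phi \<in> borel_measurable M" "\<forall>y. 0 \<le> Phi y"
      "\<forall>i<m. \<forall>j k. (\<lambda>y. A i y $ j $ k) \<in> measurable M Q" "\<forall>i<m. AE y in M. invertible (A i y)"
      "\<forall>i<m. in_CMO p absp M w (r i) (b i)" "C10 p absp M m Phi A zeta delta r q lam < \<infinity>"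
      "\<forall>i<m. in_Bdot p absp M w (q i) (lam i) (f i)"
    have *: "i < m \<Longrightarrow> 1 \<le> r i" "i < m \<Longrightarrow> zeta \<le> r i" "i < m \<Longrightarrow> 1 \<le> q i" "i < m \<Longrightarrow> lam i < 0"
      "0 \<le> Phi y" "i < m \<Longrightarrow> (\<lambda>y. A i y $ j $ k) \<in> measurable M Q" "i < m \<Longrightarrow> AE y in M. invertible (A i y)"
      "i < m \<Longrightarrow> in_CMO p absp M w (r i) (b i)" "i < m \<Longrightarrow> in_Bdot p absp M w (q i) (lam i) (f i)" for i j k y
      using r_ge zeta_r q_ge lam h by auto
    note main = hausdorff_comm_bound[OF qs *(1-4) C d D e h(1) *(5-8) h(6) *(9)]
    show "(AE x in M. integrable M (hausdorff_comm_integrand absp m Phi A b f x)) \<and>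
      in_Bdot p absp M w qs (\<Sum>i<m. lam i) (hausdorff_comm absp M m Phi A b f) \<and>
      Bdot_norm p absp M w qs (\<Sum>i<m. lam i) (hausdorff_comm absp M m Phi A b f)
      \<le> C * (\<Prod>i<m. 9 * CA * p powr real CARD('n) * (CA * D powr (- lam i))) *
        enn2real (C10 p absp M m Phi A zeta delta r q lam) *
        (\<Prod>i<m. CMO_norm p absp M w (r i) (b i)) *
        (\<Prod>i<m. Bdot_norm p absp M w (q i) (lam i) (f i))"
      by (intro conjI main)
  qed
qed

end
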